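(* Every smooth $3$-dimensional lattice prismatoid has a unimodular cover.
   Context: The lattice is $\mathbb{Z}^3\subset\mathbb{R}^3$. A lattice polytope is the convex hull of finitely many lattice points. A prismatoid is a polytope whose vertices all lie in two parallel facets; a lattice prismatoid is a prismatoid that is a lattice polytope. In particular, a $3$-dimensional lattice prismatoid is, up to unimodular equivalence (lattice-preserving affine transformation), of the form $\mathrm{conv}(Q_1\times\{0\}\cup Q_2\times\{k\})$ with $Q_1,Q_2\subset\mathbb{R}^2$ two-dimensional lattice polygons and $k$ a positive integer. A lattice polytope is smooth if it is simple and the primitive edge directions at every vertex form a linear basis for the lattice. A unimodular tetrahedron is a lattice tetrahedron whose edge vectors from one vertex form a basis of $\mathbb{Z}^3$ (normalized volume $1$). A unimodular cover of a $3$-dimensional lattice polytope is a collection of unimodular tetrahedra whose union equals the polytope. *)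

theory Defs
  imports "HOL-Analysis.Analysis"
begin

definition int_lattice :: "(real ^ 3) set" where
  "int_lattice = {x. \<forall>i. x $ i \<in> \<int>}"

definition lattice_polytope :: "(real ^ 3) set \<Rightarrow> bool" where
  "lattice_polytope P \<longleftrightarrow> (\<exists>V. finite V \<and> V \<subseteq> int_lattice \<and> P = convex hull V)"

definition prismatoid :: "'a::euclidean_space set \<Rightarrow> bool" where
  "prismatoid P \<longleftrightarrow> polytope P \<and>
     (\<exists>F G. F facet_of P \<and> G facet_of P \<and> F \<noteq> G \<and>
        affine_parallel (affine hull F) (affine hull G) \<and>
        {v. v extreme_point_of P} \<subseteq> F \<union> G)"

definition lattice_prismatoid :: "(real ^ 3) set \<Rightarrow> bool" where
  "lattice_prismatoid P \<longleftrightarrow> prismatoid P \<and> lattice_polytope P"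

definition simple_polytope :: "'a::euclidean_space set \<Rightarrow> bool" where
  "simple_polytope P \<longleftrightarrow> polytope P \<and>
     (\<forall>v. v extreme_point_of P \<longrightarrow> int (card {e. e edge_of P \<and> v \<in> e}) = aff_dim P)"

definition lattice_basis :: "(real ^ 3) set \<Rightarrow> bool" where
  "lattice_basis B \<longleftrightarrow> finite B \<and> independent B \<and>
     {\<Sum>b\<in>B. of_int (c b) *\<^sub>R b | c :: real ^ 3 \<Rightarrow> int. True} = int_lattice"

definition primitive_vector :: "real ^ 3 \<Rightarrow> bool" where
  "primitive_vector u \<longleftrightarrow> u \<in> int_lattice \<and> u \<noteq> 0 \<and> open_segment 0 u \<inter> int_lattice = {}"

text \<open>Edge directions at \<open>v\<close> point away from \<open>v\<close>, so each edge at a vertex \<open>v\<close> of a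
  lattice polytope contributes exactly one primitive vector.\<close>

definition primitive_edge_directions :: "(real ^ 3) set \<Rightarrow> real ^ 3 \<Rightarrow> (real ^ 3) set" where
  "primitive_edge_directions P v =
     {u. primitive_vector u \<and>
         (\<exists>w t. closed_segment v w edge_of P \<and> t > 0 \<and> w - v = t *\<^sub>R u)}"

text \<open>The basis condition refers to the whole lattice, so this notion is meant for
  full-dimensional polytopes only.\<close>

definition smooth_polytope :: "(real ^ 3) set \<Rightarrow> bool" where
  "smooth_polytope P \<longleftrightarrow> lattice_polytope P \<and> simple_polytope P \<and>
     (\<forall>v. v extreme_point_of P \<longrightarrow> lattice_basis (primitive_edge_directions P v))"

definition unimodular_tetrahedron :: "(real ^ 3) set \<Rightarrow> bool" where
  "unimodular_tetrahedron T \<longleftrightarrow> 3 simplex T \<and> lattice_polytope T \<and>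
     (\<exists>v. v extreme_point_of T \<and> lattice_basis {w - v | w. w extreme_point_of T \<and> w \<noteq> v})"

definition unimodular_cover :: "(real ^ 3) set set \<Rightarrow> (real ^ 3) set \<Rightarrow> bool" where
  "unimodular_cover \<T> P \<longleftrightarrow> (\<forall>T\<in>\<T>. unimodular_tetrahedron T) \<and> \<Union>\<T> = P"

end

theory Submission
  imports Defs
begin

text \<open>Smoothness gives, at every vertex of the bottom facet, two primitive edge directions \<open>a\<close>, \<open>b\<close> inside the facet
  and a third one of lattice height one, which leads to the top facet. Hence every slice at an integer height is a lattice
  polygon, and all slices share the same pairs of edge directions. It remains to cover the slab
  between two consecutive slices \<open>S\<close>, \<open>S'\<close>, i.e. to write each point of \<open>(1-t)S + tS'\<close> as
  \<open>(1-t)p + tq\<close> with \<open>p\<close> a lattice point, or \<open>q\<close> a lattice point, or \<open>p\<close>, \<open>q\<close> on lattice segments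
  of determinant one.

  A smooth polygon either has two parallel edges, horizontal after a change of coordinates, or is a multiple of a
  unimodular triangle. In both cases each integer row contains a lattice point, so a pair \<open>(p,q)\<close> with \<open>q\<close> between two
  lattice points of a row can be slid horizontally until \<open>p\<close> meets a segment joining lattice points of adjacent rows
  or \<open>q\<close> becomes a lattice point. The points covered in this way form intervals, one for each way of
  placing \<open>p\<close> or \<open>q\<close> on an integer row. The outermost intervals reach the boundary because the extreme pairs
  involve a vertex, and consecutive intervals cannot leave a gap, because a gap would force the boundary of a slice
  to be steep at the bottom left and at the top right, which makes its rows too wide.\<close>

section \<open>Sums of two planar convex sets\<close>

text \<open>A unimodular tetrahedron between two consecutive lattice planes has three vertices in
  one plane and one in the other, or two in each; this is the origin of the three kinds of pairs.
  The kinds with a lattice point need no further choice, because every lattice polygon is covered by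
  unimodular triangles.

  The obstacle is that \<open>S\<close> and \<open>S'\<close> may have quite different edge lengths;
  only their edge directions agree. A gap between neighbouring intervals is therefore converted into
  inequalities for inverse slopes of one slice, the only data that can be transported, and refuted
  in the other slice.

  The alternative for smooth polygons comes from looking at the part of the polygon farthest from a
  given edge. If it is not an edge, it is a vertex, which becomes the new origin. In these
  coordinates the given edge maximises a functional with positive coefficients, and the determinant
  one at every corner leaves only parallel edges or the three corners of a unimodular
  triangle.\<close>

definition int_pt :: "real \<times> real \<Rightarrow> bool" where
  "int_pt p \<longleftrightarrow> fst p \<in> \<int> \<and> snd p \<in> \<int>"

definition det2 :: "real \<times> real \<Rightarrow> real \<times> real \<Rightarrow> real" where
  "det2 u w = fst u * snd w - snd u * fst w"

text \<open>A lattice point \<open>p\<close> is the apex over a unimodular triangle of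
  \<open>S'\<close> around \<open>q\<close>, and vice versa; the last disjunct is the join of two
  segments, whose normalized volume between consecutive planes is the absolute determinant.
  Triangles are not mentioned, since \<open>polygon_unimodular_triangle\<close> always supplies
  them.\<close>

definition sum_cov :: "real \<Rightarrow> (real \<times> real) set \<Rightarrow> (real \<times> real) set \<Rightarrow> real \<times> real \<Rightarrow> bool" where
  "sum_cov t S S' y \<longleftrightarrow> (\<exists>p\<in>S. \<exists>q\<in>S'. y = (1-t) *\<^sub>R p + t *\<^sub>R q \<and>
     (int_pt p \<or> int_pt q \<or>
      (\<exists>a\<in>S. \<exists>b\<in>S. \<exists>c\<in>S'. \<exists>d\<in>S'. int_pt a \<and> int_pt b \<and> int_pt c \<and> int_pt d \<and>
         p \<in> closed_segment a b \<and> q \<in> closed_segment c d \<and> \<bar>det2 (b - a) (d - c)\<bar> = 1)))"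

lemma convexD_pair:
  fixes S :: "(real \<times> real) set"
  assumes "convex S" "(x1,y1) \<in> S" "(x2,y2) \<in> S" "0 \<le> w" "w \<le> 1"
    "x = x1 + w * (x2 - x1)" "y = y1 + w * (y2 - y1)"
  shows "(x,y) \<in> S"
proof -
  have "(1-w) *\<^sub>R (x1,y1) + w *\<^sub>R (x2,y2) \<in> S"
    using assms by (intro convexD) auto
  moreover have "(1-w) *\<^sub>R (x1,y1) + w *\<^sub>R (x2,y2) = (x,y)"
    using assms by (simp add: algebra_simps)
  ultimately show ?thesis by simp
qed

lemma convex_row:
  fixes S :: "(real \<times> real) set"
  assumes "convex S" "(x1,y) \<in> S" "(x2,y) \<in> S" "x1 \<le> x" "x \<le> x2"
  shows "(x,y) \<in> S"
proof (cases "x1 = x2")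
  case True then show ?thesis using assms by auto
next
  case False
  then have "x1 < x2" using assms by auto
  then show ?thesis
    using assms by (intro convexD_pair[OF assms(1-3), of "(x-x1)/(x2-x1)"]) (auto simp: field_simps)
qed

lemma convex_between_rows:
  fixes S :: "(real \<times> real) set"
  assumes "convex S" "(x1,y1) \<in> S" "(x2,y2) \<in> S" "y1 \<le> y" "y \<le> y2"
  shows "\<exists>x. (x,y) \<in> S"
proof (cases "y1 = y2")
  case True then show ?thesis using assms by (metis order.antisym)
next
  case False
  then have "y1 < y2" using assms by auto
  then show ?thesis
    using assms by (intro exI[of _ "x1 + (y-y1)/(y2-y1) * (x2-x1)"]
      convexD_pair[OF assms(1-3), of "(y-y1)/(y2-y1)"]) (auto simp: field_simps)
qed

text \<open>\<open>p\<close> moves to \<open>r\<close> while \<open>q\<close> moves backwards on the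
  line through \<open>c\<close> and \<open>d\<close>, keeping the sum fixed. Either \<open>p\<close>
  arrives while \<open>q\<close> is still in the segment, and \<open>fin\<close> applies, or
  \<open>q\<close> meets one of the lattice points \<open>c\<close>, \<open>d\<close> on the
  way.\<close>

lemma sum_cov_slide:
  assumes S: "convex S" and t: "0 < t" "t < 1"
    and p: "p \<in> S" and q: "q \<in> closed_segment c d" and cd: "c \<in> S'" "d \<in> S'" "int_pt c" "int_pt d"
    and rS: "r \<in> S" and par: "r - p = k *\<^sub>R (d - c)"
    and fin: "\<And>q'. q' \<in> closed_segment c d \<Longrightarrow> sum_cov t S S' ((1-t) *\<^sub>R r + t *\<^sub>R q')"
  shows "sum_cov t S S' ((1-t) *\<^sub>R p + t *\<^sub>R q)"
proof -
  obtain u where u: "0 \<le> u" "u \<le> 1" "q = (1-u) *\<^sub>R c + u *\<^sub>R d"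
    using q by (auto simp: in_segment)
  \<comment> \<open>The position of \<open>q\<close> on the line through \<open>c\<close> and
    \<open>d\<close> at the moment when \<open>p\<close> reaches \<open>r\<close>; the factor
    \<open>(1-t)/t\<close> balances the weights.\<close>
  define v where "v = u - k * ((1-t)/t)"
  have main: "(1-t) *\<^sub>R (p + (l * k) *\<^sub>R (d - c)) + t *\<^sub>R ((1 - w) *\<^sub>R c + w *\<^sub>R d) = (1-t) *\<^sub>R p + t *\<^sub>R q"
    if "w = u - l * k * ((1-t)/t)" for l w
  proof -
    have "t * w = t * u - l * k * (1-t)" using that t by (simp add: field_simps)
    then have "(1-t) * (l*k) + t * w = t * u" by (simp add: algebra_simps)
    moreover have "(1-t) *\<^sub>R (p + (l * k) *\<^sub>R (d - c)) + t *\<^sub>R ((1 - w) *\<^sub>R c + w *\<^sub>R d)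
       = (1-t) *\<^sub>R p + t *\<^sub>R c + ((1-t) * (l*k) + t * w) *\<^sub>R (d - c)"
      by (simp add: algebra_simps)
    moreover have "(1-t) *\<^sub>R p + t *\<^sub>R q = (1-t) *\<^sub>R p + t *\<^sub>R c + (t * u) *\<^sub>R (d - c)"
      unfolding u(3) by (simp add: algebra_simps)
    ultimately show ?thesis by simp
  qed
  have inS: "p + (l * k) *\<^sub>R (d - c) \<in> S" if "0 \<le> l" "l \<le> 1" for l
  proof -
    have "(1-l) *\<^sub>R p + l *\<^sub>R r \<in> S" using S p rS that by (intro convexD) auto
    moreover have "(1-l) *\<^sub>R p + l *\<^sub>R r = p + l *\<^sub>R (r - p)" by (simp add: algebra_simps)
    ultimately show ?thesis using par by simp
  qed
  show ?thesis
  proof (cases "0 \<le> v \<and> v \<le> 1")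
    case True
    have q': "(1 - v) *\<^sub>R c + v *\<^sub>R d \<in> closed_segment c d"
      using True by (auto simp: in_segment)
    have e: "(1-t) *\<^sub>R p + t *\<^sub>R q = (1-t) *\<^sub>R r + t *\<^sub>R ((1 - v) *\<^sub>R c + v *\<^sub>R d)"
    proof -
      have "r = p + (1 * k) *\<^sub>R (d - c)" using par by (simp add: diff_eq_eq add.commute)
      then show ?thesis using main[of v 1] by (simp add: v_def)
    qed
    show ?thesis unfolding e by (rule fin[OF q'])
  next
    case False
    \<comment> \<open>\<open>q\<close> leaves the segment too early: \<open>g\<close> is the
      parameter of the endpoint it hits, and \<open>l\<close> below is the fraction of the way from
      \<open>p\<close> to \<open>r\<close> covered by then.\<close>
    define g where "g = (if v < 0 then 0 else (1::real))"
    have "\<exists>l. 0 \<le> l \<and> l \<le> 1 \<and> g = u - l * (u - v)"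
    proof (cases "v < 0")
      case True
      have "u / (u - v) \<le> 1" "0 \<le> u/(u-v)" "u / (u - v) * (u - v) = u" using True u by (auto simp: field_simps)
      then show ?thesis using True by (intro exI[of _ "u/(u-v)"]) (auto simp: g_def)
    next
      case F: False
      then have v: "v > 1" using False by auto
      have "(1-u) / (v-u) \<le> 1" "0 \<le> (1-u) / (v-u)" "(1-u) / (v-u) * (u - v) = - (1-u)" using v u
        by (auto simp: field_simps)
      then show ?thesis using F by (intro exI[of _ "(1-u)/(v-u)"]) (auto simp: g_def)
    qed
    then obtain l where l: "0 \<le> l" "l \<le> 1" "g = u - l * (u - v)" by auto
    have "g = u - l * k * ((1-t)/t)" using l by (simp add: v_def)
    note m = main[OF this]
    have "int_pt ((1 - g) *\<^sub>R c + g *\<^sub>R d)" "(1 - g) *\<^sub>R c + g *\<^sub>R d \<in> S'" using cd by (auto simp: g_def)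
    then show ?thesis unfolding sum_cov_def using m inS[OF l(1,2)] by metis
  qed
qed

text \<open>For non-integral \<open>y\<close> the two lattice points span a segment of vertical
  extent one that crosses row \<open>y\<close>; the slide in \<open>row_cover\<close> ends on
  it.\<close>

definition rows_full :: "(real \<times> real) set \<Rightarrow> bool" where
  "rows_full S \<longleftrightarrow> (\<forall>x y. (x,y) \<in> S \<longrightarrow>
     (\<exists>n::int. (of_int n, of_int \<lfloor>y\<rfloor>) \<in> S) \<and> (\<exists>n::int. (of_int n, of_int \<lceil>y\<rceil>) \<in> S))"

text \<open>Horizontal slide of \<open>q\<close> within a unit cell of its row. The target of
  \<open>p\<close> is a lattice point of its row if \<open>h\<close> is integral, otherwise the
  crossing with a lattice segment between adjacent rows; such a segment has determinant one with a
  horizontal unit segment.\<close>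

lemma row_cover:
  assumes S: "convex S" "convex S'" and t: "0 < t" "t < 1" and full: "rows_full S"
    and p: "(px, h) \<in> S" and m: "(m1, k) \<in> S'" "(m2, k) \<in> S'" "m1 \<in> \<int>" "m2 \<in> \<int>" "k \<in> \<int>"
    and q: "m1 \<le> qx" "qx \<le> m2"
  shows "sum_cov t S S' ((1-t) * px + t * qx, (1-t) * h + t * k)"
proof -
  obtain n n' :: int where n: "(of_int n, of_int \<lfloor>h\<rfloor>) \<in> S" "(of_int n', of_int \<lceil>h\<rceil>) \<in> S"
    using full p unfolding rows_full_def by blast
  have qS: "(qx, k) \<in> S'" using convex_row[OF S(2) m(1,2) q] .
  show ?thesis
  proof (cases "qx \<in> \<int>")
    case True
    then have "int_pt (qx,k)" using m by (simp add: int_pt_def)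
    then show ?thesis unfolding sum_cov_def using p qS
      by (intro bexI[of _ "(px,h)"] bexI[of _ "(qx,k)"]) auto
  next
    case qnz: False
    define c where "c = (of_int \<lfloor>qx\<rfloor> :: real, k)"
    define d where "d = (of_int \<lfloor>qx\<rfloor> + 1 :: real, k)"
    have fl: "of_int \<lfloor>qx\<rfloor> < qx" using qnz by (metis Ints_of_int of_int_floor_le order_less_le)
    have "m1 \<le> of_int \<lfloor>qx\<rfloor>" using q m by (metis Ints_cases le_floor_iff of_int_le_iff)
    moreover have "of_int \<lfloor>qx\<rfloor> + 1 \<le> m2" 
  proof -
    obtain z where z: "m2 = of_int z" using m(4) by (elim Ints_cases)
    then have "real_of_int \<lfloor>qx\<rfloor> < of_int z" using q fl by linarith
    then have "\<lfloor>qx\<rfloor> + 1 \<le> z" by simp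
    then show ?thesis unfolding z by (metis of_int_1 of_int_add of_int_le_iff)
  qed

    ultimately have cd: "c \<in> S'" "d \<in> S'" unfolding c_def d_def
      using fl q by (auto intro!: convex_row[OF S(2) m(1,2)])
    have q: "(qx,k) \<in> closed_segment c d" unfolding in_segment c_def d_def
      by (rule exI[of _ "qx - \<lfloor>qx\<rfloor>"]) (use fl in \<open>auto simp: algebra_simps\<close>, linarith)
    have icd: "int_pt c" "int_pt d" using m by (auto simp: int_pt_def c_def d_def)
    show ?thesis
    proof (cases "h \<in> \<int>")
      case True
      then have nS: "(of_int n, h) \<in> S" using n by (auto elim!: Ints_cases)
      have par: "(of_int n, h) - (px,h) = (of_int n - px) *\<^sub>R (d - c)" by (auto simp: d_def c_def prod_eq_iff)
      have "sum_cov t S S' ((1-t) *\<^sub>R (px,h) + t *\<^sub>R (qx,k))"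
      proof (rule sum_cov_slide[OF S(1) t p q cd icd nS par])
        fix q' assume "q' \<in> closed_segment c d"
        then have "q' \<in> S'" using S(2) cd closed_segment_subset by blast
        then show "sum_cov t S S' ((1-t) *\<^sub>R (of_int n, h) + t *\<^sub>R q')"
          using nS True unfolding sum_cov_def int_pt_def
          by (intro bexI[of _ "(of_int n, h)"] bexI[of _ q']) auto
      qed
      then show ?thesis by simp
    next
      case False
      define a where "a = (of_int n :: real, of_int \<lfloor>h\<rfloor> :: real)"
      define b where "b = (of_int n' :: real, of_int \<lceil>h\<rceil> :: real)"
      have ce: "\<lceil>h\<rceil> = \<lfloor>h\<rfloor> + 1" using False by (metis Ints_of_int ceiling_altdef)
      define r where "r = (1 - (h - \<lfloor>h\<rfloor>)) *\<^sub>R a + (h - \<lfloor>h\<rfloor>) *\<^sub>R b"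
      have r: "r \<in> closed_segment a b" unfolding r_def in_segment
        by (rule exI[of _ "h - \<lfloor>h\<rfloor>"]) (auto, linarith)
      have "snd r = h" by (simp add: r_def a_def b_def ce algebra_simps)
      then have par: "r - (px,h) = (fst r - px) *\<^sub>R (d - c)" by (auto simp: d_def c_def prod_eq_iff)
      have "sum_cov t S S' ((1-t) *\<^sub>R (px,h) + t *\<^sub>R (qx,k))"
      proof (rule sum_cov_slide[OF S(1) t p q cd icd _ par])
        have ab: "a \<in> S" "b \<in> S" "int_pt a" "int_pt b" using n by (auto simp: a_def b_def int_pt_def)
        show rS: "r \<in> S" using r S(1) ab closed_segment_subset by blast
        fix q' assume q': "q' \<in> closed_segment c d"
        then have "q' \<in> S'" using S(2) cd closed_segment_subset by blast
        moreover have "\<bar>det2 (b - a) (d - c)\<bar> = 1" by (simp add: det2_def a_def b_def c_def d_def ce)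
        ultimately show "sum_cov t S S' ((1-t) *\<^sub>R r + t *\<^sub>R q')"
          using rS r q' ab cd icd unfolding sum_cov_def by blast
      qed
      then show ?thesis by simp
    qed
  qed
qed

section \<open>Polygons with two parallel edges\<close>

lemma int_greatest_exists:
  fixes P :: "int \<Rightarrow> bool"
  assumes "P n0" "\<And>n. P n \<Longrightarrow> n \<le> B"
  shows "\<exists>n. P n \<and> (\<forall>m. P m \<longrightarrow> m \<le> n)"
proof -
  let ?A = "{m. P m \<and> n0 \<le> m}"
  have "?A \<subseteq> {n0..B}" using assms by auto
  then have f: "finite ?A" using finite_subset by blast
  have "n0 \<in> ?A" using assms by auto
  then have "Max ?A \<in> ?A" using f by (metis Max_in empty_iff)
  moreover have "m \<le> Max ?A" if "P m" for m
  proof (cases "n0 \<le> m")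
    case True then show ?thesis using that f by auto
  next
    case False then show ?thesis using \<open>Max ?A \<in> ?A\<close> by auto
  qed
  ultimately show ?thesis by blast
qed

text \<open>The mirror image exchanges left and right corners, so that each one-sided statement
  below yields its counterpart.\<close>

definition hflip :: "(real \<times> real) set \<Rightarrow> (real \<times> real) set" where
  "hflip S = {(x,y). (-x,y) \<in> S}"

lemma mem_hflip [simp]: "(x,y) \<in> hflip S \<longleftrightarrow> (-x,y) \<in> S"
  by (simp add: hflip_def)

lemma convex_hflip: "convex S \<Longrightarrow> convex (hflip S)"
proof -
  assume c: "convex S"
  have "linear (\<lambda>p::real \<times> real. (- fst p, snd p))" by (intro linearI) (auto simp: algebra_simps)
  from convex_linear_vimage[OF this c] show "convex (hflip S)"
    by (simp add: hflip_def vimage_def case_prod_unfold)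
qed

text \<open>The slopes are inverse, \<open>dx/dy\<close>: \<open>mB\<close>, \<open>rB\<close> belong to the left and right edges at the bottom
  edge \<open>[b1,b2]\<close>, and \<open>mT\<close>, \<open>rT\<close> to those at the top edge \<open>[t1,t2]\<close>.\<close>

locale two_parallel_edges =
  fixes S :: "(real \<times> real) set" and h0 h1 b1 b2 t1 t2 mB rB mT rT :: int
  assumes cvx: "convex S"
    and h: "h0 < h1" and b: "b1 < b2" and t: "t1 < t2"
    and mem: "(of_int b1, of_int h0) \<in> S" "(of_int b2, of_int h0) \<in> S"
      "(of_int t1, of_int h1) \<in> S" "(of_int t2, of_int h1) \<in> S"
    and mem': "(of_int (b1 + mB), of_int (h0 + 1)) \<in> S" "(of_int (t2 - rT), of_int (h1 - 1)) \<in> S"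
      "(of_int (b2 + rB), of_int (h0 + 1)) \<in> S" "(of_int (t1 - mT), of_int (h1 - 1)) \<in> S"
    and bounds: "\<And>x y. (x,y) \<in> S \<Longrightarrow> of_int h0 \<le> y" "\<And>x y. (x,y) \<in> S \<Longrightarrow> y \<le> of_int h1"
      "\<And>x y. (x,y) \<in> S \<Longrightarrow> of_int b1 + of_int mB * (y - of_int h0) \<le> x"
      "\<And>x y. (x,y) \<in> S \<Longrightarrow> x \<le> of_int b2 + of_int rB * (y - of_int h0)"
      "\<And>x y. (x,y) \<in> S \<Longrightarrow> of_int t1 + of_int mT * (y - of_int h1) \<le> x"
      "\<And>x y. (x,y) \<in> S \<Longrightarrow> x \<le> of_int t2 + of_int rT * (y - of_int h1)"
begin

lemma flip: "two_parallel_edges (hflip S) h0 h1 (-b2) (-b1) (-t2) (-t1) (-rB) (-mB) (-rT) (-mT)"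
proof (unfold_locales, goal_cases)
  case 1 show ?case using cvx by (rule convex_hflip)
next
  case (15 x y) then show ?case using bounds(4)[of "-x" y] by simp
next
  case (16 x y) then show ?case using bounds(3)[of "-x" y] by simp
next
  case (17 x y) then show ?case using bounds(6)[of "-x" y] by simp
next
  case (18 x y) then show ?case using bounds(5)[of "-x" y] by simp
qed (use h b t mem mem' bounds in \<open>auto simp: algebra_simps\<close>)

text \<open>The segment from the bottom left vertex to \<open>(x2,y2)\<close> crosses row
  \<open>y1\<close> strictly to the right of the line of inverse slope \<open>\<sigma>\<close>
  through \<open>(x2,y2)\<close>, so its inverse slope is less than \<open>\<sigma>\<close>. By the
  supporting line of the left edge, \<open>mB\<close> is at most that inverse slope.\<close>

lemma slope_mB:
  fixes \<sigma> :: int and x1 x2 y1 y2 :: real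
  assumes "(x1,y1) \<in> S" "(x2,y2) \<in> S" "y1 < y2" "\<And>x. (x,y1) \<in> S \<Longrightarrow> x > x2 - \<sigma> * (y2 - y1)"
  shows "mB < \<sigma>"
proof -
  have h: "of_int h0 \<le> y1" using bounds assms by blast
  define D where "D = y2 - of_int h0"
  have D: "D > 0" using h assms(3) by (simp add: D_def)
  define w where "w = (y1 - of_int h0) / D"
  have w: "0 \<le> w" "w \<le> 1" "w * D = y1 - of_int h0" using D h assms(3) by (auto simp: w_def D_def field_simps)
  have "(of_int b1 + w * (x2 - of_int b1), y1) \<in> S"
    by (rule convexD_pair[OF cvx mem(1) assms(2) w(1,2)]) (use w in \<open>auto simp: D_def\<close>)
  from assms(4)[OF this] have "(x2 - of_int b1) * (1 - w) < \<sigma> * (y2 - y1)" by (simp add: algebra_simps)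
  moreover have "y2 - y1 = D * (1 - w)" using w by (simp add: D_def algebra_simps)
  moreover have "of_int mB * D \<le> x2 - of_int b1" using bounds(3)[OF assms(2)] by (simp add: D_def)
  then have "of_int mB * D * (1 - w) \<le> (x2 - of_int b1) * (1-w)" using w by (intro mult_right_mono) auto
  ultimately have "of_int mB * (D * (1 - w)) < \<sigma> * (D * (1-w))" by (simp add: algebra_simps)
  moreover have "D * (1 - w) > 0" using \<open>y2 - y1 = D * (1 - w)\<close> assms(3) by simp
  ultimately have "real_of_int mB < of_int \<sigma>" by (simp only: mult_less_cancel_right_pos)
  then show ?thesis by simp
qed

text \<open>The argument of \<open>slope_mB\<close> at the opposite corner, with the segment from
  \<open>(x1,y1)\<close> to the top right vertex and its crossing with row
  \<open>y2\<close>.\<close>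

lemma slope_rT:
  fixes \<sigma> :: int and x1 x2 y1 y2 :: real
  assumes "(x1,y1) \<in> S" "(x2,y2) \<in> S" "y1 < y2" "\<And>x. (x,y2) \<in> S \<Longrightarrow> x < x1 + \<sigma> * (y2 - y1)"
  shows "rT < \<sigma>"
proof -
  have h: "y2 \<le> of_int h1" using bounds assms by blast
  define D where "D = of_int h1 - y1"
  have D: "D > 0" using h assms(3) by (simp add: D_def)
  define w where "w = (y2 - y1) / D"
  have w: "0 < w" "w \<le> 1" "w * D = y2 - y1" using D h assms(3) by (auto simp: w_def D_def field_simps)
  have "(x1 + w * (of_int t2 - x1), y2) \<in> S"
    by (rule convexD_pair[OF cvx assms(1) mem(4), of w]) (use w in \<open>auto simp: D_def\<close>)
  then have "w * (of_int t2 - x1) < \<sigma> * (y2 - y1)" using assms(4) by fastforce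
  also have "\<sigma> * (y2 - y1) = w * (\<sigma> * D)" using w(3) by (metis mult.left_commute)
  finally have "w * (of_int t2 - x1) < w * (\<sigma> * D)" .
  then have "of_int t2 - x1 < \<sigma> * D" using w by (simp only: mult_less_cancel_left_pos)
  moreover have "of_int rT * D \<le> of_int t2 - x1" using bounds(6)[OF assms(1)] by (simp add: D_def algebra_simps)
  ultimately have "of_int rT * D < \<sigma> * D" by linarith
  then have "real_of_int rT < of_int \<sigma>" using D by (simp only: mult_less_cancel_right_pos)
  then show ?thesis by simp
qed

lemma slope_rB:
  fixes \<sigma> :: int and x1 x2 y1 y2 :: real
  assumes "(x1,y1) \<in> S" "(x2,y2) \<in> S" "y1 < y2" "\<And>x. (x,y1) \<in> S \<Longrightarrow> x < x2 - \<sigma> * (y2 - y1)"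
  shows "\<sigma> < rB"
proof -
  interpret M: two_parallel_edges "hflip S" h0 h1 "-b2" "-b1" "-t2" "-t1" "-rB" "-mB" "-rT" "-mT" by (rule flip)
  show ?thesis using M.slope_mB[of "-x1" y1 "-x2" y2 "-\<sigma>"] assms(1-3) assms(4)[of "- x" for x] by fastforce
qed

lemma slope_mT:
  fixes \<sigma> :: int and x1 x2 y1 y2 :: real
  assumes "(x1,y1) \<in> S" "(x2,y2) \<in> S" "y1 < y2" "\<And>x. (x,y2) \<in> S \<Longrightarrow> x > x1 + \<sigma> * (y2 - y1)"
  shows "\<sigma> < mT"
proof -
  interpret M: two_parallel_edges "hflip S" h0 h1 "-b2" "-b1" "-t2" "-t1" "-rB" "-mB" "-rT" "-mT" by (rule flip)
  show ?thesis using M.slope_rT[of "-x1" y1 "-x2" y2 "-\<sigma>"] assms(1-3) assms(4)[of "- x" for x] by fastforce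
qed

text \<open>The hypotheses on rows say that no lattice point of row \<open>i\<close> lies right of \<open>R\<close>, and none of row \<open>i + 1\<close>
  lies left of \<open>R + \<sigma>\<close>. Interpolation between the bottom and the top edge contradicts this.\<close>

lemma no_left_gap:
  fixes i \<sigma> :: int and R :: real
  assumes i: "h0 \<le> i" "i + 1 \<le> h1"
    and r0: "\<And>x. (x, of_int i) \<in> S \<Longrightarrow> x < R + 1"
    and r1: "\<And>x. (x, of_int i + 1) \<in> S \<Longrightarrow> x > R + \<sigma> - 1"
    and sl: "mB < \<sigma>" "rT < \<sigma>"
  shows False
proof -
  \<comment> \<open>One weight serves two segments: on the right from row \<open>h0\<close> to row
    \<open>h1 - 1\<close>, on the left from row \<open>h0 + 1\<close> to row \<open>h1\<close>; they
    meet rows \<open>i\<close> and \<open>i + 1\<close>. If \<open>h1 = h0 + 1\<close>, both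
    segments are horizontal and any weight would do.\<close>
  define w :: real where "w = (if h1 - 1 - h0 = 0 then 0 else (i - h0) / (h1 - 1 - h0))"
  have w: "0 \<le> w" "w \<le> 1" "w * (h1 - 1 - h0) = i - h0"
    using i h by (auto simp: w_def field_simps simp flip: of_int_add of_int_diff)
  have "(of_int b2 + w * (of_int (t2 - rT) - of_int b2), of_int i) \<in> S"
    by (rule convexD_pair[OF cvx mem(2) mem'(2) w(1,2)]) (use w in auto)
  from r0[OF this] have 1: "of_int b2 + w * (of_int (t2 - rT) - of_int b2) < R + 1" .
  have "(of_int (b1 + mB) + w * (of_int t1 - of_int (b1 + mB)), of_int i + 1) \<in> S"
    by (rule convexD_pair[OF cvx mem'(1) mem(3) w(1,2)]) (use w in \<open>auto simp: algebra_simps\<close>)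
  from r1[OF this] have 2: "of_int (b1 + mB) + w * (of_int t1 - of_int (b1 + mB)) > R + \<sigma> - 1" .
  \<comment> \<open>Edge lengths are at least one, and \<open>\<sigma>\<close> exceeds the integers
    \<open>mB\<close> and \<open>rT\<close> by at least one. The weighted sum of these surpluses is
    incompatible with the bounds \<open>1\<close> and \<open>2\<close>.\<close>
  have "real_of_int (b2 - b1 - 1 + (\<sigma> - mB - 1)) \<ge> 0" "real_of_int (t2 - t1 - 1 + (\<sigma> - rT - 1)) \<ge> 0"
    using b t sl by simp_all
  then have "(1-w) * real_of_int (b2 - b1 - 1 + (\<sigma> - mB - 1)) + w * real_of_int (t2 - t1 - 1 + (\<sigma> - rT - 1)) \<ge> 0"
    using w by (intro add_nonneg_nonneg mult_nonneg_nonneg) auto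
  with 1 2 show False by (simp add: algebra_simps)
qed

lemma no_right_gap:
  fixes i \<sigma> :: int and L :: real
  assumes i: "h0 \<le> i" "i + 1 \<le> h1"
    and r0: "\<And>x. (x, of_int i) \<in> S \<Longrightarrow> x > L - 1"
    and r1: "\<And>x. (x, of_int i + 1) \<in> S \<Longrightarrow> x < L + \<sigma> + 1"
    and sl: "\<sigma> < rB" "\<sigma> < mT"
  shows False
proof -
  interpret M: two_parallel_edges "hflip S" h0 h1 "-b2" "-b1" "-t2" "-t1" "-rB" "-mB" "-rT" "-mT" by (rule flip)
  have "x < - L + 1" if "(x, of_int i) \<in> hflip S" for x using r0[of "-x"] that by simp
  moreover have "x > - L + of_int (- \<sigma>) - 1" if "(x, of_int i + 1) \<in> hflip S" for x using r1[of "-x"] that by simp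
  ultimately show False using M.no_left_gap[OF i, of "- L" "- \<sigma>"] sl by simp
qed

text \<open>The bottom and the top edge have length at least one, and convexity lets the row lengths
  interpolate between them.\<close>

lemma unit_row:
  assumes "of_int h0 \<le> y" "y \<le> of_int h1"
  shows "\<exists>x. (x,y) \<in> S \<and> (x+1,y) \<in> S"
proof -
  define w where "w = (y - of_int h0) / (of_int h1 - of_int h0)"
  have w: "0 \<le> w" "w \<le> 1" "w * (of_int h1 - of_int h0) = y - of_int h0" using assms h by (auto simp: w_def field_simps)
  let ?l = "of_int b1 + w * (of_int t1 - of_int b1)" and ?r = "of_int b2 + w * (of_int t2 - of_int b2)"
  have l: "(?l, y) \<in> S" by (rule convexD_pair[OF cvx mem(1) mem(3) w(1,2)]) (use w in auto)
  have r: "(?r, y) \<in> S" by (rule convexD_pair[OF cvx mem(2) mem(4) w(1,2)]) (use w in auto)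
  have "real_of_int (b2 - b1 - 1) \<ge> 0" "real_of_int (t2 - t1 - 1) \<ge> 0" using b t by simp_all
  then have "(1-w) * real_of_int (b2 - b1 - 1) + w * real_of_int (t2 - t1 - 1) \<ge> 0"
    using w by (intro add_nonneg_nonneg mult_nonneg_nonneg) auto
  then have "?l + 1 \<le> ?r" by (simp add: algebra_simps)
  then have "(?l + 1, y) \<in> S" using convex_row[OF cvx l r] by simp
  then show ?thesis using l by blast
qed

lemma lattice_row:
  fixes i :: int
  assumes "h0 \<le> i" "i \<le> h1"
  shows "\<exists>n::int. (of_int n, of_int i) \<in> S"
proof -
  obtain x where x: "(x, of_int i) \<in> S" "(x+1, of_int i) \<in> S" using unit_row[of "of_int i"] assms by auto
  have "(of_int \<lceil>x\<rceil>, of_int i) \<in> S" by (rule convex_row[OF cvx x]) linarith+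
  then show ?thesis by blast
qed

lemma row_max:
  fixes i :: int
  assumes "h0 \<le> i" "i \<le> h1"
  shows "\<exists>n::int. (of_int n, of_int i) \<in> S \<and> (\<forall>x. (x, of_int i) \<in> S \<longrightarrow> x < of_int n + 1)"
proof -
  obtain n0 :: int where n0: "(of_int n0, of_int i) \<in> S" using lattice_row assms by blast
  have "n \<le> b2 + rB * (i - h0)" if "(of_int n, of_int i) \<in> S" for n
    using bounds(4)[OF that] by (simp flip: of_int_diff of_int_mult of_int_add)
  then obtain n where n: "(of_int n, of_int i) \<in> S" "\<And>m. (of_int m, of_int i) \<in> S \<Longrightarrow> m \<le> n"
    using int_greatest_exists[of "\<lambda>n. (of_int n, of_int i) \<in> S", OF n0] by blast
  have "x < of_int n + 1" if x: "(x, of_int i) \<in> S" for x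
  proof (rule ccontr)
    assume "\<not> x < of_int n + 1"
    then have "(of_int (n+1), of_int i) \<in> S" by (intro convex_row[OF cvx n(1) x]) auto
    from n(2)[OF this] show False by simp
  qed
  then show ?thesis using n by blast
qed

lemma row_min:
  fixes i :: int
  assumes "h0 \<le> i" "i \<le> h1"
  shows "\<exists>n::int. (of_int n, of_int i) \<in> S \<and> (\<forall>x. (x, of_int i) \<in> S \<longrightarrow> x > of_int n - 1)"
proof -
  interpret M: two_parallel_edges "hflip S" h0 h1 "-b2" "-b1" "-t2" "-t1" "-rB" "-mB" "-rT" "-mT" by (rule flip)
  obtain n where n: "(of_int n, of_int i) \<in> hflip S" "\<And>x. (x, of_int i) \<in> hflip S \<Longrightarrow> x < of_int n + 1"
    using M.row_max[OF assms] by blast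
  have "x > of_int (- n) - 1" if "(x, of_int i) \<in> S" for x using n(2)[of "-x"] that by simp
  then show ?thesis using n(1) by (intro exI[of _ "-n"]) auto
qed

lemma rows_full: "rows_full S"
  unfolding rows_full_def
proof (intro allI impI conjI)
  fix x y assume "(x,y) \<in> S"
  then have "of_int h0 \<le> y" "y \<le> of_int h1" using bounds by auto
  then show "\<exists>n::int. (of_int n, of_int \<lfloor>y\<rfloor>) \<in> S" "\<exists>n::int. (of_int n, of_int \<lceil>y\<rceil>) \<in> S"
    by (intro lattice_row; linarith)+
qed

end

section \<open>Events and the intervals covered at them\<close>

text \<open>Throughout, \<open>\<eta>\<close> is the height of \<open>p\<close>, and \<open>theta t yy \<eta>\<close> is the height of \<open>q\<close> for which
  \<open>(1-t)p + tq\<close> has height \<open>yy\<close>. An event is a pair of nonempty rows, one of them integral;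
  \<open>cset\<close> collects the abscissas of \<open>(1-t)p + tq\<close> where the point on the integral row is a lattice point.\<close>

definition theta :: "real \<Rightarrow> real \<Rightarrow> real \<Rightarrow> real" where
  "theta t yy \<eta> = (yy - (1-t) * \<eta>) / t"

definition cset :: "real \<Rightarrow> real \<Rightarrow> (real \<times> real) set \<Rightarrow> (real \<times> real) set \<Rightarrow> real \<Rightarrow> real set" where
  "cset t yy S S' \<eta> = {(1-t) * x + t * x' | x x'. (x,\<eta>) \<in> S \<and> (x', theta t yy \<eta>) \<in> S' \<and>
     (x \<in> \<int> \<and> \<eta> \<in> \<int> \<or> x' \<in> \<int> \<and> theta t yy \<eta> \<in> \<int>)}"

definition event :: "real \<Rightarrow> real \<Rightarrow> (real \<times> real) set \<Rightarrow> (real \<times> real) set \<Rightarrow> real \<Rightarrow> bool" where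
  "event t yy S S' \<eta> \<longleftrightarrow> (\<exists>x. (x,\<eta>) \<in> S) \<and> (\<exists>x'. (x', theta t yy \<eta>) \<in> S') \<and>
     (\<eta> \<in> \<int> \<or> theta t yy \<eta> \<in> \<int>)"

lemma csetI:
  assumes "(x,\<eta>) \<in> S" "(x', theta t yy \<eta>) \<in> S'" "x \<in> \<int> \<and> \<eta> \<in> \<int> \<or> x' \<in> \<int> \<and> theta t yy \<eta> \<in> \<int>"
  shows "(1-t) * x + t * x' \<in> cset t yy S S' \<eta>"
  using assms unfolding cset_def by blast

lemma theta_diff: "0 < t \<Longrightarrow> t * (theta t yy \<eta> - theta t yy \<eta>') = (1-t) * (\<eta>' - \<eta>)"
  by (simp add: theta_def field_simps)

lemma theta_eq: "0 < t \<Longrightarrow> (1-t) * \<eta> + t * theta t yy \<eta> = yy"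
  by (simp add: theta_def)

text \<open>The letters of the four cases tell which point is on an integral row at
  \<open>\<eta>\<close> and at \<open>\<eta>'\<close>: \<open>A\<close> for \<open>q\<close>,
  \<open>B\<close> for \<open>p\<close>. Taking lattice points extremal in their rows turns the gap
  into slope bounds for one slice. Both slices have the same \<open>mB\<close>, \<open>rB\<close>,
  \<open>mT\<close>, \<open>rT\<close>, so \<open>no_left_gap\<close> or \<open>no_right_gap\<close>
  refutes the bounds in the other slice.\<close>

lemma no_gap_between_events:
  assumes S: "two_parallel_edges S h0 h1 b1 b2 t1 t2 mB rB mT rT"
    and S': "two_parallel_edges S' h0' h1' b1' b2' t1' t2' mB rB mT rT"
    and t: "0 < t" "t < 1"
    and eta: "\<eta> < \<eta>'" and th: "th = theta t yy \<eta>" "th' = theta t yy \<eta>'"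
    and ev: "event t yy S S' \<eta>" "event t yy S S' \<eta>'"
    and j: "of_int j \<le> \<eta>" "\<eta>' \<le> of_int j + 1" and i: "of_int i \<le> th'" "th \<le> of_int i + 1"
    and e: "\<eta> = of_int j \<or> th = of_int i + 1" and e': "\<eta>' = of_int j + 1 \<or> th' = of_int i"
    and L: "\<And>c. c \<in> cset t yy S S' \<eta> \<Longrightarrow> yx < c" and R: "\<And>c. c \<in> cset t yy S S' \<eta>' \<Longrightarrow> c < yx"
  shows False
proof -
  interpret S: two_parallel_edges S h0 h1 b1 b2 t1 t2 mB rB mT rT by (rule S)
  interpret T: two_parallel_edges S' h0' h1' b1' b2' t1' t2' mB rB mT rT by (rule S')
  have td: "t * (th - th') = (1-t) * (\<eta>' - \<eta>)" unfolding th by (rule theta_diff[OF t(1)])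
  have "t * (th - th') > 0" unfolding td using t eta by simp
  then have tlt: "th' < th" using t by (simp add: zero_less_mult_iff)
  obtain x0 x0' where x0: "(x0,\<eta>) \<in> S" "(x0',\<eta>') \<in> S" using ev unfolding event_def by blast
  obtain q0 q0' where q0: "(q0,th) \<in> S'" "(q0',th') \<in> S'" using ev unfolding event_def th by blast
  have LA: "yx < (1-t) * x + t * of_int m" if "th = of_int i + 1" "(x,\<eta>) \<in> S" "(of_int m, of_int i + 1) \<in> S'" for x and m :: int
    by (rule L, rule csetI) (use that th in auto)
  have LB: "yx < (1-t) * of_int n + t * q" if "\<eta> = of_int j" "(of_int n, of_int j) \<in> S" "(q,th) \<in> S'" for q and n :: int
    by (rule L, rule csetI) (use that th in auto)
  have RA: "(1-t) * x + t * of_int m < yx" if "th' = of_int i" "(x,\<eta>') \<in> S" "(of_int m, of_int i) \<in> S'" for x and m :: int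
    by (rule R, rule csetI) (use that th in auto)
  have RB: "(1-t) * of_int n + t * q < yx" if "\<eta>' = of_int j + 1" "(of_int n, of_int j + 1) \<in> S" "(q,th') \<in> S'" for q and n :: int
    by (rule R, rule csetI) (use that th in auto)
  have "of_int h0 \<le> \<eta>" "\<eta>' \<le> of_int h1" "of_int h0' \<le> th'" "th \<le> of_int h1'"
    using S.bounds(1)[OF x0(1)] S.bounds(2)[OF x0(2)] T.bounds(1)[OF q0(2)] T.bounds(2)[OF q0(1)] by auto
  then have "of_int h0 < real_of_int (j+1)" "real_of_int j < of_int h1" "of_int h0' < real_of_int (i+1)" "real_of_int i < of_int h1'"
    using eta tlt i j by auto
  then have hj: "h0 \<le> j" "j + 1 \<le> h1" "h0' \<le> i" "i + 1 \<le> h1'" by simp_all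
  have ij: "h0 \<le> j + 1" "j \<le> h1" "h0' \<le> i + 1" "i \<le> h1'" using hj by auto
  consider (AA) "th = of_int i + 1" "th' = of_int i" | (BB) "\<eta> = of_int j" "\<eta>' = of_int j + 1"
    | (AB) "th = of_int i + 1" "\<eta>' = of_int j + 1" | (BA) "\<eta> = of_int j" "th' = of_int i" using e e' by blast
  then show False
  proof cases
    case AA
    obtain m where m: "(of_int m, of_int (i+1)) \<in> S'" "\<And>x. (x, of_int (i+1)) \<in> S' \<Longrightarrow> x > of_int m - 1"
      using T.row_min[OF ij(3) hj(4)] by blast
    obtain m' where m': "(of_int m', of_int i) \<in> S'" "\<And>x. (x, of_int i) \<in> S' \<Longrightarrow> x < of_int m' + 1"
      using T.row_max[OF hj(3) ij(4)] by blast
    define \<sigma> where "\<sigma> = m - m'"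
    \<comment> \<open>Here \<open>q\<close> descends by exactly one, so
      \<open>t = (1-t) * (\<eta>' - \<eta>)\<close> and the weights cancel. The result bounds the
      inverse slopes of \<open>S\<close>; the contradiction arises in \<open>S'\<close>.\<close>
    have key: "x' - x < \<sigma> * (\<eta>' - \<eta>)" if "(x,\<eta>) \<in> S" "(x',\<eta>') \<in> S" for x x'
    proof -
      have "(1-t) * x' + t * of_int m' < (1-t) * x + t * of_int m"
        using LA[of x m] RA[of x' m'] m m' that AA by auto
      then have "(1-t) * (x' - x) < t * \<sigma>" by (simp add: \<sigma>_def algebra_simps)
      also have "t * \<sigma> = ((1-t) * (\<eta>' - \<eta>)) * \<sigma>" using td AA by simp
      finally have "(1-t) * (x' - x) < (1-t) * (\<sigma> * (\<eta>' - \<eta>))" by (simp add: mult_ac)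
      then show ?thesis using t by simp
    qed
    have "mB < \<sigma>" by (rule S.slope_mB[OF x0 eta]) (use key[of _ x0'] x0 in fastforce)
    moreover have "rT < \<sigma>" by (rule S.slope_rT[OF x0 eta]) (use key[of x0] x0 in fastforce)
    ultimately show False
      using T.no_left_gap[OF hj(3,4), of "of_int m'" \<sigma>] m m' by (fastforce simp: \<sigma>_def)
  next
    case BB
    obtain n where n: "(of_int n, of_int j) \<in> S" "\<And>x. (x, of_int j) \<in> S \<Longrightarrow> x > of_int n - 1"
      using S.row_min[OF hj(1) ij(2)] by blast
    obtain n' where n': "(of_int n', of_int (j+1)) \<in> S" "\<And>x. (x, of_int (j+1)) \<in> S \<Longrightarrow> x < of_int n' + 1"
      using S.row_max[OF ij(1) hj(2)] by blast
    define \<sigma> where "\<sigma> = n' - n"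
    \<comment> \<open>Now \<open>p\<close> climbs a full row, so the roles are exchanged: the slope
      bounds come from \<open>S'\<close> and the contradiction from \<open>S\<close>.\<close>
    have key: "q' < q - \<sigma> * (th - th')" if "(q,th) \<in> S'" "(q',th') \<in> S'" for q q'
    proof -
      have "(1-t) * n' + t * q' < (1-t) * n + t * q"
        using LB[of n q] RB[of n' q'] n n' that BB by auto
      then have *: "(1-t) * \<sigma> < t * (q - q')" by (simp add: \<sigma>_def algebra_simps)
      have e: "t * (th - th') = 1 - t" using td BB by simp
      have e2: "t * (\<sigma> * (th - th')) = \<sigma> * (t * (th - th'))" by (simp only: mult_ac)
      have "t * (\<sigma> * (th - th')) < t * (q - q')" unfolding e2 e using * by (simp only: mult_ac)
      then show ?thesis using t by simp
    qed
    have "\<sigma> < rB" by (rule T.slope_rB[OF q0(2,1) tlt]) (use key[of q0] q0 in fastforce)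
    moreover have "\<sigma> < mT" by (rule T.slope_mT[OF q0(2,1) tlt]) (use key[of _ q0'] q0 in fastforce)
    ultimately show False
      using S.no_right_gap[OF hj(1,2), of "of_int n" \<sigma>] n n' by (fastforce simp: \<sigma>_def)
  next
    case AB
    obtain n where n: "(of_int n, of_int (j+1)) \<in> S" "\<And>x. (x, of_int (j+1)) \<in> S \<Longrightarrow> x < of_int n + 1"
      using S.row_max[OF ij(1) hj(2)] by blast
    obtain m where m: "(of_int m, of_int (i+1)) \<in> S'" "\<And>x. (x, of_int (i+1)) \<in> S' \<Longrightarrow> x > of_int m - 1"
      using T.row_min[OF ij(3) hj(4)] by blast
    obtain r where r: "(of_int r, of_int i) \<in> S'" "\<And>x. (x, of_int i) \<in> S' \<Longrightarrow> x < of_int r + 1"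
      using T.row_max[OF hj(3) ij(4)] by blast
    define \<sigma> where "\<sigma> = m - r"
    \<comment> \<open>The non-integral rows are reached by interpolating between the extremal
      lattice point and an arbitrary point of the neighbouring integral row. By \<open>td\<close>
      the two interpolation weights are inversely proportional to \<open>t\<close> and
      \<open>1-t\<close>, so everything but the differences cancels.\<close>
    have key: "\<xi> - m < \<zeta> - n" if \<xi>: "(\<xi>, of_int i) \<in> S'" and \<zeta>: "(\<zeta>, of_int j) \<in> S" for \<xi> \<zeta>
    proof -
      have 1: "(of_int m + (th - th') * (\<xi> - of_int m), th') \<in> S'"
        by (rule convexD_pair[OF T.cvx m(1) \<xi>, of "th - th'"]) (use tlt i AB in auto)
      have 2: "(of_int n + (\<eta>' - \<eta>) * (\<zeta> - of_int n), \<eta>) \<in> S"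
        by (rule convexD_pair[OF S.cvx n(1) \<zeta>, of "\<eta>' - \<eta>"]) (use eta j AB in auto)
      have "(1-t) * n + t * (of_int m + (th - th') * (\<xi> - of_int m))
          < (1-t) * (of_int n + (\<eta>' - \<eta>) * (\<zeta> - of_int n)) + t * m"
        using LA[OF AB(1) 2] RB[OF AB(2) _ 1] n(1) m(1) by fastforce
      then have "(t * (th - th')) * (\<xi> - m) < ((1-t) * (\<eta>' - \<eta>)) * (\<zeta> - n)"
        by (simp add: algebra_simps)
      then show ?thesis unfolding td using t eta by (simp add: mult_less_cancel_left_pos)
    qed
    \<comment> \<open>\<open>n\<close> controls row \<open>j + 1\<close> only up to one unit; the
      unit segment in row \<open>j\<close> makes up for this in the bound for
      \<open>rT\<close>.\<close>
    obtain \<zeta> where \<zeta>: "(\<zeta>, of_int j) \<in> S" "(\<zeta> + 1, of_int j) \<in> S" using S.unit_row[of "of_int j"] hj ij by auto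
    have "mB < \<sigma>"
    proof (rule S.slope_mB[OF \<zeta>(1) n(1)])
      fix x assume "(x, real_of_int j) \<in> S"
      from key[OF r(1) this]
      show "real_of_int n - real_of_int \<sigma> * (real_of_int (j + 1) - real_of_int j) < x" by (simp add: \<sigma>_def)
    qed simp
    moreover have "rT < \<sigma>"
    proof (rule S.slope_rT[OF \<zeta>(2) n(1)])
      fix x assume "(x, real_of_int (j + 1)) \<in> S"
      then have "x < of_int n + 1" by (rule n)
      then show "x < \<zeta> + 1 + real_of_int \<sigma> * (real_of_int (j + 1) - real_of_int j)"
        using key[OF r(1) \<zeta>(1)] by (simp add: \<sigma>_def)
    qed simp
    ultimately show False
      using T.no_left_gap[OF hj(3,4), of "of_int r" \<sigma>] m r by (fastforce simp: \<sigma>_def)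
  next
    case BA
    obtain n where n: "(of_int n, of_int j) \<in> S" "\<And>x. (x, of_int j) \<in> S \<Longrightarrow> x > of_int n - 1"
      using S.row_min[OF hj(1) ij(2)] by blast
    obtain m where m: "(of_int m, of_int i) \<in> S'" "\<And>x. (x, of_int i) \<in> S' \<Longrightarrow> x < of_int m + 1"
      using T.row_max[OF hj(3) ij(4)] by blast
    obtain r where r: "(of_int r, of_int (j+1)) \<in> S" "\<And>x. (x, of_int (j+1)) \<in> S \<Longrightarrow> x < of_int r + 1"
      using S.row_max[OF ij(1) hj(2)] by blast
    define \<sigma> where "\<sigma> = r - n"
    \<comment> \<open>The interpolation of the previous case, now towards the upper neighbouring
      rows.\<close>
    have key: "\<zeta> - n < \<xi> - m" if \<xi>: "(\<xi>, of_int (i+1)) \<in> S'" and \<zeta>: "(\<zeta>, of_int (j+1)) \<in> S" for \<xi> \<zeta>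
    proof -
      have 1: "(of_int m + (th - th') * (\<xi> - of_int m), th) \<in> S'"
        by (rule convexD_pair[OF T.cvx m(1) \<xi>, of "th - th'"]) (use tlt i BA in auto)
      have 2: "(of_int n + (\<eta>' - \<eta>) * (\<zeta> - of_int n), \<eta>') \<in> S"
        by (rule convexD_pair[OF S.cvx n(1) \<zeta>, of "\<eta>' - \<eta>"]) (use eta j BA in auto)
      have "(1-t) * (of_int n + (\<eta>' - \<eta>) * (\<zeta> - of_int n)) + t * m
          < (1-t) * n + t * (of_int m + (th - th') * (\<xi> - of_int m))"
        using LB[OF BA(1) n(1) 1] RA[OF BA(2) 2 m(1)] by fastforce
      then have "((1-t) * (\<eta>' - \<eta>)) * (\<zeta> - n) < (t * (th - th')) * (\<xi> - m)"
        by (simp add: algebra_simps)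
      then show ?thesis unfolding td using t eta by (simp add: mult_less_cancel_left_pos)
    qed
    obtain \<xi> where \<xi>: "(\<xi>, of_int (i+1)) \<in> S'" "(\<xi> + 1, of_int (i+1)) \<in> S'" using T.unit_row[of "of_int (i+1)"] hj ij by auto
    have "\<sigma> < mT"
    proof (rule T.slope_mT[OF m(1) \<xi>(1)])
      fix x assume "(x, real_of_int (i + 1)) \<in> S'"
      from key[OF this r(1)]
      show "real_of_int m + real_of_int \<sigma> * (real_of_int (i + 1) - real_of_int i) < x" by (simp add: \<sigma>_def)
    qed simp
    moreover have "\<sigma> < rB"
    proof (rule T.slope_rB[OF m(1) \<xi>(2)])
      fix x assume "(x, real_of_int i) \<in> S'"
      then have "x < of_int m + 1" by (rule m)
      then show "x < \<xi> + 1 - real_of_int \<sigma> * (real_of_int (i + 1) - real_of_int i)"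
        using key[OF \<xi>(1) r(1)] by (simp add: \<sigma>_def)
    qed simp
    ultimately show False
      using S.no_right_gap[OF hj(1,2), of "of_int n" \<sigma>] n r by (fastforce simp: \<sigma>_def)
  qed
qed

lemma event_hflip [simp]: "event t yy (hflip S) (hflip S') = event t yy S S'"
  by (auto simp: event_def fun_eq_iff; metis add.inverse_inverse)

lemma cset_hflip: "c \<in> cset t yy (hflip S) (hflip S') \<eta> \<longleftrightarrow> - c \<in> cset t yy S S' \<eta>"
proof -
  have 1: "- c \<in> cset t yy S S' \<eta>" if *: "c \<in> cset t yy (hflip S) (hflip S') \<eta>" for c S S'
  proof -
    obtain x x' where x: "c = (1-t) * x + t * x'" "(-x,\<eta>) \<in> S" "(-x', theta t yy \<eta>) \<in> S'"
      "x \<in> \<int> \<and> \<eta> \<in> \<int> \<or> x' \<in> \<int> \<and> theta t yy \<eta> \<in> \<int>" using * unfolding cset_def mem_hflip by blast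
    show ?thesis unfolding cset_def using x
      by (intro CollectI exI[of _ "-x"] exI[of _ "-x'"]) (auto simp: algebra_simps)
  qed
  have "hflip (hflip S) = S" for S by (auto simp: hflip_def)
  then show ?thesis using 1[of c S S'] 1[of "-c" "hflip S" "hflip S'"] by auto
qed

text \<open>Rows between nonempty rows are nonempty by convexity, so an integral height strictly in
  between would be an event. Hence \<open>p\<close> stays in one strip, and so does
  \<open>q\<close>, which descends while \<open>p\<close> rises.\<close>

lemma consecutive_events:
  assumes S: "convex S" "convex S'" and t: "0 < t" "t < 1"
    and eta: "\<eta> < \<eta>'" and th: "th = theta t yy \<eta>" "th' = theta t yy \<eta>'"
    and ev: "event t yy S S' \<eta>" "event t yy S S' \<eta>'"
    and no: "\<And>x. \<eta> < x \<Longrightarrow> x < \<eta>' \<Longrightarrow> \<not> event t yy S S' x"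
  shows "\<exists>j i :: int. of_int j \<le> \<eta> \<and> \<eta>' \<le> of_int j + 1 \<and> of_int i \<le> th' \<and> th \<le> of_int i + 1 \<and>
     (\<eta> = of_int j \<or> th = of_int i + 1) \<and> (\<eta>' = of_int j + 1 \<or> th' = of_int i)"
proof -
  have mono: "theta t yy a < theta t yy b" if "b < a" for a b
  proof -
    have "t * (theta t yy b - theta t yy a) > 0" unfolding theta_diff[OF t(1)] using that t by simp
    then show ?thesis using t by (simp add: zero_less_mult_iff)
  qed
  have tlt: "th' < th" unfolding th by (rule mono[OF eta])
  have rows: "\<exists>x. (x,a) \<in> S" "\<exists>x. (x,theta t yy a) \<in> S'" if "\<eta> < a" "a < \<eta>'" for a
    using ev that mono[OF that(1)] mono[OF that(2)] unfolding event_def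
    by (metis convex_between_rows[OF S(1)] less_imp_le, metis convex_between_rows[OF S(2)] less_imp_le)
  have no': "a \<notin> \<int>" "theta t yy a \<notin> \<int>" if "\<eta> < a" "a < \<eta>'" for a
    using no[OF that] rows[OF that] unfolding event_def by auto
  define j where "j = \<lfloor>\<eta>\<rfloor>"
  \<comment> \<open>Rounding from above: \<open>q\<close> descends from \<open>th\<close>, so for
    integral \<open>th\<close> the relevant strip is the one below it.\<close>
  define i where "i = \<lceil>th\<rceil> - 1"
  have j: "of_int j \<le> \<eta>" "\<eta> < of_int j + 1" unfolding j_def by linarith+
  have i: "of_int i < th" "th \<le> of_int i + 1" unfolding i_def by linarith+
  have j1: "\<eta>' \<le> of_int j + 1"
    using no'(1)[of "of_int j + 1"] j by (metis Ints_1 Ints_add Ints_of_int not_le)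
  have i1: "of_int i \<le> th'"
  proof (rule ccontr)
    assume n: "\<not> of_int i \<le> th'"
    define a where "a = (yy - t * of_int i) / (1-t)"
    have ta: "theta t yy a = of_int i" using t by (simp add: theta_def a_def)
    have "\<eta> < a" by (rule ccontr) (use mono[of a \<eta>] ta i th in \<open>auto simp: not_less order.order_iff_strict\<close>)
    moreover have "a < \<eta>'" by (rule ccontr) (use mono[of \<eta>' a] ta n th in \<open>auto simp: not_less order.order_iff_strict\<close>)
    ultimately show False using no'(2)[of a] ta by auto
  qed
  have "\<eta> = of_int j \<or> th = of_int i + 1"
    using ev(1) unfolding event_def j_def i_def th by (auto elim!: Ints_cases)
  moreover have "\<eta>' = of_int j + 1 \<or> th' = of_int i"
  proof -
    have "\<eta>' \<in> \<int> \<or> th' \<in> \<int>" using ev(2) unfolding event_def th by auto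
    then show ?thesis
    proof
      assume "\<eta>' \<in> \<int>" then obtain z where z: "\<eta>' = of_int z" by (elim Ints_cases)
      have "of_int j < real_of_int z" "real_of_int z \<le> of_int (j+1)" using j j1 eta z by auto
      then have "z = j + 1" by linarith
      then show ?thesis using z by simp
    next
      assume "th' \<in> \<int>" then obtain z where z: "th' = of_int z" by (elim Ints_cases)
      have "of_int i \<le> real_of_int z" "real_of_int z < of_int (i+1)" using i i1 tlt z by auto
      then have "z = i" by linarith
      then show ?thesis using z by simp
    qed
  qed
  ultimately show ?thesis using j i1 i j1 by blast
qed

lemma sum_cov_swap: "sum_cov (1-t) S' S y \<Longrightarrow> sum_cov t S S' y"
proof -
  have d: "\<bar>det2 u v\<bar> = \<bar>det2 v u\<bar>" for u v by (simp add: det2_def abs_minus_commute mult.commute)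
  assume "sum_cov (1-t) S' S y"
  moreover have e: "1 - (1 - t) = t" by simp
  ultimately obtain p q where pq: "p \<in> S'" "q \<in> S" "y = t *\<^sub>R p + (1-t) *\<^sub>R q" 
    and *: "int_pt p \<or> int_pt q \<or>
      (\<exists>a\<in>S'. \<exists>b\<in>S'. \<exists>c\<in>S. \<exists>d\<in>S. int_pt a \<and> int_pt b \<and> int_pt c \<and> int_pt d \<and>
         p \<in> closed_segment a b \<and> q \<in> closed_segment c d \<and> \<bar>det2 (b - a) (d - c)\<bar> = 1)"
    unfolding sum_cov_def e by blast
  have "int_pt q \<or> int_pt p \<or>
      (\<exists>a\<in>S. \<exists>b\<in>S. \<exists>c\<in>S'. \<exists>d\<in>S'. int_pt a \<and> int_pt b \<and> int_pt c \<and> int_pt d \<and>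
         q \<in> closed_segment a b \<and> p \<in> closed_segment c d \<and> \<bar>det2 (b - a) (d - c)\<bar> = 1)"
    using * by (metis d)
  moreover have "y = (1-t) *\<^sub>R q + t *\<^sub>R p" using pq by simp
  ultimately show ?thesis unfolding sum_cov_def using pq(1,2) by blast
qed

text \<open>Both points move linearly from the first pair to the second. The sum sweeps the whole
  interval while \<open>q\<close> stays between the lattice points \<open>m1\<close> and
  \<open>m2\<close>, so \<open>row_cover\<close> applies at each position.\<close>

lemma sum_cov_between:
  assumes S: "convex S" "convex S'" and t: "0 < t" "t < 1" and full: "rows_full S"
    and p: "(x1, h) \<in> S" "(x2, h) \<in> S" and m: "(m1, k) \<in> S'" "(m2, k) \<in> S'" "m1 \<in> \<int>" "m2 \<in> \<int>" "k \<in> \<int>"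
    and y: "(1-t) * x1 + t * m1 \<le> yx" "yx \<le> (1-t) * x2 + t * m2"
  shows "sum_cov t S S' (yx, (1-t) * h + t * k)"
proof -
  define c1 c2 where "c1 = (1-t) * x1 + t * m1" and "c2 = (1-t) * x2 + t * m2"
  have c: "c1 \<le> yx" "yx \<le> c2" using y by (auto simp: c1_def c2_def)
  obtain w where w: "0 \<le> w" "w \<le> 1" "yx = c1 + w * (c2 - c1)"
  proof (cases "c1 = c2")
    case True then show ?thesis using that[of 0] c by simp
  next
    case False
    then show ?thesis using that[of "(yx - c1) / (c2 - c1)"] c by (simp add: field_simps)
  qed
  define px qx where "px = x1 + w * (x2 - x1)" and "qx = m1 + w * (m2 - m1)"
  have pS: "(px,h) \<in> S" by (rule convexD_pair[OF S(1) p w(1,2)]) (auto simp: px_def)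
  have yx: "yx = (1-t) * px + t * qx" unfolding w(3) c1_def c2_def px_def qx_def by (simp add: algebra_simps)
  show ?thesis
  proof (cases "m1 \<le> m2")
    case True
    have "0 \<le> w * (m2 - m1)" "0 \<le> (1-w) * (m2 - m1)" using w True by simp_all
    then have "m1 \<le> qx" "qx \<le> m2" by (auto simp: qx_def algebra_simps)
    then show ?thesis unfolding yx using row_cover[OF S t full pS m] by blast
  next
    case False
    have "0 \<le> w * (m1 - m2)" "0 \<le> (1-w) * (m1 - m2)" using w False by simp_all
    then have "m2 \<le> qx" "qx \<le> m1" by (auto simp: qx_def algebra_simps)
    then show ?thesis unfolding yx using row_cover[OF S t full pS m(2,1,4,3,5)] by blast
  qed
qed

text \<open>This makes an uncovered point lie strictly to one side of the whole \<open>cset\<close>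
  of every event, the basis of \<open>sum_cov_if_no_gap\<close>.\<close>

lemma event_side:
  assumes S: "convex S" "convex S'" and t: "0 < t" "t < 1" and full: "rows_full S" "rows_full S'"
    and c: "c1 \<in> cset t yy S S' \<eta>" "c2 \<in> cset t yy S S' \<eta>" and y: "c1 \<le> yx" "yx \<le> c2"
  shows "sum_cov t S S' (yx, yy)"
proof -
  let ?th = "theta t yy \<eta>"
  have yy: "(1-t) * \<eta> + t * ?th = yy" "(1-(1-t)) * ?th + (1-t) * \<eta> = yy"
    using theta_eq[OF t(1)] by (simp_all add: algebra_simps)
  have A: "sum_cov t S S' (yx, yy)"
    if "(x1,\<eta>) \<in> S" "(x2,\<eta>) \<in> S" "(m1,?th) \<in> S'" "(m2,?th) \<in> S'" "m1 \<in> \<int>" "m2 \<in> \<int>" "?th \<in> \<int>"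
      "(1-t) * x1 + t * m1 \<le> yx" "yx \<le> (1-t) * x2 + t * m2" for x1 x2 m1 m2
    using sum_cov_between[OF S t full(1) that] unfolding yy by simp
  have B: "sum_cov t S S' (yx, yy)"
    if "(x1,?th) \<in> S'" "(x2,?th) \<in> S'" "(n1,\<eta>) \<in> S" "(n2,\<eta>) \<in> S" "n1 \<in> \<int>" "n2 \<in> \<int>" "\<eta> \<in> \<int>"
      "(1-t) * n1 + t * x1 \<le> yx" "yx \<le> (1-t) * n2 + t * x2" for x1 x2 n1 n2
  proof (rule sum_cov_swap)
    have "sum_cov (1-t) S' S (yx, (1-(1-t)) * ?th + (1-t) * \<eta>)"
      by (rule sum_cov_between[OF S(2,1) _ _ full(2) that(1-7)]) (use t that(8,9) in \<open>auto simp: algebra_simps\<close>)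
    then show "sum_cov (1-t) S' S (yx,yy)" unfolding yy .
  qed
  obtain x1 x1' where 1: "c1 = (1-t) * x1 + t * x1'" "(x1,\<eta>) \<in> S" "(x1', ?th) \<in> S'"
    "x1 \<in> \<int> \<and> \<eta> \<in> \<int> \<or> x1' \<in> \<int> \<and> ?th \<in> \<int>" using c(1) unfolding cset_def by blast
  obtain x2 x2' where 2: "c2 = (1-t) * x2 + t * x2'" "(x2,\<eta>) \<in> S" "(x2', ?th) \<in> S'"
    "x2 \<in> \<int> \<and> \<eta> \<in> \<int> \<or> x2' \<in> \<int> \<and> ?th \<in> \<int>" using c(2) unfolding cset_def by blast
  note y1 = y(1)[unfolded 1(1)] and y2 = y(2)[unfolded 2(1)]
  consider "x1 \<in> \<int>" "\<eta> \<in> \<int>" "x2 \<in> \<int>" | "x1' \<in> \<int>" "?th \<in> \<int>" "x2' \<in> \<int>"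
    | "x1 \<in> \<int>" "\<eta> \<in> \<int>" "x2' \<in> \<int>" "?th \<in> \<int>" | "x1' \<in> \<int>" "\<eta> \<in> \<int>" "x2 \<in> \<int>" "?th \<in> \<int>"
    using 1(4) 2(4) by blast
  then show ?thesis
  proof cases
    case 1
    show ?thesis by (rule B[of x1' x2' x1 x2]) (use 1 y1 y2 \<open>(x1,\<eta>) \<in> S\<close> 2 \<open>(x1', ?th) \<in> S'\<close> in auto)
  next
    case 2
    show ?thesis by (rule A[of x1 x2 x1' x2']) (use 2 y1 y2 \<open>(x1,\<eta>) \<in> S\<close> \<open>(x2,\<eta>) \<in> S\<close> \<open>(x1', ?th) \<in> S'\<close> \<open>(x2', ?th) \<in> S'\<close> in auto)
  next
    case 3
    show ?thesis
    \<comment> \<open>Both rows are integral and the endpoints of the interval use lattice points on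
      different rows. The interval is split at the sum of the two lattice points: first
      \<open>q\<close> moves with \<open>p\<close> fixed, then \<open>p\<close> moves with
      \<open>q\<close> fixed.\<close>
    proof (cases "yx \<le> (1-t) * x1 + t * x2'")
      case True
      show ?thesis by (rule B[of x1' x2' x1 x1]) (use 3 y1 y2 True \<open>(x1,\<eta>) \<in> S\<close> 2 \<open>(x1', ?th) \<in> S'\<close> in auto)
    next
      case False
      show ?thesis by (rule A[of x1 x2 x2' x2']) (use 3 y1 y2 False \<open>(x1,\<eta>) \<in> S\<close> 2 \<open>(x1', ?th) \<in> S'\<close> in auto)
    qed
  next
    case 4
    show ?thesis
    proof (cases "yx \<le> (1-t) * x2 + t * x1'")
      case True
      show ?thesis by (rule A[of x1 x2 x1' x1']) (use 4 y1 y2 True \<open>(x1,\<eta>) \<in> S\<close> 2 \<open>(x1', ?th) \<in> S'\<close> in auto)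
    next
      case False
      show ?thesis by (rule B[of x1' x2' x2 x2]) (use 4 y1 y2 False \<open>(x1,\<eta>) \<in> S\<close> 2 \<open>(x1', ?th) \<in> S'\<close> in auto)
    qed
  qed
qed

lemma cset_nonempty:
  assumes full: "rows_full S" "rows_full S'" and e: "event t yy S S' \<eta>"
  shows "\<exists>c. c \<in> cset t yy S S' \<eta>"
proof -
  obtain x x' where x: "(x,\<eta>) \<in> S" "(x', theta t yy \<eta>) \<in> S'" using e by (auto simp: event_def)
  have lat: "\<exists>n. n \<in> \<int> \<and> (n, y) \<in> A" if "rows_full A" "(z,y) \<in> A" "y \<in> \<int>" for A z y
    using that unfolding rows_full_def by (metis Ints_cases Ints_of_int floor_of_int)
  from e have "\<eta> \<in> \<int> \<or> theta t yy \<eta> \<in> \<int>" by (auto simp: event_def)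
  then show ?thesis
  proof
    assume "\<eta> \<in> \<int>"
    then show ?thesis using lat[OF full(1) x(1)] csetI[OF _ x(2)] by blast
  next
    assume "theta t yy \<eta> \<in> \<int>"
    then show ?thesis using lat[OF full(2) x(2)] csetI[OF x(1)] by blast
  qed
qed

lemma finite_events:
  assumes t: "0 < t" "t < 1" and B: "\<And>x y. (x,y) \<in> S \<Longrightarrow> \<bar>y\<bar> \<le> B" "\<And>x y. (x,y) \<in> S' \<Longrightarrow> \<bar>y\<bar> \<le> B"
  shows "finite {\<eta>. event t yy S S' \<eta>}"
proof (rule finite_subset)
  let ?Z = "{k \<in> \<int>. \<bar>k\<bar> \<le> B} :: real set"
  show "{\<eta>. event t yy S S' \<eta>} \<subseteq> ?Z \<union> (\<lambda>k. (yy - t * k) / (1-t)) ` ?Z"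
  proof
    fix \<eta> assume "\<eta> \<in> {\<eta>. event t yy S S' \<eta>}"
    then have "\<bar>\<eta>\<bar> \<le> B" "\<bar>theta t yy \<eta>\<bar> \<le> B" "\<eta> \<in> \<int> \<or> theta t yy \<eta> \<in> \<int>" using B by (auto simp: event_def)
    moreover have "\<eta> = (yy - t * theta t yy \<eta>) / (1-t)" using theta_eq[of t \<eta> yy] t by (simp add: field_simps)
    ultimately show "\<eta> \<in> ?Z \<union> (\<lambda>k. (yy - t * k) / (1-t)) ` ?Z" by blast
  qed
  show "finite (?Z \<union> (\<lambda>k. (yy - t * k) / (1-t)) ` ?Z)" using finite_abs_int_segment[of B] by simp
qed

text \<open>A discrete intermediate value argument. For an uncovered point each event is of type
  \<open>L\<close> (its \<open>cset\<close> lies to the right of the point) or \<open>R\<close> (to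
  the left), and both types occur. A closest pair of opposite types has no event in between, which
  \<open>nogap\<close> excludes.\<close>

lemma sum_cov_if_no_gap:
  assumes S: "convex S" "convex S'" and t: "0 < t" "t < 1" and full: "rows_full S" "rows_full S'"
    and B: "\<And>x y. (x,y) \<in> S \<Longrightarrow> \<bar>y\<bar> \<le> B" "\<And>x y. (x,y) \<in> S' \<Longrightarrow> \<bar>y\<bar> \<le> B"
    and le: "\<exists>e c. event t yy S S' e \<and> c \<in> cset t yy S S' e \<and> c \<le> yx"
    and ge: "\<exists>e c. event t yy S S' e \<and> c \<in> cset t yy S S' e \<and> yx \<le> c"
    and nogap: "\<And>\<eta> \<eta>' :: real. \<lbrakk>\<eta> < \<eta>'; event t yy S S' \<eta>; event t yy S S' \<eta>';
        \<And>x. \<eta> < x \<Longrightarrow> x < \<eta>' \<Longrightarrow> \<not> event t yy S S' x;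
        (\<forall>c\<in>cset t yy S S' \<eta>. yx < c) \<and> (\<forall>c\<in>cset t yy S S' \<eta>'. c < yx) \<or>
        (\<forall>c\<in>cset t yy S S' \<eta>. c < yx) \<and> (\<forall>c\<in>cset t yy S S' \<eta>'. yx < c)\<rbrakk> \<Longrightarrow> False"
  shows "sum_cov t S S' (yx, yy)"
proof (rule ccontr)
  assume n: "\<not> sum_cov t S S' (yx, yy)"
  define L where "L e \<longleftrightarrow> event t yy S S' e \<and> (\<forall>c\<in>cset t yy S S' e. yx < c)" for e
  define R where "R e \<longleftrightarrow> event t yy S S' e \<and> (\<forall>c\<in>cset t yy S S' e. c < yx)" for e
  have side: "L e \<or> R e" if "event t yy S S' e" for e
    using event_side[OF S t full, of _ yy e _ yx] n that unfolding L_def R_def by (meson not_le)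
  have notboth: "\<not> (L e \<and> R e)" for e
    using cset_nonempty[OF full, of t yy e] unfolding L_def R_def by (metis order.asym)
  let ?P = "{(e,e'). L e \<and> R e'}"
  have fin: "finite ?P"
    by (rule finite_subset[of _ "{\<eta>. event t yy S S' \<eta>} \<times> {\<eta>. event t yy S S' \<eta>}"])
      (use finite_events[of t S B S' yy, OF t B] in \<open>auto simp: L_def R_def\<close>)
  obtain e1 where "R e1" using le side unfolding L_def R_def by (metis not_le)
  obtain e2 where "L e2" using ge side unfolding L_def R_def by (metis not_le)
  with \<open>R e1\<close> have ne: "?P \<noteq> {}" by auto
  let ?d = "\<lambda>p :: real \<times> real. \<bar>fst p - snd p\<bar>"
  have "Min (?d ` ?P) \<in> ?d ` ?P" using fin ne by (intro Min_in) auto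
  then obtain p where p: "p \<in> ?P" "?d p = Min (?d ` ?P)" by (metis (no_types, lifting) imageE)
  define e e' where "e = fst p" and "e' = snd p"
  have ee: "L e" "R e'" using p(1) by (auto simp: e_def e'_def)
  have min: "\<bar>e - e'\<bar> \<le> \<bar>a - b\<bar>" if "L a" "R b" for a b
  proof -
    have "Min (?d ` ?P) \<le> ?d (a,b)" by (rule Min_le) (use fin that in \<open>auto intro!: image_eqI[of _ _ "(a,b)"]\<close>)
    then show ?thesis using p(2) by (simp add: e_def e'_def)
  qed
  have "e \<noteq> e'" using ee notboth by blast
  then consider "e < e'" | "e' < e" by linarith
  then show False
  proof cases
    case 1
    have "\<not> event t yy S S' x" if "e < x" "x < e'" for x
      using side[of x] min[of x e'] min[of e x] ee that by (auto; linarith)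
    then show False using nogap[OF 1] ee unfolding L_def R_def by blast
  next
    case 2
    have "\<not> event t yy S S' x" if "e' < x" "x < e" for x
      using side[of x] min[of x e'] min[of e x] ee that by (auto; linarith)
    then show False using nogap[OF 2] ee unfolding L_def R_def by blast
  qed
qed

lemma two_parallel_edges_cover:
  assumes A: "two_parallel_edges S h0 h1 b1 b2 t1 t2 mB rB mT rT"
    and A': "two_parallel_edges S' h0' h1' b1' b2' t1' t2' mB rB mT rT"
    and t: "0 < t" "t < 1"
    and le: "\<exists>e c. event t yy S S' e \<and> c \<in> cset t yy S S' e \<and> c \<le> yx"
    and ge: "\<exists>e c. event t yy S S' e \<and> c \<in> cset t yy S S' e \<and> yx \<le> c"
  shows "sum_cov t S S' (yx, yy)"
proof -
  interpret S: two_parallel_edges S h0 h1 b1 b2 t1 t2 mB rB mT rT by (rule A)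
  interpret T: two_parallel_edges S' h0' h1' b1' b2' t1' t2' mB rB mT rT by (rule A')
  define B :: real where "B = max (max \<bar>h0\<bar> \<bar>h1\<bar>) (max \<bar>h0'\<bar> \<bar>h1'\<bar>)"
  have B: "\<bar>y\<bar> \<le> B" if "(x,y) \<in> S \<or> (x,y) \<in> S'" for x y
  proof -
    have "\<bar>real_of_int h0\<bar> \<le> B" "\<bar>real_of_int h1\<bar> \<le> B" "\<bar>real_of_int h0'\<bar> \<le> B" "\<bar>real_of_int h1'\<bar> \<le> B"
      by (simp_all add: B_def)
    then show ?thesis using that S.bounds(1,2)[of x y] T.bounds(1,2)[of x y] by (elim disjE) linarith+
  qed
  show ?thesis
  proof (rule sum_cov_if_no_gap[OF S.cvx T.cvx t S.rows_full T.rows_full _ _ le ge])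
    show "\<bar>y\<bar> \<le> B" if "(x,y) \<in> S" for x y using B that by blast
    show "\<bar>y\<bar> \<le> B" if "(x,y) \<in> S'" for x y using B that by blast
    fix \<eta> \<eta>' :: real
    assume lt: "\<eta> < \<eta>'" and ev: "event t yy S S' \<eta>" "event t yy S S' \<eta>'"
      and no: "\<And>x. \<eta> < x \<Longrightarrow> x < \<eta>' \<Longrightarrow> \<not> event t yy S S' x"
      and side: "(\<forall>c\<in>cset t yy S S' \<eta>. yx < c) \<and> (\<forall>c\<in>cset t yy S S' \<eta>'. c < yx) \<or>
        (\<forall>c\<in>cset t yy S S' \<eta>. c < yx) \<and> (\<forall>c\<in>cset t yy S S' \<eta>'. yx < c)"
    obtain j i :: int where ji: "of_int j \<le> \<eta>" "\<eta>' \<le> of_int j + 1" "of_int i \<le> theta t yy \<eta>'" "theta t yy \<eta> \<le> of_int i + 1"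
      "\<eta> = of_int j \<or> theta t yy \<eta> = of_int i + 1" "\<eta>' = of_int j + 1 \<or> theta t yy \<eta>' = of_int i"
      using consecutive_events[OF S.cvx T.cvx t lt refl refl ev no] by blast
    from side show False
    proof
      assume "(\<forall>c\<in>cset t yy S S' \<eta>. yx < c) \<and> (\<forall>c\<in>cset t yy S S' \<eta>'. c < yx)"
      then show False using no_gap_between_events[OF A A' t lt refl refl ev ji] by blast
    next
      \<comment> \<open>The opposite orientation becomes the first one after reflection, with
        \<open>- yx\<close> in place of \<open>yx\<close>.\<close>
      assume *: "(\<forall>c\<in>cset t yy S S' \<eta>. c < yx) \<and> (\<forall>c\<in>cset t yy S S' \<eta>'. yx < c)"
      have ev': "event t yy (hflip S) (hflip S') \<eta>" "event t yy (hflip S) (hflip S') \<eta>'" using ev by simp_all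
      have "- yx < c" if "c \<in> cset t yy (hflip S) (hflip S') \<eta>" for c
        using that * unfolding cset_hflip by fastforce
      moreover have "c < - yx" if "c \<in> cset t yy (hflip S) (hflip S') \<eta>'" for c
        using that * unfolding cset_hflip by fastforce
      ultimately show False using no_gap_between_events[OF S.flip T.flip t lt refl refl ev' ji] by blast
    qed
  qed
qed

section \<open>Multiples of the unimodular triangle\<close>

definition std_triangle :: "int \<Rightarrow> int \<Rightarrow> int \<Rightarrow> (real \<times> real) set" where
  "std_triangle x0 y0 N = {(x,y). of_int x0 \<le> x \<and> of_int y0 \<le> y \<and> x + y \<le> of_int N}"

lemma convex_std_triangle: "convex (std_triangle x0 y0 N)"
proof -
  have "std_triangle x0 y0 N =
      {p. (-1,0) \<bullet> p \<le> - of_int x0} \<inter> {p. (0,-1) \<bullet> p \<le> - of_int y0} \<inter> {p. (1,1) \<bullet> p \<le> real_of_int N}"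
    by (auto simp: std_triangle_def inner_prod_def)
  then show ?thesis by (simp add: convex_Int convex_halfspace_le)
qed

text \<open>The vertical left side meets every integral row of the triangle in the lattice point
  with abscissa \<open>x0\<close>.\<close>

lemma rows_full_std_triangle: "rows_full (std_triangle x0 y0 N)"
  unfolding rows_full_def
proof (intro allI impI conjI; intro exI[of _ x0])
  fix x y assume "(x, y) \<in> std_triangle x0 y0 N"
  then have *: "of_int y0 \<le> y" "y \<le> of_int (N - x0)" by (auto simp: std_triangle_def)
  then have "y0 \<le> \<lfloor>y\<rfloor>" "\<lceil>y\<rceil> \<le> N - x0" by (simp_all add: le_floor_iff ceiling_le_iff)
  moreover have "\<lfloor>y\<rfloor> \<le> \<lceil>y\<rceil>" by (meson floor_le_ceiling)
  ultimately have "y0 \<le> \<lfloor>y\<rfloor>" "x0 + \<lfloor>y\<rfloor> \<le> N" "y0 \<le> \<lceil>y\<rceil>" "x0 + \<lceil>y\<rceil> \<le> N" by linarith+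
  then show "(of_int x0, of_int \<lfloor>y\<rfloor>) \<in> std_triangle x0 y0 N"
      "(of_int x0, of_int \<lceil>y\<rceil>) \<in> std_triangle x0 y0 N"
    unfolding std_triangle_def by (simp_all flip: of_int_add)
qed

text \<open>Every \<open>cset\<close> reaches the common left boundary of the slab here, so no point lies to the left of a whole \<open>cset\<close>.\<close>

lemma std_triangle_cover:
  fixes x0 y0 N x0' y0' N' :: int
  defines "S \<equiv> std_triangle x0 y0 N" and "S' \<equiv> std_triangle x0' y0' N'"
  assumes t: "0 < t" "t < 1" and y: "(1-t) * of_int x0 + t * of_int x0' \<le> yx"
    and le: "\<exists>e c. event t yy S S' e \<and> c \<in> cset t yy S S' e \<and> c \<le> yx"
    and ge: "\<exists>e c. event t yy S S' e \<and> c \<in> cset t yy S S' e \<and> yx \<le> c"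
  shows "sum_cov t S S' (yx, yy)"
proof -
  define B where "B = \<bar>real_of_int y0\<bar> + \<bar>real_of_int (N - x0)\<bar> + \<bar>real_of_int y0'\<bar> + \<bar>real_of_int (N' - x0')\<bar>"
  have B: "\<bar>y\<bar> \<le> B" if "(x,y) \<in> S \<or> (x,y) \<in> S'" for x y
    using that unfolding S_def S'_def B_def std_triangle_def by auto
  have "convex S" "convex S'" "rows_full S" "rows_full S'"
    unfolding S_def S'_def by (rule convex_std_triangle rows_full_std_triangle)+
  then show ?thesis
  proof (rule sum_cov_if_no_gap[OF _ _ t _ _ _ _ le ge])
    show "\<bar>y\<bar> \<le> B" if "(x,y) \<in> S" for x y using B that by blast
    show "\<bar>y\<bar> \<le> B" if "(x,y) \<in> S'" for x y using B that by blast
    have *: "(1-t) * of_int x0 + t * of_int x0' \<in> cset t yy S S' \<eta>" if "event t yy S S' \<eta>" for \<eta>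
    proof (rule csetI)
      show "(real_of_int x0, \<eta>) \<in> S" "(real_of_int x0', theta t yy \<eta>) \<in> S'"
        using that unfolding event_def S_def S'_def std_triangle_def by auto
      show "real_of_int x0 \<in> \<int> \<and> \<eta> \<in> \<int> \<or> real_of_int x0' \<in> \<int> \<and> theta t yy \<eta> \<in> \<int>" using that unfolding event_def by simp
    qed
    fix \<eta> \<eta>'
    assume "event t yy S S' \<eta>" "event t yy S S' \<eta>'" "(\<forall>c\<in>cset t yy S S' \<eta>. yx < c) \<and> (\<forall>c\<in>cset t yy S S' \<eta>'. c < yx) \<or>
        (\<forall>c\<in>cset t yy S S' \<eta>. c < yx) \<and> (\<forall>c\<in>cset t yy S S' \<eta>'. yx < c)"
    then show False using * y by (meson not_le)
  qed
qed

section \<open>Extreme pairs\<close>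

text \<open>An exchange argument: among the pairs with sum at height \<open>yy\<close>, a minimiser
  is chosen extreme in the set of all minimisers. If neither component were a vertex, each could
  move both ways along a line, and suitable speeds keep the height; this contradicts extremality.
  The sign of \<open>\<sigma>\<close> selects the left or the right boundary.\<close>

lemma extreme_pair:
  fixes S S' :: "(real \<times> real) set"
  assumes S: "compact S" "convex S" "compact S'" "convex S'"
    and pq: "p0 \<in> S" "q0 \<in> S'" and yy: "snd ((1-t) *\<^sub>R p0 + t *\<^sub>R q0) = yy" and t: "0 < t" "t < 1"
  obtains p q where "p \<in> S" "q \<in> S'" "snd ((1-t) *\<^sub>R p + t *\<^sub>R q) = yy"
    "\<sigma> * fst ((1-t) *\<^sub>R p + t *\<^sub>R q) \<le> \<sigma> * fst ((1-t) *\<^sub>R p0 + t *\<^sub>R q0)"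
    "p extreme_point_of S \<or> q extreme_point_of S'"
proof -
  define g where "g = (\<lambda>z :: (real \<times> real) \<times> (real \<times> real). (1-t) *\<^sub>R fst z + t *\<^sub>R snd z)"
  have lin_g: "g (u *\<^sub>R a + v *\<^sub>R b) = u *\<^sub>R g a + v *\<^sub>R g b" for u v a b
    by (simp add: g_def algebra_simps)
  have cont: "continuous_on A g" for A unfolding g_def by (intro continuous_intros)
  define W where "W = (S \<times> S') \<inter> {z. snd (g z) = yy}"
  have "closed {z. snd (g z) = yy}"
    by (intro closed_Collect_eq continuous_intros cont)
  then have cW: "compact W" unfolding W_def using S by (intro compact_Int_closed compact_Times)
  have vx: "convex {z. snd (g z) = yy}"
    unfolding convex_def by (auto simp: lin_g algebra_simps simp flip: distrib_right)
  then have vW: "convex W" unfolding W_def using S by (intro convex_Int convex_Times)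
  have z0: "(p0,q0) \<in> W" using pq yy by (simp add: W_def g_def)
  define f where "f = (\<lambda>z. \<sigma> * fst (g z))"
  have lin_f: "f (u *\<^sub>R a + v *\<^sub>R b) = u * f a + v * f b" for u v a b
    by (simp add: f_def lin_g algebra_simps)
  have cf: "continuous_on A f" for A unfolding f_def by (intro continuous_intros cont)
  obtain zm where zm: "zm \<in> W" "\<And>z. z \<in> W \<Longrightarrow> f zm \<le> f z"
    using continuous_attains_inf[OF cW _ cf] z0 by blast
  define M where "M = W \<inter> {z. f z = f zm}"
  have "closed {z. f z = f zm}" by (intro closed_Collect_eq continuous_intros cf)
  then have cM: "compact M" unfolding M_def using cW by (intro compact_Int_closed)
  have "convex {z. f z = f zm}" unfolding convex_def by (auto simp: lin_f simp flip: distrib_right)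
  then have vM: "convex M" unfolding M_def using vW by (intro convex_Int)
  have "zm \<in> M" using zm by (simp add: M_def)
  then obtain z where z: "z extreme_point_of M" using extreme_point_exists_convex[OF cM vM] by blast
  obtain p q where zpq: "z = (p,q)" by (cases z)
  have zM: "z \<in> M" using z by (simp add: extreme_point_of_def)
  then have pS: "p \<in> S" "q \<in> S'" and gz: "snd (g z) = yy" and fz: "f z = f zm" by (auto simp: M_def W_def zpq)
  have wiggle: "\<exists>u \<epsilon>. u \<noteq> 0 \<and> \<epsilon> > 0 \<and> (\<forall>k. \<bar>k\<bar> \<le> \<epsilon> \<longrightarrow> a + k *\<^sub>R u \<in> A)"
    if A: "convex A" "a \<in> A" "\<not> a extreme_point_of A" for A :: "(real \<times> real) set" and a
  proof -
    obtain b c where bc: "b \<in> A" "c \<in> A" "a \<in> open_segment b c" using A by (auto simp: extreme_point_of_def)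
    then obtain l where l: "0 < l" "l < 1" "a = (1-l) *\<^sub>R b + l *\<^sub>R c" "b \<noteq> c" by (auto simp: in_segment)
    have "a + k *\<^sub>R (c - b) \<in> A" if "\<bar>k\<bar> \<le> min l (1-l)" for k
    proof -
      have "(1 - (l + k)) *\<^sub>R b + (l + k) *\<^sub>R c \<in> A" using that A(1) bc by (intro convexD) auto
      moreover have "(1 - (l + k)) *\<^sub>R b + (l + k) *\<^sub>R c = a + k *\<^sub>R (c - b)"
        unfolding l(3) by (simp add: algebra_simps)
      ultimately show ?thesis by simp
    qed
    then show ?thesis using l by (intro exI[of _ "c - b"] exI[of _ "min l (1-l)"]) auto
  qed
  have "p extreme_point_of S \<or> q extreme_point_of S'"
  proof (rule ccontr)
    assume n: "\<not> (p extreme_point_of S \<or> q extreme_point_of S')"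
    obtain u e where u: "u \<noteq> 0" "e > 0" "\<And>k. \<bar>k\<bar> \<le> e \<Longrightarrow> p + k *\<^sub>R u \<in> S" using wiggle[OF S(2) pS(1)] n by blast
    obtain w e' where w: "w \<noteq> 0" "e' > 0" "\<And>k. \<bar>k\<bar> \<le> e' \<Longrightarrow> q + k *\<^sub>R w \<in> S'" using wiggle[OF S(4) pS(2)] n by blast
    \<comment> \<open>Two unknown speeds under one linear equation: a nonzero solution
      exists.\<close>
    obtain \<alpha> \<beta> where ab: "(1-t) * (\<alpha> * snd u) + t * (\<beta> * snd w) = 0" "\<alpha> \<noteq> 0 \<or> \<beta> \<noteq> 0"
    proof (cases "snd u = 0 \<and> snd w = 0")
      case True then show ?thesis using that[of 1 0] by simp
    next
      case False then show ?thesis using that[of "t * snd w" "- (1-t) * snd u"] t by (auto simp: algebra_simps)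
    qed
    \<comment> \<open>A scale that keeps both components within the range in which they can move;
      the summand 1 protects against a vanishing speed.\<close>
    define k where "k = min (e / (1 + \<bar>\<alpha>\<bar>)) (e' / (1 + \<bar>\<beta>\<bar>))"
    have k0: "k > 0" using u w by (simp add: k_def add_pos_nonneg)
    have "k \<le> e / (1 + \<bar>\<alpha>\<bar>)" "k \<le> e' / (1 + \<bar>\<beta>\<bar>)" by (simp_all add: k_def)
    then have "k * (1 + \<bar>\<alpha>\<bar>) \<le> e" "k * (1 + \<bar>\<beta>\<bar>) \<le> e'" by (simp_all add: pos_le_divide_eq add_pos_nonneg)
    then have kab: "\<bar>k * \<alpha>\<bar> \<le> e" "\<bar>k * \<beta>\<bar> \<le> e'" using k0 by (auto simp: abs_mult algebra_simps)
    define v where "v = ((k * \<alpha>) *\<^sub>R u, (k * \<beta>) *\<^sub>R w)"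
    have v0: "v \<noteq> 0" 
    proof -
      have "(k * \<alpha>) *\<^sub>R u \<noteq> 0 \<or> (k * \<beta>) *\<^sub>R w \<noteq> 0" using ab(2) k0 u(1) w(1) by auto
      then show ?thesis by (metis v_def fst_conv snd_conv fst_zero snd_zero)
    qed
    have "snd (g v) = k * ((1-t) * (\<alpha> * snd u) + t * (\<beta> * snd w))" by (simp add: g_def v_def algebra_simps)
    then have gv: "snd (g v) = 0" using ab by simp
    have zv: "z + s *\<^sub>R v \<in> W" if "s = 1 \<or> s = -1" for s
    proof -
      have "p + (s * (k * \<alpha>)) *\<^sub>R u \<in> S" "q + (s * (k * \<beta>)) *\<^sub>R w \<in> S'"
        using that kab by (auto intro!: u(3) w(3))
      moreover have "snd (g (z + s *\<^sub>R v)) = yy" using lin_g[of 1 z s v] gz gv by simp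
      ultimately show ?thesis by (simp add: W_def zpq v_def)
    qed
    have "f (z + v) = f z + f v" "f (z - v) = f z - f v"
      using lin_f[of 1 z 1 v] lin_f[of 1 z "-1" v] by simp_all
    \<comment> \<open>The objective is linear and cannot drop in either direction, so it is constant
      along \<open>v\<close>.\<close>
    then have "f v = 0" using zm(2)[OF zv[of 1]] zm(2)[OF zv[of "-1"]] fz by simp
    then have "z + s *\<^sub>R v \<in> M" if "s = 1 \<or> s = -1" for s
      using zv[OF that] fz lin_f[of 1 z s v] by (simp add: M_def)
    then have "z + v \<in> M" "z - v \<in> M" by (metis scaleR_one, metis scaleR_minus1_left uminus_add_conv_diff add.commute)
    moreover have "z \<in> open_segment (z - v) (z + v)"
    proof -
      have "(z + v) - (z - v) = 2 *\<^sub>R v" by (simp add: scaleR_2)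
      then have "z - v \<noteq> z + v" using v0 by (metis diff_self scaleR_eq_0_iff zero_neq_numeral)
      moreover have "z = (1 - 1/2) *\<^sub>R (z - v) + (1/2) *\<^sub>R (z + v)" by (simp add: algebra_simps flip: scaleR_add_left)
      ultimately show ?thesis unfolding in_segment by (intro conjI exI[of _ "1/2"]) auto
    qed
    ultimately show False using z unfolding extreme_point_of_def by blast
  qed
  moreover have "f z \<le> f (p0,q0)" using fz zm(2)[OF z0] by simp
  ultimately show ?thesis
    using that[of p q] pS gz by (simp add: f_def g_def zpq)
qed

text \<open>A vertex of a lattice polygon is a lattice point, so the pair from
  \<open>extreme_pair\<close> lies on an event and its sum belongs to the \<open>cset\<close>. The
  cases \<open>\<sigma> = 1\<close> and \<open>\<sigma> = -1\<close> show that the intervals reach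
  both ends of the row.\<close>

lemma boundary_event:
  assumes V: "finite V" "finite V'" "\<And>v. v \<in> V \<Longrightarrow> int_pt v" "\<And>v. v \<in> V' \<Longrightarrow> int_pt v"
    and S: "S = convex hull V" "S' = convex hull V'"
    and pq: "p \<in> S" "q \<in> S'" "(yx,yy) = (1-t) *\<^sub>R p + t *\<^sub>R q" and t: "0 < t" "t < 1"
  shows "\<exists>e c. event t yy S S' e \<and> c \<in> cset t yy S S' e \<and> \<sigma> * c \<le> \<sigma> * yx"
proof -
  have cc: "compact S" "convex S" "compact S'" "convex S'"
    using V by (auto simp: S finite_imp_compact_convex_hull)
  have y: "snd ((1-t) *\<^sub>R p + t *\<^sub>R q) = yy" "fst ((1-t) *\<^sub>R p + t *\<^sub>R q) = yx" using pq(3) by (metis snd_conv, metis fst_conv)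
  obtain a b where ab: "a \<in> S" "b \<in> S'" "snd ((1-t) *\<^sub>R a + t *\<^sub>R b) = yy"
    "\<sigma> * fst ((1-t) *\<^sub>R a + t *\<^sub>R b) \<le> \<sigma> * yx" "a extreme_point_of S \<or> b extreme_point_of S'"
    using extreme_pair[OF cc pq(1,2) y(1) t, of \<sigma>] y(2) by metis
  have ip: "int_pt a \<or> int_pt b" using ab(5) V extreme_point_of_convex_hull unfolding S by blast
  have th: "theta t yy (snd a) = snd b" using ab(3) t by (simp add: theta_def field_simps)
  have "(fst a, snd a) \<in> S" "(fst b, theta t yy (snd a)) \<in> S'" using ab by (simp_all add: th)
  moreover have "event t yy S S' (snd a)" unfolding event_def th using ab ip by (metis int_pt_def prod.collapse)
  moreover have "(1-t) * fst a + t * fst b \<in> cset t yy S S' (snd a)"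
    by (rule csetI) (use ab ip in \<open>auto simp: th int_pt_def\<close>)
  ultimately show ?thesis using ab(4) by (intro exI[of _ "snd a"] exI[of _ "(1-t) * fst a + t * fst b"]) simp
qed

section \<open>Unimodular triangles in lattice polygons\<close>

lemma int_pt_arith:
  assumes "int_pt a" "int_pt b"
  shows "int_pt (a + b)" "int_pt (a - b)" "z \<in> \<int> \<Longrightarrow> int_pt (z *\<^sub>R a)" "det2 a b \<in> \<int>"
  using assms by (auto simp: int_pt_def det2_def)

lemma cramer2: "det2 u v *\<^sub>R w = det2 w v *\<^sub>R u + det2 u w *\<^sub>R v"
  by (simp add: det2_def prod_eq_iff algebra_simps)

lemma det2_combs: "det2 (a *\<^sub>R u + b *\<^sub>R v) (c *\<^sub>R u + d *\<^sub>R v) = (a * d - b * c) * det2 u v"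
  by (simp add: det2_def algebra_simps)

text \<open>If all lattice points had integral coordinates with respect to \<open>u\<close> and
  \<open>v\<close>, so would the unit vectors, and the integer \<open>det2 u v\<close> would divide
  one. A lattice point with a non-integral coordinate is then reduced modulo \<open>u\<close> and
  \<open>v\<close>.\<close>

lemma exists_lattice_point_in_triangle:
  assumes "int_pt u" "int_pt v" and d: "det2 u v \<noteq> 0" "\<bar>det2 u v\<bar> \<noteq> 1"
  shows "\<exists>\<alpha> \<beta>. 0 \<le> \<alpha> \<and> 0 \<le> \<beta> \<and> \<alpha> < 1 \<and> \<beta> < 1 \<and> \<alpha> + \<beta> \<le> 1 \<and> \<alpha> + \<beta> > 0 \<and> int_pt (\<alpha> *\<^sub>R u + \<beta> *\<^sub>R v)"
proof -
  define co where "co = (\<lambda>w. (det2 w v / det2 u v, det2 u w / det2 u v))"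
  have co: "w = fst (co w) *\<^sub>R u + snd (co w) *\<^sub>R v" for w
  proof -
    have "w = (1 / det2 u v) *\<^sub>R (det2 u v *\<^sub>R w)" using d by simp
    also have "\<dots> = fst (co w) *\<^sub>R u + snd (co w) *\<^sub>R v"
      unfolding cramer2[of u v w] co_def by (simp add: scaleR_add_right)
    finally show ?thesis .
  qed
  have "\<exists>w. int_pt w \<and> \<not> int_pt (co w)"
  proof (rule ccontr)
    assume "\<not> ?thesis"
    then have "int_pt (co (1,0))" "int_pt (co (0,1))" by (simp_all add: int_pt_def)
    then have "fst (co (1,0)) * snd (co (0,1)) - snd (co (1,0)) * fst (co (0,1)) \<in> \<int>"
      unfolding int_pt_def by (intro Ints_diff Ints_mult) auto
    then obtain k :: int where k: "fst (co (1,0)) * snd (co (0,1)) - snd (co (1,0)) * fst (co (0,1)) = of_int k"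
      by (elim Ints_cases)
    obtain l :: int where l: "det2 u v = of_int l" using int_pt_arith(4)[OF assms(1,2)] by (elim Ints_cases)
    have "1 = det2 (1,0) (0,1)" by (simp add: det2_def)
    also have "\<dots> = of_int k * det2 u v" by (subst co[of "(1,0)"], subst co[of "(0,1)"]) (simp add: det2_combs k)
    also have "\<dots> = of_int (k * l)" by (simp add: l)
    finally have "k * l = 1" by (metis of_int_eq_1_iff)
    then have "l dvd 1" by (metis dvd_triv_right)
    then have "\<bar>l\<bar> = 1" by simp
    then show False using d(2) by (simp add: l)
  qed
  then obtain w where w: "int_pt w" "\<not> int_pt (co w)" by blast
  define \<alpha> \<beta> where "\<alpha> = frac (fst (co w))" and "\<beta> = frac (snd (co w))"
  have r: "0 \<le> \<alpha>" "0 \<le> \<beta>" "\<alpha> < 1" "\<beta> < 1" by (simp_all add: \<alpha>_def \<beta>_def frac_lt_1)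
  have nz: "\<alpha> \<noteq> 0 \<or> \<beta> \<noteq> 0" using w(2) by (auto simp: \<alpha>_def \<beta>_def int_pt_def frac_eq_0_iff)
  have "\<alpha> *\<^sub>R u + \<beta> *\<^sub>R v = (fst (co w) *\<^sub>R u + snd (co w) *\<^sub>R v)
      - (of_int \<lfloor>fst (co w)\<rfloor> *\<^sub>R u + of_int \<lfloor>snd (co w)\<rfloor> *\<^sub>R v)"
    by (simp add: \<alpha>_def \<beta>_def frac_def algebra_simps)
  also have "fst (co w) *\<^sub>R u + snd (co w) *\<^sub>R v = w" by (rule co[symmetric])
  finally have ip: "int_pt (\<alpha> *\<^sub>R u + \<beta> *\<^sub>R v)" using w(1) assms(1,2) by (simp add: int_pt_arith)
  show ?thesis
  proof (cases "\<alpha> + \<beta> \<le> 1")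
    case True
    then show ?thesis using r nz ip by (intro exI[of _ \<alpha>] exI[of _ \<beta>]) auto
  next
    case False
    \<comment> \<open>A residue in the far half of the parallelogram is reflected through its
      centre.\<close>
    have "(1 - \<alpha>) *\<^sub>R u + (1 - \<beta>) *\<^sub>R v = u + v - (\<alpha> *\<^sub>R u + \<beta> *\<^sub>R v)" by (simp add: algebra_simps)
    then have "int_pt ((1 - \<alpha>) *\<^sub>R u + (1 - \<beta>) *\<^sub>R v)" using ip assms(1,2) by (simp add: int_pt_arith)
    then show ?thesis using r False by (intro exI[of _ "1-\<alpha>"] exI[of _ "1-\<beta>"]) auto
  qed
qed

text \<open>A lattice point \<open>w\<close> other than the vertices cuts the triangle into pieces
  whose determinants are the old one times the barycentric weights of \<open>w\<close>, all less
  than one; \<open>p\<close> lies in one of the pieces.\<close>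

lemma lattice_triangle_descent:
  assumes "int_pt a" "int_pt b" "int_pt c" "det2 (b - a) (c - a) \<noteq> 0" "p \<in> convex hull {a,b,c}"
  shows "\<exists>a' b' c'. int_pt a' \<and> int_pt b' \<and> int_pt c' \<and> {a',b',c'} \<subseteq> convex hull {a,b,c} \<and>
    \<bar>det2 (b' - a') (c' - a')\<bar> = 1 \<and> p \<in> convex hull {a',b',c'}"
  using assms
\<comment> \<open>The determinant is an integer, so the floor only serves to produce a natural
  number.\<close>
proof (induction "nat \<lfloor>\<bar>det2 (b - a) (c - a)\<bar>\<rfloor>" arbitrary: a b c rule: less_induct)
  case less
  let ?D = "det2 (b - a) (c - a)"
  show ?case
  proof (cases "\<bar>?D\<bar> = 1")
    case True
    then show ?thesis using less.prems by (intro exI[of _ a] exI[of _ b] exI[of _ c]) (auto simp: hull_inc)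
  next
    case False
    have ii: "int_pt (b - a)" "int_pt (c - a)" using less.prems by (auto intro: int_pt_arith)
    obtain \<alpha> \<beta> where ab: "0 \<le> \<alpha>" "0 \<le> \<beta>" "\<alpha> < 1" "\<beta> < 1" "\<alpha> + \<beta> \<le> 1" "\<alpha> + \<beta> > 0"
      "int_pt (\<alpha> *\<^sub>R (b - a) + \<beta> *\<^sub>R (c - a))"
      using exists_lattice_point_in_triangle[OF ii less.prems(4) False] by blast
    define w where "w = a + (\<alpha> *\<^sub>R (b - a) + \<beta> *\<^sub>R (c - a))"
    have iw: "int_pt w" unfolding w_def using less.prems(1) ab(7) by (rule int_pt_arith(1))
    have w: "w = (1 - \<alpha> - \<beta>) *\<^sub>R a + \<alpha> *\<^sub>R b + \<beta> *\<^sub>R c" by (simp add: w_def algebra_simps)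
    have wh: "w \<in> convex hull {a,b,c}" unfolding convex_hull_3 w using ab
      by (intro CollectI exI[of _ "1 - \<alpha> - \<beta>"] exI[of _ \<alpha>] exI[of _ \<beta>]) auto
    obtain l m n where p: "0 \<le> l" "0 \<le> m" "0 \<le> n" "l + m + n = 1" "p = l *\<^sub>R a + m *\<^sub>R b + n *\<^sub>R c"
      using less.prems(5) unfolding convex_hull_3 by auto
    \<comment> \<open>\<open>p\<close> lies in the subtriangle obtained by replacing the vertex with the least ratio of barycentric coordinates\<close>
    have step: ?thesis
      if perm: "{x,y,z} = {a,b,c}" and ip: "int_pt y" "int_pt z" and D: "\<bar>det2 (y - w) (z - w)\<bar> = k * \<bar>?D\<bar>"
        and k: "0 < k" "k < 1" and w': "w = k *\<^sub>R x + k2 *\<^sub>R y + k3 *\<^sub>R z" "k + k2 + k3 = 1"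
        and p': "p = l *\<^sub>R x + m *\<^sub>R y + n *\<^sub>R z" "0 \<le> l" "l + m + n = 1"
        and r: "l * k2 \<le> m * k" "l * k3 \<le> n * k" for x y z k k2 k3 l m n
    proof -
      define r where "r = l / k"
      have r': "0 \<le> r" "r * k2 \<le> m" "r * k3 \<le> n" "r * k = l" using k r p' by (auto simp: r_def field_simps)
      have "p = r *\<^sub>R w + (m - r * k2) *\<^sub>R y + (n - r * k3) *\<^sub>R z"
        unfolding p'(1) w' by (simp add: algebra_simps r'(4)[symmetric])
      moreover have "r + (m - r * k2) + (n - r * k3) = 1"
      proof -
        have "r * (k + k2 + k3) = r" using w' by simp
        then have "r * k + r * k2 + r * k3 = r" by (simp add: algebra_simps)
        then show ?thesis using r' p' by simp
      qed
      ultimately have pin: "p \<in> convex hull {w,y,z}" unfolding convex_hull_3 using r'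
        by (intro CollectI exI[of _ r] exI[of _ "m - r * k2"] exI[of _ "n - r * k3"]) auto
      have Dz: "det2 (y - w) (z - w) \<noteq> 0" using D k less.prems(4) by auto
      have "det2 (y - w) (z - w) \<in> \<int>" "?D \<in> \<int>" using iw ip ii by (auto intro!: int_pt_arith)
      moreover have "\<bar>det2 (y - w) (z - w)\<bar> < \<bar>?D\<bar>" unfolding D using k less.prems(4) by simp
      ultimately have lt: "nat \<lfloor>\<bar>det2 (y - w) (z - w)\<bar>\<rfloor> < nat \<lfloor>\<bar>?D\<bar>\<rfloor>"
        by (elim Ints_cases) (simp flip: of_int_abs)
      obtain a' b' c' where abc: "int_pt a'" "int_pt b'" "int_pt c'" "{a',b',c'} \<subseteq> convex hull {w,y,z}"
        "\<bar>det2 (b' - a') (c' - a')\<bar> = 1" "p \<in> convex hull {a',b',c'}"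
        using less.hyps[OF lt iw ip Dz pin] by blast
      have "{w,y,z} \<subseteq> convex hull {a,b,c}" using wh perm by (metis empty_subsetI hull_inc insert_subset insertCI)
      then have "convex hull {w,y,z} \<subseteq> convex hull {a,b,c}" by (simp add: hull_minimal)
      then show ?thesis using abc by (meson order.trans)
    qed
    define g where "g = 1 - \<alpha> - \<beta>"
    have g: "0 \<le> g" "g < 1" "g + \<alpha> + \<beta> = 1" "w = g *\<^sub>R a + \<alpha> *\<^sub>R b + \<beta> *\<^sub>R c" using ab w by (auto simp: g_def)
    have d1: "\<bar>det2 (b - w) (c - w)\<bar> = g * \<bar>?D\<bar>"
    proof -
      have "det2 (b - w) (c - w) = g * ?D" unfolding w_def g_def det2_def by (simp add: algebra_simps)
      then show ?thesis using g by (simp add: abs_mult)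
    qed
    have d2: "\<bar>det2 (a - w) (c - w)\<bar> = \<alpha> * \<bar>?D\<bar>"
    proof -
      have "det2 (a - w) (c - w) = - (\<alpha> * ?D)" unfolding w_def g_def det2_def by (simp add: algebra_simps)
      then show ?thesis using ab by (simp add: abs_mult)
    qed
    have d3: "\<bar>det2 (a - w) (b - w)\<bar> = \<beta> * \<bar>?D\<bar>"
    proof -
      have "det2 (a - w) (b - w) = \<beta> * ?D" unfolding w_def g_def det2_def by (simp add: algebra_simps)
      then show ?thesis using ab by (simp add: abs_mult)
    qed
    consider (1) "0 < g" "l * \<alpha> \<le> m * g" "l * \<beta> \<le> n * g" | (2) "0 < \<alpha>" "m * g \<le> l * \<alpha>" "m * \<beta> \<le> n * \<alpha>"
      | (3) "0 < \<beta>" "n * g \<le> l * \<beta>" "n * \<alpha> \<le> m * \<beta>"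
    proof -
      \<comment> \<open>Only vertices with positive weight in \<open>w\<close> compete:
        \<open>w\<close> may lie on a side, and replacing a vertex of weight zero would give a
        degenerate triangle.\<close>
      define K where "K = {(l,g),(m,\<alpha>),(n,\<beta>)} \<inter> {(x,y). 0 < y}"
      have "K \<noteq> {}" using ab g unfolding K_def by auto
      moreover have "finite K" by (simp add: K_def)
      ultimately have "Min ((\<lambda>(x,y). x / y) ` K) \<in> (\<lambda>(x,y). x / y) ` K" by (intro Min_in) auto
      then obtain x y where xy: "(x,y) \<in> K" "Min ((\<lambda>(x,y). x / y) ` K) = x / y" by auto
      have le: "x * y' \<le> x' * y" if "(x',y') = (l,g) \<or> (x',y') = (m,\<alpha>) \<or> (x',y') = (n,\<beta>)" for x' y'
      proof (cases "0 < y'")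
        case True
        then have "(x',y') \<in> K" using that by (auto simp: K_def)
        then have "x / y \<le> x' / y'" unfolding xy(2)[symmetric] using \<open>finite K\<close> by (intro Min_le) auto
        then show ?thesis using True xy(1) by (auto simp: K_def field_simps)
      next
        case False
        then have "y' = 0" using that ab g by auto
        then show ?thesis using that p xy(1) by (auto simp: K_def)
      qed
      from xy(1) have "(x = l \<and> y = g \<or> x = m \<and> y = \<alpha> \<or> x = n \<and> y = \<beta>) \<and> 0 < y" by (auto simp: K_def)
      then show ?thesis using that le by auto
    qed
    then show ?thesis
    proof cases
      case 1
      show ?thesis by (rule step[of a b c g \<alpha> \<beta> l m n]) (use 1 g d1 p less.prems in auto)
    next
      case 2
      show ?thesis by (rule step[of b a c \<alpha> g \<beta> m l n]) (use 2 g d2 p ab less.prems in auto)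
    next
      case 3
      show ?thesis by (rule step[of c a b \<beta> g \<alpha> n l m]) (use 3 g d3 p ab less.prems in auto)
    qed
  qed
qed

text \<open>A support of least cardinality is taken. Caratheodory's theorem inside it shows that it
  has at most one point more than its affine dimension, hence is independent.\<close>

lemma in_convex_hull_affinely_independent:
  fixes V :: "'a::euclidean_space set"
  assumes "x \<in> convex hull V"
  shows "\<exists>S. S \<subseteq> V \<and> \<not> affine_dependent S \<and> x \<in> convex hull S"
proof -
  let ?P = "\<lambda>S. finite S \<and> S \<subseteq> V \<and> x \<in> convex hull S"
  obtain S0 where "?P S0" using assms unfolding caratheodory[of V] by blast
  then obtain S where S: "?P S" "\<And>T. ?P T \<Longrightarrow> card S \<le> card T"
    using ex_has_least_nat[of ?P S0 card] by blast
  obtain T where T: "finite T" "T \<subseteq> S" "card T \<le> aff_dim S + 1" "x \<in> convex hull T"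
    using S(1) unfolding caratheodory_aff_dim[of S] by blast
  then have "card S \<le> card T" using S(1) by (intro S(2)) blast
  then have "int (card S) \<le> aff_dim S + 1" using T(3) by linarith
  moreover have "aff_dim S \<le> int (card S) - 1" using S(1) aff_dim_le_card by blast
  ultimately have "\<not> affine_dependent S" using S(1) affine_independent_iff_card[of S] by simp
  then show ?thesis using S(1) by blast
qed

lemma affine_hull_eq_UNIV_2:
  fixes V :: "(real \<times> real) set"
  assumes "u \<in> affine hull V" "v \<in> affine hull V" "w \<in> affine hull V" and d: "det2 (v - u) (w - u) \<noteq> 0"
  shows "affine hull V = UNIV"
proof -
  have "x \<in> affine hull V" for x
  proof -
    let ?d = "det2 (v - u) (w - u)"
    define \<alpha> \<beta> where "\<alpha> = det2 (x - u) (w - u) / ?d" and "\<beta> = det2 (v - u) (x - u) / ?d"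
    have "x - u = (1 / ?d) *\<^sub>R (?d *\<^sub>R (x - u))" using d by simp
    also have "\<dots> = \<alpha> *\<^sub>R (v - u) + \<beta> *\<^sub>R (w - u)"
      unfolding cramer2[of "v - u" "w - u" "x - u"] \<alpha>_def \<beta>_def by (simp add: scaleR_add_right)
    finally have "x = (1 - \<alpha> - \<beta>) *\<^sub>R u + \<alpha> *\<^sub>R v + \<beta> *\<^sub>R w" by (simp add: algebra_simps)
    then show ?thesis using mem_affine_3[OF affine_affine_hull assms(1-3), of "1 - \<alpha> - \<beta>" \<alpha> \<beta>] by simp
  qed
  then show ?thesis by auto
qed

text \<open>\<open>p\<close> lies in a simplex spanned by independent points of \<open>V\<close>.
  Since the polygon is full-dimensional, this extends to a triangle with corners in
  \<open>V\<close>, to which the descent applies.\<close>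

lemma polygon_unimodular_triangle:
  assumes V: "\<And>v. v \<in> V \<Longrightarrow> int_pt v" and S: "S = convex hull V"
    and full: "u \<in> S" "v \<in> S" "w \<in> S" "det2 (v - u) (w - u) \<noteq> 0" and p: "p \<in> S"
  shows "\<exists>a b c. int_pt a \<and> int_pt b \<and> int_pt c \<and> {a,b,c} \<subseteq> S \<and> \<bar>det2 (b - a) (c - a)\<bar> = 1 \<and> p \<in> convex hull {a,b,c}"
proof -
  have sub: "S \<subseteq> affine hull V" unfolding S by (rule convex_hull_subset_affine_hull)
  have U: "affine hull V = UNIV" by (rule affine_hull_eq_UNIV_2[OF _ _ _ full(4)]) (use full sub in auto)
  obtain B where B: "B \<subseteq> V" "\<not> affine_dependent B" "p \<in> convex hull B"
    using in_convex_hull_affinely_independent p unfolding S by blast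
  then have "B \<noteq> {}" by auto
  obtain T where T: "\<not> affine_dependent T" "B \<subseteq> T" "T \<subseteq> V" "affine hull T = UNIV"
    using extend_to_affine_basis_nonempty[OF B(2,1) \<open>B \<noteq> {}\<close>] U by blast
  have "aff_dim T = 2" using T(4) by (metis aff_dim_affine_hull aff_dim_UNIV DIM_prod DIM_real of_nat_1 of_nat_add one_add_one)
  then have "card T = 3" using aff_dim_affine_independent[OF T(1)] by simp
  then obtain a b c where abc: "T = {a,b,c}" by (auto simp: card_3_iff)
  have i: "int_pt a" "int_pt b" "int_pt c" using V T abc by auto
  have d: "det2 (b - a) (c - a) \<noteq> 0"
  proof
    assume 0: "det2 (b - a) (c - a) = 0"
    have co: "\<exists>m n. x - a = m *\<^sub>R (b - a) + n *\<^sub>R (c - a)" for x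
    proof -
      have "x \<in> affine hull {a,b,c}" using T(4) abc by simp
      then obtain k m n where x: "k + m + n = 1" "x = k *\<^sub>R a + m *\<^sub>R b + n *\<^sub>R c" unfolding affine_hull_3 by auto
      have k: "k = 1 - m - n" using x(1) by simp
      have "x - a = m *\<^sub>R (b - a) + n *\<^sub>R (c - a)" unfolding x(2) k by (simp add: algebra_simps)
      then show ?thesis by blast
    qed
    obtain m n where 1: "(1,0) = m *\<^sub>R (b - a) + n *\<^sub>R (c - a)" using co[of "a + (1,0)"] by auto
    obtain m' n' where 2: "(0,1) = m' *\<^sub>R (b - a) + n' *\<^sub>R (c - a)" using co[of "a + (0,1)"] by auto
    have "det2 (1,0) (0,1) = 0" unfolding 1 2 det2_combs 0 by simp
    then show False by (simp add: det2_def)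
  qed
  have "p \<in> convex hull {a,b,c}" using B(3) T(2) abc hull_mono by blast
  from lattice_triangle_descent[OF i d this]
  obtain a' b' c' where *: "int_pt a'" "int_pt b'" "int_pt c'" "{a',b',c'} \<subseteq> convex hull {a,b,c}"
    "\<bar>det2 (b' - a') (c' - a')\<bar> = 1" "p \<in> convex hull {a',b',c'}" by blast
  have "convex hull {a,b,c} \<subseteq> S" unfolding S using T(3) abc by (intro hull_mono) auto
  then show ?thesis using * by (meson order.trans)
qed

section \<open>Charts of smooth polygons\<close>

text \<open>A smooth corner described without faces: \<open>S\<close> contains the first lattice
  point in both directions and lies in the unimodular cone at \<open>v\<close>. In this form the
  notion passes to the slices, whose edges are never computed.\<close>

definition chart :: "(real \<times> real) set \<Rightarrow> int \<times> int \<Rightarrow> int \<times> int \<Rightarrow> int \<times> int \<Rightarrow> bool" where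
  "chart S v a b \<longleftrightarrow> \<bar>fst a * snd b - snd a * fst b\<bar> = 1 \<and>
     (of_int (fst v), of_int (snd v)) \<in> S \<and>
     (of_int (fst v + fst a), of_int (snd v + snd a)) \<in> S \<and>
     (of_int (fst v + fst b), of_int (snd v + snd b)) \<in> S \<and>
     (\<forall>x y. (x,y) \<in> S \<longrightarrow> (\<exists>k\<ge>0. \<exists>l\<ge>0. x = of_int (fst v) + k * of_int (fst a) + l * of_int (fst b) \<and>
        y = of_int (snd v) + k * of_int (snd a) + l * of_int (snd b)))"

text \<open>The corners at both ends of the bottom and of the top edge. \<open>D\<close> holds pairs
  of directions without positions, so that one \<open>D\<close> describes all slices. The slopes at
  the top are negated because the directions there point downwards.\<close>

definition four_charts :: "(int \<times> int \<Rightarrow> int \<times> int \<Rightarrow> bool) \<Rightarrow> int \<Rightarrow> int \<Rightarrow> int \<Rightarrow> int \<Rightarrow> bool" where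
  "four_charts D mB rB mT rT \<longleftrightarrow> D (1,0) (mB,1) \<and> D (-1,0) (rB,1) \<and> D (1,0) (-mT,-1) \<and> D (-1,0) (-rT,-1)"

definition triangle_charts :: "(int \<times> int \<Rightarrow> int \<times> int \<Rightarrow> bool) \<Rightarrow> bool" where
  "triangle_charts D \<longleftrightarrow> D (1,0) (0,1) \<and> D (-1,1) (-1,0) \<and> D (1,-1) (0,-1)"

text \<open>Cramer's rule: the brackets are the cone coordinates times the determinant, and
  multiplying by the determinant once more removes its sign.\<close>

lemma chart_bounds:
  assumes "chart S v a b" "(x,y) \<in> S"
  shows "0 \<le> of_int (fst a * snd b - snd a * fst b) * ((x - of_int (fst v)) * of_int (snd b) - (y - of_int (snd v)) * of_int (fst b))" (is "0 \<le> ?d * ?P")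
    and "0 \<le> of_int (fst a * snd b - snd a * fst b) * (of_int (fst a) * (y - of_int (snd v)) - of_int (snd a) * (x - of_int (fst v)))" (is "0 \<le> _ * ?Q")
proof -
  obtain k l where kl: "k \<ge> 0" "l \<ge> 0" "x = of_int (fst v) + k * of_int (fst a) + l * of_int (fst b)"
    "y = of_int (snd v) + k * of_int (snd a) + l * of_int (snd b)"
    using assms unfolding chart_def by blast
  have "?P = k * ?d" "?Q = l * ?d" unfolding kl(3,4) by (simp_all add: algebra_simps)
  then have "?d * ?P = k * (?d * ?d)" "?d * ?Q = l * (?d * ?d)" by simp_all
  then show "0 \<le> ?d * ?P" "0 \<le> ?d * ?Q" using kl(1,2) by (metis mult_nonneg_nonneg zero_le_square)+
qed

lemma chart_mem:
  assumes "chart S v a b"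
  shows "(of_int (fst v), of_int (snd v)) \<in> S" "(of_int (fst v + fst a), of_int (snd v + snd a)) \<in> S"
    "(of_int (fst v + fst b), of_int (snd v + snd b)) \<in> S"
  using assms unfolding chart_def by blast+

text \<open>The four charts come with unrelated vertices. The two bottom cones contain each other's
  vertices, which forces equal heights, and likewise at the top. The first lattice points along the
  edges make the inequalities strict.\<close>

lemma four_charts_two_parallel_edges:
  assumes S: "convex S" and D: "\<And>a b. D a b \<Longrightarrow> \<exists>v. chart S v a b" and f: "four_charts D mB rB mT rT"
  shows "\<exists>h0 h1 b1 b2 t1 t2. two_parallel_edges S h0 h1 b1 b2 t1 t2 mB rB mT rT"
proof -
  obtain b1 h0 where BL: "chart S (b1,h0) (1,0) (mB,1)" using f D unfolding four_charts_def by fastforce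
  obtain b2 h0' where BR: "chart S (b2,h0') (-1,0) (rB,1)" using f D unfolding four_charts_def by fastforce
  obtain t1 h1 where TL: "chart S (t1,h1) (1,0) (-mT,-1)" using f D unfolding four_charts_def by fastforce
  obtain t2 h1' where TR: "chart S (t2,h1') (-1,0) (-rT,-1)" using f D unfolding four_charts_def by fastforce
  note BL' = chart_mem[OF BL] and BR' = chart_mem[OF BR] and TL' = chart_mem[OF TL] and TR' = chart_mem[OF TR]
  have mem: "(of_int b1, of_int h0) \<in> S" "(of_int (b1 + 1), of_int h0) \<in> S" "(of_int (b1 + mB), of_int (h0 + 1)) \<in> S"
    "(of_int b2, of_int h0') \<in> S" "(of_int (b2 + rB), of_int (h0' + 1)) \<in> S"
    "(of_int t1, of_int h1) \<in> S" "(of_int (t1 + 1), of_int h1) \<in> S" "(of_int (t1 - mT), of_int (h1 - 1)) \<in> S"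
    "(of_int t2, of_int h1') \<in> S" "(of_int (t2 - rT), of_int (h1' - 1)) \<in> S"
    using BL' BR' TL' TR' by simp_all
  have bd: "of_int h0 \<le> y \<and> of_int b1 + of_int mB * (y - of_int h0) \<le> x"
    "of_int h0' \<le> y \<and> x \<le> of_int b2 + of_int rB * (y - of_int h0')"
    "y \<le> of_int h1 \<and> of_int t1 + of_int mT * (y - of_int h1) \<le> x"
    "y \<le> of_int h1' \<and> x \<le> of_int t2 + of_int rT * (y - of_int h1')" if "(x,y) \<in> S" for x y
    using chart_bounds[OF BL that] chart_bounds[OF BR that] chart_bounds[OF TL that] chart_bounds[OF TR that]
    by (simp_all add: algebra_simps)
  have "real_of_int h0 = of_int h0'" using bd(1)[OF mem(4)] bd(2)[OF mem(1)] by simp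
  then have h0: "h0' = h0" by simp
  have "real_of_int h1 = of_int h1'" using bd(3)[OF mem(9)] bd(4)[OF mem(6)] by simp
  then have h1: "h1' = h1" by simp
  have "real_of_int (b1 + 1) \<le> of_int b2" using bd(2)[OF mem(2)] by (simp add: h0)
  moreover have "real_of_int (t1 + 1) \<le> of_int t2" using bd(4)[OF mem(7)] by (simp add: h1)
  moreover have "real_of_int (h0 + 1) \<le> of_int h1" using bd(3)[OF mem(3)] by simp
  ultimately have "b1 < b2" "t1 < t2" "h0 < h1" by (simp_all only: of_int_le_iff)
  then have "two_parallel_edges S h0 h1 b1 b2 t1 t2 mB rB mT rT"
  proof unfold_locales
    note m = mem[unfolded h0 h1] and d = bd[unfolded h0 h1]
    show "convex S" by (rule S)
    show "(of_int b1, of_int h0) \<in> S" "(of_int b2, of_int h0) \<in> S" "(of_int t1, of_int h1) \<in> S" "(of_int t2, of_int h1) \<in> S"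
      "(of_int (b1 + mB), of_int (h0 + 1)) \<in> S" "(of_int (t2 - rT), of_int (h1 - 1)) \<in> S"
      "(of_int (b2 + rB), of_int (h0 + 1)) \<in> S" "(of_int (t1 - mT), of_int (h1 - 1)) \<in> S" by (rule m)+
    fix x y assume "(x,y) \<in> S"
    note d = d[OF this]
    show "of_int h0 \<le> y" "y \<le> of_int h1" "of_int b1 + of_int mB * (y - of_int h0) \<le> x"
      "x \<le> of_int b2 + of_int rB * (y - of_int h0)" "of_int t1 + of_int mT * (y - of_int h1) \<le> x"
      "x \<le> of_int t2 + of_int rT * (y - of_int h1)"
      using d by blast+
  qed
  then show ?thesis by blast
qed

text \<open>Each cone contains the vertices of the other two, so the six half planes coincide in
  pairs. The triangle that remains is spanned by the three vertices, which belong to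
  \<open>S\<close>.\<close>

lemma triangle_charts_std_triangle:
  assumes S: "convex S" and D: "\<And>a b. D a b \<Longrightarrow> \<exists>v. chart S v a b" and f: "triangle_charts D"
  shows "\<exists>x0 y0 N. S = std_triangle x0 y0 N"
proof -
  obtain x0 y0 where A: "chart S (x0,y0) (1,0) (0,1)" using f D unfolding triangle_charts_def by fastforce
  obtain x1 y1 where B: "chart S (x1,y1) (-1,1) (-1,0)" using f D unfolding triangle_charts_def by fastforce
  obtain x2 y2 where C: "chart S (x2,y2) (1,-1) (0,-1)" using f D unfolding triangle_charts_def by fastforce
  have mem: "(of_int x0, of_int y0) \<in> S" "(of_int x1, of_int y1) \<in> S" "(of_int x2, of_int y2) \<in> S"
    using chart_mem(1)[OF A] chart_mem(1)[OF B] chart_mem(1)[OF C] by simp_all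
  have bd: "of_int x0 \<le> x \<and> of_int y0 \<le> y" "of_int y1 \<le> y \<and> x + y \<le> of_int (x1 + y1)"
    "of_int x2 \<le> x \<and> x + y \<le> of_int (x2 + y2)" if "(x,y) \<in> S" for x y
    using chart_bounds[OF A that] chart_bounds[OF B that] chart_bounds[OF C that] by simp_all
  have "real_of_int y1 = of_int y0" "real_of_int x2 = of_int x0"
    using bd(2)[OF mem(1)] bd(1)[OF mem(2)] bd(3)[OF mem(1)] bd(1)[OF mem(3)] by auto
  then have y1: "y1 = y0" and x2: "x2 = x0" by simp_all
  have "real_of_int (x1 + y1) = of_int (x2 + y2)"
    using bd(3)[OF mem(2)] bd(2)[OF mem(3)] by simp
  then have e: "x1 + y1 = x2 + y2" by (simp only: of_int_eq_iff)
  define N where "N = x1 + y1"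
  have xN: "x1 = N - y0" "y2 = N - x0" using e by (auto simp: N_def y1 x2)
  have "S = std_triangle x0 y0 N"
  proof
    show "S \<subseteq> std_triangle x0 y0 N"
    proof
      fix p assume p: "p \<in> S"
      obtain x y where xy: "p = (x,y)" by (cases p)
      show "p \<in> std_triangle x0 y0 N" using bd(1,2)[of x y] p unfolding xy std_triangle_def N_def by simp
    qed
    show "std_triangle x0 y0 N \<subseteq> S"
    proof
      fix p assume "p \<in> std_triangle x0 y0 N"
      then obtain x y where p: "p = (x,y)" "of_int x0 \<le> x" "of_int y0 \<le> y" "x + y \<le> of_int N"
        by (auto simp: std_triangle_def)
      define d where "d = real_of_int N - x0 - y0"
      have "\<exists>m n. 0 \<le> m \<and> 0 \<le> n \<and> m + n \<le> 1 \<and> x = x0 + m * d \<and> y = y0 + n * d"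
      proof (cases "d = 0")
        case True then show ?thesis using p by (intro exI[of _ 0]) (auto simp: d_def)
      next
        case False
        then have "d > 0" using p by (simp add: d_def)
        define m n where "m = (x - x0) / d" and "n = (y - y0) / d"
        have "m * d = x - x0" "n * d = y - y0" using \<open>d > 0\<close> by (simp_all add: m_def n_def)
        moreover have "0 \<le> m" "0 \<le> n" using p \<open>d > 0\<close> by (simp_all add: m_def n_def)
        moreover have "m + n = (x - x0 + (y - y0)) / d" by (simp add: m_def n_def add_divide_distrib)
        then have "m + n \<le> 1" using p \<open>d > 0\<close> by (simp add: d_def)
        ultimately show ?thesis by (intro exI[of _ m] exI[of _ n]) simp
      qed
      then obtain m n where mn: "0 \<le> m" "0 \<le> n" "m + n \<le> 1" "x = x0 + m * d" "y = y0 + n * d" by blast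
      let ?H = "{(real_of_int x0, real_of_int y0), (real_of_int x1, real_of_int y1), (real_of_int x2, real_of_int y2)}"
      let ?p = "(1 - m - n) *\<^sub>R (real_of_int x0, real_of_int y0) + m *\<^sub>R (real_of_int x1, real_of_int y1) + n *\<^sub>R (real_of_int x2, real_of_int y2)"
      have e: "p = ?p"
        unfolding p(1) mn(4,5) y1 x2 xN d_def by (simp add: algebra_simps)
      have "?p \<in> convex hull ?H"
      proof -
        have "0 \<le> 1 - m - n \<and> 0 \<le> m \<and> 0 \<le> n \<and> (1 - m - n) + m + n = 1" using mn(1-3) by simp
        then show ?thesis unfolding convex_hull_3 by blast
      qed
      moreover have "?H \<subseteq> S" using mem by simp
      then have "convex hull ?H \<subseteq> S" using S by (rule hull_minimal)
      ultimately show "p \<in> S" unfolding e by (rule subsetD[rotated])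
    qed
  qed
  then show ?thesis by blast
qed

lemma slab_cover:
  assumes V: "finite V" "finite V'" "\<And>v. v \<in> V \<Longrightarrow> int_pt v" "\<And>v. v \<in> V' \<Longrightarrow> int_pt v"
    and S: "S = convex hull V" "S' = convex hull V'"
    and D: "\<And>a b. D a b \<Longrightarrow> \<exists>v. chart S v a b" "\<And>a b. D a b \<Longrightarrow> \<exists>v. chart S' v a b"
    and f: "triangle_charts D \<or> (\<exists>mB rB mT rT. four_charts D mB rB mT rT)"
    and pq: "p \<in> S" "q \<in> S'" and t: "0 \<le> t" "t \<le> 1"
  shows "sum_cov t S S' ((1-t) *\<^sub>R p + t *\<^sub>R q)"
proof -
  have cv: "convex S" "convex S'" by (simp_all add: S convex_convex_hull)
  obtain v v' where vv: "v \<in> S" "int_pt v" "v' \<in> S'" "int_pt v'"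
  proof -
    have "V \<noteq> {}" "V' \<noteq> {}" using pq S by auto
    then show ?thesis using that V S by (metis all_not_in_conv hull_inc)
  qed
  consider "t = 0" | "t = 1" | "0 < t" "t < 1" using t by linarith
  then show ?thesis
  proof cases
    case 1
    \<comment> \<open>The weight of \<open>q\<close> vanishes, so \<open>q\<close> may be replaced
      by a lattice point of \<open>S'\<close>.\<close>
    then have "(1-t) *\<^sub>R p + t *\<^sub>R q = (1-t) *\<^sub>R p + t *\<^sub>R v'" by simp
    then show ?thesis unfolding sum_cov_def using pq vv by blast
  next
    case 2
    then have "(1-t) *\<^sub>R p + t *\<^sub>R q = (1-t) *\<^sub>R v + t *\<^sub>R q" by simp
    then show ?thesis unfolding sum_cov_def using pq vv by blast
  next
    case t: 3
    obtain yx yy where y: "(yx,yy) = (1-t) *\<^sub>R p + t *\<^sub>R q" by (metis surj_pair)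
    have le: "\<exists>e c. event t yy S S' e \<and> c \<in> cset t yy S S' e \<and> c \<le> yx"
      using boundary_event[OF V S pq y t, of 1] by simp
    have ge: "\<exists>e c. event t yy S S' e \<and> c \<in> cset t yy S S' e \<and> yx \<le> c"
      using boundary_event[OF V S pq y t, of "-1"] by simp
    from f have "sum_cov t S S' (yx,yy)"
    proof
      assume f: "triangle_charts D"
      obtain x0 y0 N x0' y0' N' where SS: "S = std_triangle x0 y0 N" "S' = std_triangle x0' y0' N'"
        using triangle_charts_std_triangle[OF cv(1) D(1) f] triangle_charts_std_triangle[OF cv(2) D(2) f] by blast
      have "of_int x0 \<le> fst p" "of_int x0' \<le> fst q" using pq unfolding SS std_triangle_def by auto
      then have "(1-t) * of_int x0 + t * of_int x0' \<le> (1-t) * fst p + t * fst q"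
        using t by (intro add_mono mult_left_mono) auto
      also have "\<dots> = yx" using y by (metis fst_add fst_conv fst_scaleR real_scaleR_def)
      finally show ?thesis using std_triangle_cover[OF t] le ge unfolding SS by blast
    next
      assume "\<exists>mB rB mT rT. four_charts D mB rB mT rT"
      then obtain mB rB mT rT where f: "four_charts D mB rB mT rT" by blast
      obtain h0 h1 b1 b2 t1 t2 where 1: "two_parallel_edges S h0 h1 b1 b2 t1 t2 mB rB mT rT"
        using four_charts_two_parallel_edges[OF cv(1) D(1) f] by blast
      obtain h0' h1' b1' b2' t1' t2' where 2: "two_parallel_edges S' h0' h1' b1' b2' t1' t2' mB rB mT rT"
        using four_charts_two_parallel_edges[OF cv(2) D(2) f] by blast
      show ?thesis by (rule two_parallel_edges_cover[OF 1 2 t le ge])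
    qed
    then show ?thesis unfolding y .
  qed
qed

text \<open>A chart at maximal \<open>x\<close> is inspected. A direction of abscissa zero there
  gives an edge parallel to the \<open>y\<close>-axis, with determinant one fixing the rest.
  Otherwise the maximum is a single vertex \<open>(X,Y)\<close>. If no edge rose from it, it would
  also be topmost, hence the only maximiser of the functional, against \<open>s\<close>. So one edge
  rises, and determinant one forces the other onto the \<open>x\<close>-axis.\<close>

lemma opposite_to_edge_chart:
  fixes p q :: int
  assumes ch: "\<And>a b. D a b \<Longrightarrow> \<exists>v. chart S v a b" and sym: "\<And>a b. D a b \<Longrightarrow> D b a"
    and opp: "\<And>c d::int. \<exists>a b. D a b \<and> c * fst a + d * snd a \<ge> 0 \<and> c * fst b + d * snd b \<ge> 0"
    and base: "chart S (0,0) (1,0) (0,1)"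
    and pq: "p > 0" "q > 0" and s: "(s1,s2) \<in> S" "(r1,r2) \<in> S" "(s1,s2) \<noteq> (r1,r2)"
      "of_int p * s1 + of_int q * s2 = of_int p * r1 + of_int q * r2"
      "\<And>x y. (x,y) \<in> S \<Longrightarrow> of_int p * x + of_int q * y \<le> of_int p * s1 + of_int q * s2"
  shows "(\<exists>b. D (0,1) b \<and> fst b = -1) \<or> (\<exists>b. D (0,-1) b \<and> fst b = -1) \<or>
    (\<exists>E X. E > 0 \<and> X > 0 \<and> D (-E,1) (-1,0) \<and> (of_int X, 0) \<in> S \<and> (\<forall>x y. (x,y) \<in> S \<longrightarrow> x + of_int E * y \<le> of_int X))"
proof -
  have S0: "(0,0) \<in> S" "(1,0) \<in> S" "\<And>x y. (x,y) \<in> S \<Longrightarrow> 0 \<le> x \<and> 0 \<le> y"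
    using chart_mem[OF base] chart_bounds[OF base] by simp_all
  obtain a b where ab: "D a b" "fst a \<le> 0" "fst b \<le> 0" "fst a * snd b - snd a * fst b = 1"
  proof -
    obtain a b where ab: "D a b" "fst a \<le> 0" "fst b \<le> 0" using opp[of "-1" 0] by auto
    have "\<bar>fst a * snd b - snd a * fst b\<bar> = 1" using ch[OF ab(1)] by (auto simp: chart_def)
    then have "fst a * snd b - snd a * fst b = 1 \<or> fst a * snd b - snd a * fst b = -1" by linarith
    then consider "fst a * snd b - snd a * fst b = 1" | "fst b * snd a - snd b * fst a = 1" by (auto simp: mult.commute)
    then show ?thesis
    proof cases
      case 1 show ?thesis by (rule that[OF ab 1])
    next
      case 2 show ?thesis by (rule that[OF sym[OF ab(1)] ab(3,2) 2])
    qed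
  qed
  obtain v where v: "chart S v a b" using ch ab by blast
  define X Y where "X = real_of_int (fst v)" and "Y = real_of_int (snd v)"
  have vS: "(X,Y) \<in> S" using chart_mem(1)[OF v] by (simp add: X_def Y_def)
  have co: "\<exists>k\<ge>0. \<exists>l\<ge>0. x = X + k * of_int (fst a) + l * of_int (fst b) \<and> y = Y + k * of_int (snd a) + l * of_int (snd b)"
    if "(x,y) \<in> S" for x y using v that unfolding chart_def X_def Y_def by blast
  show ?thesis
  proof (cases "fst a = 0 \<or> fst b = 0")
    case True
    then show ?thesis
    proof
      assume a0: "fst a = 0"
      then have "- snd a * fst b = 1" using ab by simp
      then have "snd a = 1 \<and> fst b = -1" using zmult_eq_1_iff[of "snd a" "- fst b"] ab(3) by auto
      then have "a = (0,1)" "fst b = -1" using a0 by (simp_all add: prod_eq_iff)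
      then show ?thesis using ab(1) by blast
    next
      assume b0: "fst b = 0"
      then have "fst a * snd b = 1" using ab by simp
      then have "snd b = -1 \<and> fst a = -1" using zmult_eq_1_iff[of "fst a" "snd b"] ab(2) by auto
      then have "b = (0,-1)" "fst a = -1" using b0 by (simp_all add: prod_eq_iff)
      then show ?thesis using sym[OF ab(1)] by blast
    qed
  next
    case False
    then have neg: "fst a < 0" "fst b < 0" using ab by auto
    have f1: "(x - X) * of_int (snd b) - (y - Y) * of_int (fst b) \<ge> 0"
      and f2: "of_int (fst a) * (y - Y) - of_int (snd a) * (x - X) \<ge> 0" if "(x,y) \<in> S" for x y
      using chart_bounds[OF v that] by (simp_all add: ab(4) X_def Y_def)
    have xX: "x \<le> X" if xy: "(x,y) \<in> S" for x y
    proof -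
      obtain k l where kl: "k \<ge> 0" "l \<ge> 0" "x = X + k * of_int (fst a) + l * of_int (fst b)"
        using co[OF xy] by blast
      have "k * real_of_int (fst a) \<le> 0" "l * real_of_int (fst b) \<le> 0" using kl neg by (simp_all add: mult_nonneg_nonpos)
      then show ?thesis unfolding kl(3) by simp
    qed
    have X1: "X \<ge> 1" using xX[OF S0(2)] .
    have Y0: "Y \<ge> 0" using S0(3)[OF vS] by simp
    \<comment> \<open>The origin lies in the cone at \<open>(X,Y)\<close>; as \<open>Y\<close> is
      nonnegative, its sign condition says that \<open>b\<close> does not rise.\<close>
    have "- X * of_int (snd b) + Y * of_int (fst b) \<ge> 0" using f1[OF S0(1)] by simp
    moreover have "Y * real_of_int (fst b) \<le> 0" using Y0 neg by (simp add: mult_nonneg_nonpos)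
    ultimately have "X * real_of_int (snd b) \<le> 0" by simp
    then have sb: "snd b \<le> 0" using X1 by (simp add: mult_le_0_iff)
    have sa: "snd a > 0"
    proof (rule ccontr)
      assume "\<not> snd a > 0"
      then have sa: "real_of_int (snd a) \<le> 0" by simp
      have yY: "y \<le> Y" if "(x,y) \<in> S" for x y
      proof -
        have "of_int (snd a) * (x - X) \<ge> 0" using sa xX[OF that] by (intro mult_nonpos_nonpos) auto
        then have "real_of_int (fst a) * (y - Y) \<ge> 0" using f2[OF that] by simp
        then show ?thesis using neg by (simp add: zero_le_mult_iff)
      qed
      have max: "of_int p * X + of_int q * Y \<le> of_int p * s1 + of_int q * s2" by (rule s(5)[OF vS])
      have uniq: "x = X \<and> y = Y" if "(x,y) \<in> S" "of_int p * x + of_int q * y = of_int p * s1 + of_int q * s2" for x y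
      proof -
        have 1: "of_int p * x \<le> of_int p * X" "of_int q * y \<le> of_int q * Y"
          using xX[OF that(1)] yY[OF that(1)] pq by (auto intro: mult_left_mono)
        then have "of_int p * x = of_int p * X" "of_int q * y = of_int q * Y" using max that(2) by linarith+
        then show ?thesis using pq by simp
      qed
      have "s1 = X \<and> s2 = Y" "r1 = X \<and> r2 = Y" using uniq[OF s(1) refl] uniq[OF s(2) s(4)[symmetric]] by blast+
      then show False using s(3) by simp
    qed
    have "- fst b \<ge> 1" using neg by simp
    then have "snd a * 1 \<le> snd a * (- fst b)" using sa by (intro mult_left_mono) auto
    then have "snd a * (- fst b) \<ge> snd a" by simp
    moreover have "fst a * snd b \<ge> 0" using neg sb by (simp add: mult_nonpos_nonpos)
    \<comment> \<open>Two nonnegative integers add up to the determinant one, and the second is at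
      least the positive \<open>snd a\<close>.\<close>
    ultimately have "snd a = 1" "fst a * snd b = 0" "snd a * (- fst b) = 1" using ab(4) sa by linarith+
    then have e: "snd a = 1" "snd b = 0" "fst b = -1" using neg by auto
    have "Y \<le> 0" using f1[OF S0(1)] by (simp add: e)
    then have Y: "Y = 0" using Y0 by simp
    have "a = (- (- fst a), 1)" "b = (-1, 0)" using e by (simp_all add: prod_eq_iff)
    then have D: "D (- (- fst a), 1) (-1, 0)" using ab(1) by metis
    have bound: "x + of_int (- fst a) * y \<le> of_int (fst v)" if "(x,y) \<in> S" for x y
      using f2[OF that] by (simp add: e Y X_def)
    have "0 < - fst a" "0 < fst v" "(of_int (fst v), 0) \<in> S"
      using neg X1 vS Y by (simp_all add: X_def)
    then show ?thesis using D bound by blast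
  qed
qed

lemma mem_swap_image [simp]: "(x,y) \<in> prod.swap ` S \<longleftrightarrow> (y,x) \<in> S" by force

lemma chart_swap:
  assumes "chart S v a b"
  shows "chart (prod.swap ` S) (prod.swap v) (prod.swap a) (prod.swap b)"
proof -
  have "\<exists>k\<ge>0. \<exists>l\<ge>0. x = of_int (snd v) + k * of_int (snd a) + l * of_int (snd b) \<and>
        y = of_int (fst v) + k * of_int (fst a) + l * of_int (fst b)" if "(y,x) \<in> S" for x y
  proof -
    obtain k l where "k \<ge> 0" "l \<ge> 0" "y = of_int (fst v) + k * of_int (fst a) + l * of_int (fst b)"
      "x = of_int (snd v) + k * of_int (snd a) + l * of_int (snd b)" using assms \<open>(y,x) \<in> S\<close> unfolding chart_def by blast
    then show ?thesis by blast
  qed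
  moreover have "\<bar>snd a * fst b - fst a * snd b\<bar> = 1" using assms unfolding chart_def by (simp add: abs_minus_commute mult.commute)
  ultimately show ?thesis using chart_mem[OF assms] unfolding chart_def mem_swap_image fst_swap snd_swap by blast
qed

lemma chart_commute:
  assumes "chart S v a b" shows "chart S v b a"
proof -
  have "\<exists>k\<ge>0. \<exists>l\<ge>0. x = of_int (fst v) + k * of_int (fst b) + l * of_int (fst a) \<and>
        y = of_int (snd v) + k * of_int (snd b) + l * of_int (snd a)" if "(x,y) \<in> S" for x y
  proof -
    obtain k l where "k \<ge> 0" "l \<ge> 0" "x = of_int (fst v) + k * of_int (fst a) + l * of_int (fst b)"
      "y = of_int (snd v) + k * of_int (snd a) + l * of_int (snd b)" using assms \<open>(x,y) \<in> S\<close> unfolding chart_def by blast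
    then show ?thesis by (intro exI[of _ l] exI[of _ k] conjI) simp_all
  qed
  moreover have "\<bar>fst b * snd a - snd b * fst a\<bar> = 1" using assms unfolding chart_def by (simp add: abs_minus_commute mult.commute)
  ultimately show ?thesis using chart_mem[OF assms] unfolding chart_def by blast
qed

text \<open>\<open>opposite_to_edge_chart\<close> is used along both axes. Without a parallel edge,
  the bounds at the far vertices \<open>(X,0)\<close> and \<open>(0,Y)\<close> read
  \<open>E * Y \<le> X\<close> and \<open>F * X \<le> Y\<close> with positive integers, so
  \<open>E = F = 1\<close>.\<close>

lemma charts_dichotomy:
  fixes p q :: int
  assumes ch: "\<And>a b. D a b \<Longrightarrow> \<exists>v. chart S v a b" and sym: "\<And>a b. D a b \<Longrightarrow> D b a"
    and opp: "\<And>c d::int. \<exists>a b. D a b \<and> c * fst a + d * snd a \<ge> 0 \<and> c * fst b + d * snd b \<ge> 0"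
    and base: "chart S (0,0) (1,0) (0,1)" "D (1,0) (0,1)"
    and pq: "p > 0" "q > 0" and s: "(s1,s2) \<in> S" "(r1,r2) \<in> S" "(s1,s2) \<noteq> (r1,r2)"
      "of_int p * s1 + of_int q * s2 = of_int p * r1 + of_int q * r2"
      "\<And>x y. (x,y) \<in> S \<Longrightarrow> of_int p * x + of_int q * y \<le> of_int p * s1 + of_int q * s2"
  shows "(\<exists>a b. D a b \<and> fst a = 0 \<and> fst b = -1) \<or> (\<exists>a b. D a b \<and> snd a = 0 \<and> snd b = -1) \<or> triangle_charts D"
proof -
  define D' where "D' a b = D (prod.swap a) (prod.swap b)" for a b
  have c1: "(\<exists>b. D (0,1) b \<and> fst b = -1) \<or> (\<exists>b. D (0,-1) b \<and> fst b = -1) \<or>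
    (\<exists>E X. E > 0 \<and> X > 0 \<and> D (-E,1) (-1,0) \<and> (of_int X, 0) \<in> S \<and> (\<forall>x y. (x,y) \<in> S \<longrightarrow> x + of_int E * y \<le> of_int X))"
    by (rule opposite_to_edge_chart[OF ch sym opp base(1) pq s])
  have c2: "(\<exists>b. D' (0,1) b \<and> fst b = -1) \<or> (\<exists>b. D' (0,-1) b \<and> fst b = -1) \<or>
    (\<exists>E X. E > 0 \<and> X > 0 \<and> D' (-E,1) (-1,0) \<and> (of_int X, 0) \<in> prod.swap ` S \<and>
       (\<forall>x y. (x,y) \<in> prod.swap ` S \<longrightarrow> x + of_int E * y \<le> of_int X))"
  proof (rule opposite_to_edge_chart[OF _ _ _ _ pq(2,1), where ?s1.0 = s2 and ?s2.0 = s1 and ?r1.0 = r2 and ?r2.0 = r1])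
    show "\<exists>v. chart (prod.swap ` S) v a b" if "D' a b" for a b
    proof -
      obtain v where "chart S v (prod.swap a) (prod.swap b)" using ch \<open>D' a b\<close> unfolding D'_def by blast
      from chart_swap[OF this] show ?thesis unfolding swap_swap by blast
    qed
    show "D' b a" if "D' a b" for a b using that sym by (simp add: D'_def)
    show "\<exists>a b. D' a b \<and> 0 \<le> c * fst a + d * snd a \<and> 0 \<le> c * fst b + d * snd b" for c d :: int
    proof -
      obtain a b where "D a b \<and> d * fst a + c * snd a \<ge> 0 \<and> d * fst b + c * snd b \<ge> 0" using opp by blast
      then show ?thesis by (intro exI[of _ "prod.swap a"] exI[of _ "prod.swap b"]) (simp add: D'_def add.commute)
    qed
    have "chart S (0,0) (0,1) (1,0)" by (rule chart_commute[OF base(1)])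
    then show "chart (prod.swap ` S) (0,0) (1,0) (0,1)" using chart_swap[of S "(0,0)" "(0,1)" "(1,0)"] by simp
  qed (use s in \<open>auto simp: add.commute\<close>)
  show ?thesis
  proof (cases "(\<exists>a b. D a b \<and> fst a = 0 \<and> fst b = -1) \<or> (\<exists>a b. D a b \<and> snd a = 0 \<and> snd b = -1)")
    case False
    obtain E X where E: "E > 0" "X > 0" "D (-E,1) (-1,0)" "(of_int X, 0) \<in> S" "\<And>x y. (x,y) \<in> S \<Longrightarrow> x + of_int E * y \<le> of_int X"
      using c1 False by (metis fst_conv)
    obtain F Y where F: "F > 0" "Y > 0" "D' (-F,1) (-1,0)" "(0, of_int Y) \<in> S" "\<And>x y. (x,y) \<in> S \<Longrightarrow> y + of_int F * x \<le> of_int Y"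
      using c2 False unfolding D'_def mem_swap_image by (metis fst_conv snd_conv swap_simp snd_swap fst_swap)
    have "real_of_int (E * Y) \<le> of_int X" "real_of_int (F * X) \<le> of_int Y" using E(5)[OF F(4)] F(5)[OF E(4)] by simp_all
    then have 1: "E * Y \<le> X" "F * X \<le> Y" by (simp_all only: of_int_le_iff)
    have "Y \<le> E * Y" "X \<le> F * X" using E F by simp_all
    then have "E * Y = Y" "F * X = X" using 1 by linarith+
    then have "E = 1" "F = 1" using E F by auto
    then have "triangle_charts D" using E(3) F(3) base(2) by (simp add: triangle_charts_def D'_def)
    then show ?thesis by blast
  qed blast
qed

section \<open>Vertices of smooth polytopes\<close>

text \<open>Descent through facets: in dimension at least two a vertex lies in the relative
  frontier, hence in a facet, and a face of a face is a face.\<close>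

lemma polytope_edge_at_vertex:
  fixes Q :: "'a::euclidean_space set"
  assumes "polytope Q" "v extreme_point_of Q" "aff_dim Q \<ge> 1"
  shows "\<exists>w. closed_segment v w edge_of Q \<and> w \<noteq> v"
  using assms
proof (induction "nat (aff_dim Q)" arbitrary: Q rule: less_induct)
  case less
  note Q = less.prems
  have vQ: "v \<in> Q" using Q by (simp add: extreme_point_of_def)
  show ?case
  proof (cases "aff_dim Q = 1")
    case True
    then have "collinear Q" by (simp add: collinear_aff_dim)
    moreover have "compact Q" "convex Q" "Q \<noteq> {}" using Q vQ by (auto simp: polytope_imp_compact polytope_imp_convex)
    ultimately obtain a b where ab: "Q = closed_segment a b" using compact_convex_collinear_segment by metis
    then have "v = a \<or> v = b" using Q extreme_point_of_segment by metis
    then obtain w where w: "Q = closed_segment v w" using ab closed_segment_commute by metis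
    have "w \<noteq> v" using True w by auto
    moreover have "Q edge_of Q" unfolding edge_of_def using True Q by (simp add: face_of_refl polytope_imp_convex)
    ultimately show ?thesis using w by auto
  next
    case False
    then have d: "aff_dim Q \<ge> 2" using Q by linarith
    then have "Q \<noteq> {v}" by auto
    then have "v \<notin> rel_interior Q" using extreme_point_not_in_REL_INTERIOR Q by blast
    then have "v \<in> rel_frontier Q" using vQ closure_subset by (auto simp: rel_frontier_def)
    then obtain F where F: "v \<in> F" "F facet_of Q"
      using rel_frontier_of_polyhedron[OF polytope_imp_polyhedron[OF Q(1)]] by blast
    then have FQ: "F face_of Q" "aff_dim F = aff_dim Q - 1" by (auto simp: facet_of_def)
    have "polytope F" using face_of_polytope_polytope Q FQ by blast
    moreover have "v extreme_point_of F" using extreme_point_of_face[OF FQ(1)] Q F by blast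
    moreover have "nat (aff_dim F) < nat (aff_dim Q)" "1 \<le> aff_dim F" using FQ d by auto
    ultimately obtain w where "closed_segment v w edge_of F" "w \<noteq> v" using less.hyps by blast
    then show ?thesis using FQ(1) unfolding edge_of_def by (meson face_of_trans)
  qed
qed

text \<open>Optimality criterion of the simplex method: among the vertices below \<open>v\<close>, one of least slope
  against an exposing functional of \<open>v\<close> spans with \<open>v\<close> a face on which the objective decreases from \<open>v\<close>.\<close>

lemma polytope_local_min_imp_global:
  fixes P :: "'a::euclidean_space set"
  assumes P: "polytope P" and v: "v extreme_point_of P" and c: "\<And>w. closed_segment v w edge_of P \<Longrightarrow> c \<bullet> v \<le> c \<bullet> w"
    and x: "x \<in> P"
  shows "c \<bullet> v \<le> c \<bullet> x"
proof (rule ccontr)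
  assume "\<not> c \<bullet> v \<le> c \<bullet> x"
  obtain V where V: "finite V" "P = convex hull V" using P polytope_def by blast
  have vP: "v \<in> P" using v by (simp add: extreme_point_of_def)
  have cvx: "convex P" using P polytope_imp_convex by blast
  have VP: "V \<subseteq> P" unfolding V(2) by (rule hull_subset)
  have "{v} exposed_face_of P"
    using exposed_face_of_polyhedron[OF polytope_imp_polyhedron[OF P]] v face_of_singleton by blast
  then obtain h b where hb: "P \<subseteq> {x. h \<bullet> x \<le> b}" "{v} = P \<inter> {x. h \<bullet> x = b}" unfolding exposed_face_of_def by blast
  have hv: "h \<bullet> v = b" using hb(2) by blast
  have H: "b - h \<bullet> w > 0" if w: "w \<in> P" "w \<noteq> v" for w
  proof -
    have "h \<bullet> w \<noteq> b" using hb(2) w by blast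
    moreover have "h \<bullet> w \<le> b" using hb(1) w by blast
    ultimately show ?thesis by simp
  qed
  have "\<exists>w\<in>V. c \<bullet> w < c \<bullet> v"
  proof (rule ccontr)
    assume "\<not> ?thesis"
    then have "V \<subseteq> {w. c \<bullet> w \<ge> c \<bullet> v}" by auto
    then have "P \<subseteq> {w. c \<bullet> w \<ge> c \<bullet> v}" unfolding V(2) by (intro hull_minimal convex_halfspace_ge)
    then show False using x \<open>\<not> c \<bullet> v \<le> c \<bullet> x\<close> by auto
  qed
  then obtain w0 where w0: "w0 \<in> V" "c \<bullet> w0 < c \<bullet> v" by blast
  define r where "r w = (c \<bullet> w - c \<bullet> v) / (b - h \<bullet> w)" for w
  have "finite (V - {v})" "w0 \<in> V - {v}" using V w0 by auto
  then have "Min (r ` (V - {v})) \<in> r ` (V - {v})" by (intro Min_in) auto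
  then obtain w where "w \<in> V - {v}" "Min (r ` (V - {v})) = r w" by (rule imageE)
  then have w: "w \<in> V" "w \<noteq> v" "r w = Min (r ` (V - {v}))" by simp_all
  define l where "l = r w"
  have lle: "l \<le> r z" if "z \<in> V" "z \<noteq> v" for z
    unfolding l_def w(3) using V that by (intro Min_le) auto
  have Hw0: "b - h \<bullet> w0 > 0" by (rule H) (use w0 VP in auto)
  have "r w0 < 0" unfolding r_def using w0 Hw0 by (simp add: divide_neg_pos)
  then have l0: "l < 0" using lle[of w0] w0 by force
  have g: "(c + l *\<^sub>R h) \<bullet> z \<ge> c \<bullet> v + l * b" if "z \<in> V" for z
  proof (cases "z = v")
    case True then show ?thesis by (simp add: inner_add_left hv)
  next
    case False
    then have "l * (b - h \<bullet> z) \<le> c \<bullet> z - c \<bullet> v" using lle[OF that False] H[of z] that VP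
      by (auto simp: r_def pos_le_divide_eq)
    then show ?thesis by (simp add: inner_add_left algebra_simps)
  qed
  have gP: "(c + l *\<^sub>R h) \<bullet> z \<ge> c \<bullet> v + l * b" if "z \<in> P" for z
  proof -
    have "P \<subseteq> {z. (c + l *\<^sub>R h) \<bullet> z \<ge> c \<bullet> v + l * b}"
      unfolding V(2) using g by (intro hull_minimal convex_halfspace_ge) auto
    then show ?thesis using that by auto
  qed
  define E where "E = P \<inter> {z. (c + l *\<^sub>R h) \<bullet> z = c \<bullet> v + l * b}"
  have EP: "E face_of P" unfolding E_def by (rule face_of_Int_supporting_hyperplane_ge[OF cvx gP])
  have vE: "v \<in> E" using vP by (simp add: E_def inner_add_left hv)
  have "b - h \<bullet> w \<noteq> 0" using H[of w] w VP by auto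
  then have "l * (b - h \<bullet> w) = c \<bullet> w - c \<bullet> v" by (simp add: l_def r_def)
  then have wE: "w \<in> E" using w VP by (auto simp: E_def inner_add_left algebra_simps)
  have "aff_dim {v,w} \<le> aff_dim E" using vE wE by (intro aff_dim_subset) auto
  then have "aff_dim E \<ge> 1" using w by simp
  moreover have "polytope E" using face_of_polytope_polytope P EP by blast
  moreover have "v extreme_point_of E" using extreme_point_of_face[OF EP] v vE by blast
  ultimately obtain u where u: "closed_segment v u edge_of E" "u \<noteq> v" using polytope_edge_at_vertex by blast
  then have uE: "u \<in> E" using edge_of_imp_subset by (metis ends_in_segment(2) subsetD)
  have "closed_segment v u edge_of P" using u EP unfolding edge_of_def by (meson face_of_trans)
  then have "c \<bullet> v \<le> c \<bullet> u" by (rule c)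
  moreover have "c \<bullet> u - c \<bullet> v = l * (b - h \<bullet> u)" using uE by (simp add: E_def inner_add_left algebra_simps)
  moreover have "l * (b - h \<bullet> u) < 0" using H[of u] u uE l0 by (auto simp: E_def mult_neg_pos)
  ultimately show False by simp
qed

section \<open>Lattice bases, primitive vectors and tangent cones\<close>

lemma int_lattice_add: "x \<in> int_lattice \<Longrightarrow> y \<in> int_lattice \<Longrightarrow> x + y \<in> int_lattice"
  and int_lattice_diff: "x \<in> int_lattice \<Longrightarrow> y \<in> int_lattice \<Longrightarrow> x - y \<in> int_lattice"
  and int_lattice_minus: "x \<in> int_lattice \<Longrightarrow> - x \<in> int_lattice"
  and int_lattice_scale: "x \<in> int_lattice \<Longrightarrow> of_int k *\<^sub>R x \<in> int_lattice"
  by (auto simp: int_lattice_def)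

text \<open>Generation over the integers is enough: three generators of the lattice span the space,
  so they are distinct and independent. The ordered triple gives access to named
  coordinates.\<close>

definition lattice_basis3 :: "real ^ 3 \<Rightarrow> real ^ 3 \<Rightarrow> real ^ 3 \<Rightarrow> bool" where
  "lattice_basis3 a b d \<longleftrightarrow> a \<in> int_lattice \<and> b \<in> int_lattice \<and> d \<in> int_lattice \<and>
     (\<forall>x\<in>int_lattice. \<exists>i j k :: int. x = of_int i *\<^sub>R a + of_int j *\<^sub>R b + of_int k *\<^sub>R d)"

lemma lattice_basis3_span:
  assumes "lattice_basis3 a b d"
  shows "span {a,b,d} = UNIV"
proof -
  have "axis i 1 \<in> span {a,b,d}" for i
  proof -
    have "axis i (1::real) \<in> int_lattice" by (auto simp: int_lattice_def axis_def)
    then obtain l j k :: int where "axis i 1 = of_int l *\<^sub>R a + of_int j *\<^sub>R b + of_int k *\<^sub>R d"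
      using assms unfolding lattice_basis3_def by blast
    then show ?thesis by (simp add: span_add span_scale span_base)
  qed
  then have "Basis \<subseteq> span {a,b,d}" by (auto simp: Basis_vec_def)
  then show ?thesis by (metis span_Basis span_mono span_span top.extremum_uniqueI)
qed

lemma lattice_basis3_independent:
  assumes "lattice_basis3 a b d"
  shows "independent {a,b,d}" "card {a,b,d} = 3"
proof -
  have "card {a,b,d} \<le> 3" by (simp add: card_insert_if)
  moreover have "dim (UNIV :: (real^3) set) = 3" by simp
  moreover have "dim (span {a,b,d}) \<le> card {a,b,d}" by (metis dim_le_card' dim_span finite.emptyI finite.insertI)
  ultimately show "card {a,b,d} = 3" using lattice_basis3_span[OF assms] by simp
  then show "independent {a,b,d}" using lattice_basis3_span[OF assms]
    by (intro card_le_dim_spanning[of _ UNIV]) auto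
qed

lemma lattice_basis3_unique:
  assumes "lattice_basis3 a b d" "i *\<^sub>R a + j *\<^sub>R b + k *\<^sub>R d = i' *\<^sub>R a + j' *\<^sub>R b + k' *\<^sub>R d"
  shows "i = i' \<and> j = j' \<and> k = k'"
proof -
  have ds: "a \<noteq> b" "a \<noteq> d" "b \<noteq> d" using lattice_basis3_independent(2)[OF assms(1)] by (auto simp: card_insert_if split: if_splits)
  define f where "f x = (if x = a then i - i' else if x = b then j - j' else k - k')" for x
  have "(\<Sum>x\<in>{a,b,d}. f x *\<^sub>R x) = (i - i') *\<^sub>R a + (j - j') *\<^sub>R b + (k - k') *\<^sub>R d"
    using ds by (simp add: f_def add.assoc)
  also have "\<dots> = (i *\<^sub>R a + j *\<^sub>R b + k *\<^sub>R d) - (i' *\<^sub>R a + j' *\<^sub>R b + k' *\<^sub>R d)" by (simp add: algebra_simps)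
  also have "\<dots> = 0" using assms(2) by simp
  finally have "\<forall>x\<in>{a,b,d}. f x = 0"
    using independentD[OF lattice_basis3_independent(1)[OF assms(1)], of "{a,b,d}" f] by simp
  then show ?thesis using ds by (auto simp: f_def)
qed

lemma lattice_basis3_coords:
  assumes "lattice_basis3 a b d"
  obtains i j k where "x = i *\<^sub>R a + j *\<^sub>R b + k *\<^sub>R d"
proof -
  have "x \<in> span {a,b,d}" using lattice_basis3_span[OF assms] by simp
  then obtain i j k where "x - i *\<^sub>R a - j *\<^sub>R b - k *\<^sub>R d = 0"
    unfolding span_breakdown_eq by auto
  then have "x = i *\<^sub>R a + j *\<^sub>R b + k *\<^sub>R d" by (simp add: algebra_simps)
  then show ?thesis by (rule that)
qed

lemma lattice_basis_imp_basis3: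
  assumes "lattice_basis B"
  shows "\<exists>a b d. B = {a,b,d} \<and> lattice_basis3 a b d"
proof -
  have B: "finite B" "independent B" and L: "{\<Sum>b\<in>B. of_int (c b) *\<^sub>R b | c :: real ^ 3 \<Rightarrow> int. True} = int_lattice"
    using assms by (auto simp: lattice_basis_def)
  have "axis i 1 \<in> span B" for i
  proof -
    have "axis i (1::real) \<in> int_lattice" by (auto simp: int_lattice_def axis_def)
    then obtain c :: "real^3 \<Rightarrow> int" where "axis i 1 = (\<Sum>b\<in>B. of_int (c b) *\<^sub>R b)" using L by blast
    then show ?thesis by (simp add: span_sum span_scale span_base)
  qed
  then have "Basis \<subseteq> span B" by (auto simp: Basis_vec_def)
  then have "span B = UNIV" by (metis span_Basis span_mono span_span top.extremum_uniqueI)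
  then have "card B = 3" using B dim_eq_card[of B UNIV] by simp
  then obtain a b d where abd: "B = {a,b,d}" "a \<noteq> b" "a \<noteq> d" "b \<noteq> d" by (auto simp: card_3_iff)
  have sum: "(\<Sum>x\<in>B. of_int (c x) *\<^sub>R x) = of_int (c a) *\<^sub>R a + of_int (c b) *\<^sub>R b + of_int (c d) *\<^sub>R d" for c :: "real^3 \<Rightarrow> int"
    using abd by (simp add: add.assoc)
  have mem: "x \<in> int_lattice" if "x \<in> B" for x
  proof -
    have "(\<Sum>y\<in>B. of_int (if y = x then 1 else 0) *\<^sub>R y) = (\<Sum>y\<in>B. if y = x then y else 0)"
      by (intro sum.cong) auto
    also have "\<dots> = x" using B that by simp
    finally have "x \<in> {\<Sum>b\<in>B. of_int (c b) *\<^sub>R b | c :: real ^ 3 \<Rightarrow> int. True}" by (intro CollectI exI[of _ "\<lambda>y. if y = x then 1 else 0"]) simp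
    then show ?thesis unfolding L .
  qed
  have "lattice_basis3 a b d" unfolding lattice_basis3_def
  proof (intro conjI ballI)
    fix x assume "x \<in> int_lattice"
    then obtain c :: "real^3 \<Rightarrow> int" where "x = (\<Sum>b\<in>B. of_int (c b) *\<^sub>R b)" using L by blast
    then show "\<exists>i j k :: int. x = of_int i *\<^sub>R a + of_int j *\<^sub>R b + of_int k *\<^sub>R d" unfolding sum by blast
  qed (use mem abd in auto)
  then show ?thesis using abd by blast
qed

lemma lattice_basis3_imp_basis:
  assumes "lattice_basis3 a b d"
  shows "lattice_basis {a,b,d}"
proof -
  have ds: "a \<noteq> b" "a \<noteq> d" "b \<noteq> d" using lattice_basis3_independent(2)[OF assms] by (auto simp: card_insert_if split: if_splits)
  have sum: "(\<Sum>x\<in>{a,b,d}. of_int (c x) *\<^sub>R x) = of_int (c a) *\<^sub>R a + of_int (c b) *\<^sub>R b + of_int (c d) *\<^sub>R d" for c :: "real^3 \<Rightarrow> int"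
    using ds by (simp add: add.assoc)
  have "{\<Sum>x\<in>{a,b,d}. of_int (c x) *\<^sub>R x | c :: real ^ 3 \<Rightarrow> int. True} = int_lattice"
  proof
    show "{\<Sum>x\<in>{a,b,d}. of_int (c x) *\<^sub>R x | c :: real ^ 3 \<Rightarrow> int. True} \<subseteq> int_lattice"
      using assms unfolding sum lattice_basis3_def by (auto intro!: int_lattice_add int_lattice_scale)
    show "int_lattice \<subseteq> {\<Sum>x\<in>{a,b,d}. of_int (c x) *\<^sub>R x | c :: real ^ 3 \<Rightarrow> int. True}"
    proof
      fix x assume "x \<in> int_lattice"
      then obtain i j k :: int where x: "x = of_int i *\<^sub>R a + of_int j *\<^sub>R b + of_int k *\<^sub>R d"
        using assms unfolding lattice_basis3_def by blast
      show "x \<in> {\<Sum>x\<in>{a,b,d}. of_int (c x) *\<^sub>R x | c :: real ^ 3 \<Rightarrow> int. True}" unfolding sum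
        using ds by (intro CollectI exI[of _ "\<lambda>y. if y = a then i else if y = b then j else k"]) (auto simp: x)
    qed
  qed
  then show ?thesis using lattice_basis3_independent[OF assms] by (simp add: lattice_basis_def)
qed

text \<open>The first coordinate functional, turned into a vector by means of the adjoint.\<close>

lemma lattice_basis3_dual:
  assumes "lattice_basis3 a b d"
  obtains \<alpha> where "\<alpha> \<bullet> a = 1" "\<alpha> \<bullet> b = 0" "\<alpha> \<bullet> d = 0"
proof -
  have ds: "a \<noteq> b" "a \<noteq> d" "b \<noteq> d" using lattice_basis3_independent(2)[OF assms] by (auto simp: card_insert_if split: if_splits)
  obtain g :: "real^3 \<Rightarrow> real" where g: "linear g" "\<forall>x\<in>{a,b,d}. g x = (if x = a then 1 else 0)"
    using linear_independent_extend[OF lattice_basis3_independent(1)[OF assms], of "\<lambda>x. if x = a then 1 else 0"] by blast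
  have "adjoint g 1 \<bullet> x = g x" for x using adjoint_works[OF g(1), of x 1] by (simp add: inner_commute)
  then show ?thesis using that[of "adjoint g 1"] g(2) ds by auto
qed

lemma lattice_polytope_extreme_in_lattice:
  assumes "lattice_polytope P" "v extreme_point_of P"
  shows "v \<in> int_lattice"
  using assms extreme_point_of_convex_hull unfolding lattice_polytope_def by blast

text \<open>Among the positive multiples of \<open>z\<close> in the lattice, one with least absolute
  value of a nonzero coordinate is primitive: a lattice point between it and the origin would have a
  smaller one.\<close>

lemma primitive_multiple_exists:
  assumes z: "z \<in> int_lattice" "z \<noteq> 0"
  shows "\<exists>u t. primitive_vector u \<and> t > 0 \<and> z = t *\<^sub>R u"
proof -
  obtain i where i: "z $ i \<noteq> 0" using z(2) by (auto simp: vec_eq_iff)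
  let ?Q = "\<lambda>l::real. 0 < l \<and> l *\<^sub>R z \<in> int_lattice"
  have "?Q 1" using z by simp
  then obtain l where l: "?Q l" "\<And>k. ?Q k \<Longrightarrow> nat \<lfloor>\<bar>(l *\<^sub>R z) $ i\<bar>\<rfloor> \<le> nat \<lfloor>\<bar>(k *\<^sub>R z) $ i\<bar>\<rfloor>"
    using ex_has_least_nat[of ?Q 1 "\<lambda>l. nat \<lfloor>\<bar>(l *\<^sub>R z) $ i\<bar>\<rfloor>"] by blast
  have "open_segment 0 (l *\<^sub>R z) \<inter> int_lattice = {}"
  proof (rule ccontr)
    assume "open_segment 0 (l *\<^sub>R z) \<inter> int_lattice \<noteq> {}"
    then obtain s where s: "0 < s" "s < 1" "s *\<^sub>R (l *\<^sub>R z) \<in> int_lattice" by (auto simp: in_segment)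
    then have q: "?Q (s * l)" using l(1) by simp
    obtain m1 where m1: "(l *\<^sub>R z) $ i = of_int m1" using l(1) unfolding int_lattice_def by (auto elim!: Ints_cases)
    obtain m2 where m2: "((s * l) *\<^sub>R z) $ i = of_int m2" using q unfolding int_lattice_def by (blast elim!: Ints_cases)
    have "\<bar>((s * l) *\<^sub>R z) $ i\<bar> = s * \<bar>(l *\<^sub>R z) $ i\<bar>" using s by (simp add: abs_mult)
    moreover have "\<bar>(l *\<^sub>R z) $ i\<bar> > 0" using l(1) i by simp
    ultimately have "\<bar>((s * l) *\<^sub>R z) $ i\<bar> < \<bar>(l *\<^sub>R z) $ i\<bar>" using s by simp
    then have "\<bar>real_of_int m2\<bar> < \<bar>real_of_int m1\<bar>" unfolding m1 m2 .
    then have "\<bar>m2\<bar> < \<bar>m1\<bar>" by (simp only: of_int_abs[symmetric] of_int_less_iff)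
    then have "nat \<bar>m2\<bar> < nat \<bar>m1\<bar>" by linarith
    moreover have "nat \<lfloor>\<bar>real_of_int m1\<bar>\<rfloor> \<le> nat \<lfloor>\<bar>real_of_int m2\<bar>\<rfloor>" using l(2)[OF q] unfolding m1 m2 .
    then have "nat \<bar>m1\<bar> \<le> nat \<bar>m2\<bar>" by (simp flip: of_int_abs)
    ultimately show False by linarith
  qed
  then have "primitive_vector (l *\<^sub>R z)" using l(1) z by (simp add: primitive_vector_def)
  moreover have "1 / l > 0" "z = (1 / l) *\<^sub>R (l *\<^sub>R z)" using l(1) by simp_all
  ultimately show ?thesis by blast
qed

lemma primitive_vector_minus: "primitive_vector u \<Longrightarrow> primitive_vector (- u)"
proof -
  assume u: "primitive_vector u"
  have "open_segment 0 (- u) \<inter> int_lattice = {}"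
  proof (rule ccontr)
    assume "open_segment 0 (- u) \<inter> int_lattice \<noteq> {}"
    then obtain s where s: "0 < s" "s < 1" "- (s *\<^sub>R u) \<in> int_lattice" by (auto simp: in_segment)
    then have "s *\<^sub>R u \<in> int_lattice" using int_lattice_minus by fastforce
    moreover have "s *\<^sub>R u \<in> open_segment 0 u" using s u by (auto simp: in_segment primitive_vector_def)
    ultimately show False using u by (auto simp: primitive_vector_def)
  qed
  then show ?thesis using u int_lattice_minus by (auto simp: primitive_vector_def)
qed

text \<open>The length of the edge in units of \<open>u\<close> is an integer, since its fractional
  part times \<open>u\<close> would be a lattice point inside the primitive segment.\<close>

lemma primitive_edge_direction_edge:
  assumes P: "lattice_polytope P" and v: "v extreme_point_of P" and u: "u \<in> primitive_edge_directions P v"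
  obtains l :: int where "l \<ge> 1" "v + of_int l *\<^sub>R u extreme_point_of P" "v + u \<in> P"
    "- u \<in> primitive_edge_directions P (v + of_int l *\<^sub>R u)"
proof -
  obtain w t where wt: "primitive_vector u" "closed_segment v w edge_of P" "t > 0" "w - v = t *\<^sub>R u"
    using u unfolding primitive_edge_directions_def by blast
  have face: "closed_segment v w face_of P" using wt(2) by (simp add: edge_of_def)
  have w: "w extreme_point_of P"
    using extreme_point_of_face[OF face] extreme_point_of_segment[of w v w] by blast
  have lat: "v \<in> int_lattice" "w \<in> int_lattice" using lattice_polytope_extreme_in_lattice[OF P] v w by auto
  have u': "u \<in> int_lattice" "u \<noteq> 0" using wt(1) by (auto simp: primitive_vector_def)
  have "frac t = 0"
  proof (rule ccontr)
    assume "frac t \<noteq> 0"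
    then have f: "0 < frac t" "frac t < 1" by (simp_all add: frac_lt_1 order.order_iff_strict[of 0 "frac t"])
    have "frac t *\<^sub>R u = (w - v) - of_int \<lfloor>t\<rfloor> *\<^sub>R u" unfolding wt(4) by (simp add: frac_def algebra_simps)
    then have "frac t *\<^sub>R u \<in> int_lattice" using lat u' by (simp add: int_lattice_diff int_lattice_scale)
    moreover have "frac t *\<^sub>R u \<in> open_segment 0 u" using f u' by (auto simp: in_segment)
    ultimately show False using wt(1) by (auto simp: primitive_vector_def)
  qed
  then obtain l :: int where l: "t = of_int l" by (metis Ints_cases frac_eq_0_iff)
  then have l1: "l \<ge> 1" using wt(3) by simp
  have wl: "w = v + of_int l *\<^sub>R u" using wt(4) l by (metis add.commute diff_add_cancel)
  have "v + u \<in> closed_segment v w"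
    unfolding in_segment
  proof (intro exI conjI)
    show "v + u = (1 - 1 / of_int l) *\<^sub>R v + (1 / of_int l) *\<^sub>R w" unfolding wl using l1 by (simp add: algebra_simps)
  qed (use l1 in auto)
  then have "v + u \<in> P" using face face_of_imp_subset by blast
  moreover have "- u \<in> primitive_edge_directions P w" unfolding primitive_edge_directions_def
  proof (intro CollectI conjI exI)
    show "closed_segment w v edge_of P" using wt(2) by (simp add: closed_segment_commute)
    show "v - w = t *\<^sub>R (- u)" using wt(4) by (metis minus_diff_eq scaleR_minus_right)
  qed (use wt primitive_vector_minus in auto)
  ultimately show ?thesis using that[of l] l1 w wl by simp
qed

lemma lattice_basis3_perm:
  assumes "lattice_basis3 a b d"
  shows "lattice_basis3 b a d" "lattice_basis3 a d b" "lattice_basis3 d b a" "lattice_basis3 b d a"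
proof -
  have 1: "lattice_basis3 y x z" if *: "lattice_basis3 x y z" for x y z
    unfolding lattice_basis3_def
  proof (intro conjI ballI)
    fix w assume "w \<in> int_lattice"
    then obtain i j k :: int where "w = of_int i *\<^sub>R x + of_int j *\<^sub>R y + of_int k *\<^sub>R z"
      using * unfolding lattice_basis3_def by blast
    then have "w = of_int j *\<^sub>R y + of_int i *\<^sub>R x + of_int k *\<^sub>R z" by simp
    then show "\<exists>i j k :: int. w = of_int i *\<^sub>R y + of_int j *\<^sub>R x + of_int k *\<^sub>R z" by blast
  qed (use * in \<open>simp_all add: lattice_basis3_def\<close>)
  have 2: "lattice_basis3 x z y" if *: "lattice_basis3 x y z" for x y z
    unfolding lattice_basis3_def
  proof (intro conjI ballI)
    fix w assume "w \<in> int_lattice"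
    then obtain i j k :: int where "w = of_int i *\<^sub>R x + of_int j *\<^sub>R y + of_int k *\<^sub>R z"
      using * unfolding lattice_basis3_def by blast
    then have "w = of_int i *\<^sub>R x + of_int k *\<^sub>R z + of_int j *\<^sub>R y" by simp
    then show "\<exists>i j k :: int. w = of_int i *\<^sub>R x + of_int j *\<^sub>R z + of_int k *\<^sub>R y" by blast
  qed (use * in \<open>simp_all add: lattice_basis3_def\<close>)
  show "lattice_basis3 b a d" "lattice_basis3 a d b" "lattice_basis3 d b a" "lattice_basis3 b d a"
    using assms 1 2 by blast+
qed

text \<open>The dual vector of \<open>a\<close> is nonnegative on all edge directions at
  \<open>v\<close>, so \<open>v\<close> minimises it along its edges and, by
  \<open>polytope_local_min_imp_global\<close>, on \<open>P\<close>. This is the sign of the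
  coordinate along \<open>a\<close>; the other two are treated alike.\<close>

lemma smooth_tangent_cone:
  assumes P: "smooth_polytope P" and v: "v extreme_point_of P"
    and B: "primitive_edge_directions P v = {a,b,d}" "lattice_basis3 a b d" and x: "x \<in> P"
  shows "\<exists>i\<ge>0. \<exists>j\<ge>0. \<exists>k\<ge>0. x = v + i *\<^sub>R a + j *\<^sub>R b + k *\<^sub>R d"
proof -
  have L: "lattice_polytope P" and pt: "polytope P" using P by (auto simp: smooth_polytope_def simple_polytope_def)
  obtain i j k where x': "x - v = i *\<^sub>R a + j *\<^sub>R b + k *\<^sub>R d" using lattice_basis3_coords[OF B(2)] by metis
  have dual: "0 \<le> i" if al: "\<alpha> \<bullet> a = 1" "\<alpha> \<bullet> b = 0" "\<alpha> \<bullet> d = 0" "x - v = i *\<^sub>R a + j *\<^sub>R b + k *\<^sub>R d"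
    and B': "primitive_edge_directions P v = {a,b,d}" for \<alpha> a b d i j k
  proof -
    have "\<alpha> \<bullet> v \<le> \<alpha> \<bullet> w" if e: "closed_segment v w edge_of P" for w
    proof (cases "w = v")
      case False
      have "closed_segment v w face_of P" using e by (simp add: edge_of_def)
      then have "w extreme_point_of P" using extreme_point_of_face extreme_point_of_segment by blast
      then have "w - v \<in> int_lattice" using lattice_polytope_extreme_in_lattice[OF L] v int_lattice_diff by blast
      then obtain u t where ut: "primitive_vector u" "t > 0" "w - v = t *\<^sub>R u"
        using primitive_multiple_exists False by (metis eq_iff_diff_eq_0)
      then have "u \<in> {a,b,d}" using e B' unfolding primitive_edge_directions_def by blast
      then have "\<alpha> \<bullet> u \<ge> 0" using al by auto
      then have "\<alpha> \<bullet> (w - v) \<ge> 0" unfolding ut(3) using ut(2) by simp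
      then show ?thesis by (simp add: inner_diff_right)
    qed simp
    then have "\<alpha> \<bullet> v \<le> \<alpha> \<bullet> x" by (rule polytope_local_min_imp_global[OF pt v _ x])
    then have "\<alpha> \<bullet> (x - v) \<ge> 0" by (simp add: inner_diff_right)
    then show ?thesis unfolding al(4) by (simp add: inner_add_right al)
  qed
  obtain \<alpha> where "\<alpha> \<bullet> a = 1" "\<alpha> \<bullet> b = 0" "\<alpha> \<bullet> d = 0" using lattice_basis3_dual[OF B(2)] by metis
  then have "0 \<le> i" using dual[OF _ _ _ x' B(1)] by blast
  moreover obtain \<beta> where "\<beta> \<bullet> b = 1" "\<beta> \<bullet> a = 0" "\<beta> \<bullet> d = 0"
    using lattice_basis3_dual[OF lattice_basis3_perm(1)[OF B(2)]] by metis
  then have "0 \<le> j" using dual[of \<beta> b a d j i k] x' B(1) by (simp add: insert_commute add.commute)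
  moreover obtain \<gamma> where "\<gamma> \<bullet> d = 1" "\<gamma> \<bullet> b = 0" "\<gamma> \<bullet> a = 0"
    using lattice_basis3_dual[OF lattice_basis3_perm(3)[OF B(2)]] by metis
  then have "0 \<le> k" using dual[of \<gamma> d b a k j i] x' B(1) by (simp add: insert_commute add.commute add.left_commute)
  moreover have "x = v + i *\<^sub>R a + j *\<^sub>R b + k *\<^sub>R d" using x' by (simp add: algebra_simps)
  ultimately show ?thesis by blast
qed

text \<open>No direction has a negative product with \<open>n\<close>. Two positive products would
  confine the face to a line, and three zeros would confine \<open>P\<close> to a plane.\<close>

lemma smooth_vertex_at_facet:
  assumes P: "smooth_polytope P" "aff_dim P = 3" and v: "v extreme_point_of P"
    and n: "\<And>x. x \<in> P \<Longrightarrow> c \<le> n \<bullet> x" "n \<bullet> v = c" "n \<noteq> 0" and K: "aff_dim (P \<inter> {x. n \<bullet> x = c}) \<ge> 2"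
  shows "\<exists>a b d. primitive_edge_directions P v = {a,b,d} \<and> lattice_basis3 a b d \<and> n \<bullet> a = 0 \<and> n \<bullet> b = 0 \<and> n \<bullet> d > 0"
proof -
  have L: "lattice_polytope P" using P by (simp add: smooth_polytope_def)
  obtain a b d where B: "primitive_edge_directions P v = {a,b,d}" "lattice_basis3 a b d"
    using P(1) v lattice_basis_imp_basis3 unfolding smooth_polytope_def by metis
  have ge: "n \<bullet> u \<ge> 0" if "u \<in> {a,b,d}" for u
  proof -
    have "v + u \<in> P" using primitive_edge_direction_edge[OF L v] that B(1) by metis
    then show ?thesis using n(1)[of "v + u"] n(2) by (simp add: inner_add_right)
  qed
  have two: "\<not> (n \<bullet> x > 0 \<and> n \<bullet> y > 0)"
    if xyz: "{x,y,z} = {a,b,d}" "lattice_basis3 x y z" for x y z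
  proof
    assume pos: "n \<bullet> x > 0 \<and> n \<bullet> y > 0"
    have z0: "n \<bullet> z \<ge> 0" using ge xyz by blast
    have "P \<inter> {w. n \<bullet> w = c} \<subseteq> affine hull {v, v + z}"
    proof
      fix w assume w: "w \<in> P \<inter> {w. n \<bullet> w = c}"
      then obtain i j k where ijk: "i \<ge> 0" "j \<ge> 0" "k \<ge> 0" "w = v + i *\<^sub>R x + j *\<^sub>R y + k *\<^sub>R z"
        using smooth_tangent_cone[OF P(1) v, of x y z w] B(1) xyz by auto
      then have "i * (n \<bullet> x) + j * (n \<bullet> y) + k * (n \<bullet> z) = 0" using w n(2) by (auto simp: inner_add_right)
      moreover have "i * (n \<bullet> x) \<ge> 0" "j * (n \<bullet> y) \<ge> 0" "k * (n \<bullet> z) \<ge> 0" using ijk pos z0 by auto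
      ultimately have "i * (n \<bullet> x) = 0" "j * (n \<bullet> y) = 0" by linarith+
      then have "w = (1 - k) *\<^sub>R v + k *\<^sub>R (v + z)" using pos ijk by (simp add: algebra_simps)
      then show "w \<in> affine hull {v, v + z}" unfolding affine_hull_2 by (intro CollectI exI[of _ "1-k"] exI[of _ k]) simp
    qed
    then have "aff_dim (P \<inter> {w. n \<bullet> w = c}) \<le> aff_dim {v, v + z}"
      by (metis aff_dim_affine_hull aff_dim_subset)
    also have "\<dots> \<le> 1" by simp
    finally show False using K by simp
  qed
  have "\<not> (n \<bullet> a = 0 \<and> n \<bullet> b = 0 \<and> n \<bullet> d = 0)"
  proof
    assume 0: "n \<bullet> a = 0 \<and> n \<bullet> b = 0 \<and> n \<bullet> d = 0"
    have "n \<bullet> w = c" if "w \<in> P" for w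
    proof -
      obtain i j k where "w = v + i *\<^sub>R a + j *\<^sub>R b + k *\<^sub>R d" using smooth_tangent_cone[OF P(1) v B \<open>w \<in> P\<close>] by blast
      then show ?thesis using 0 n(2) by (simp add: inner_add_right)
    qed
    then have "P \<subseteq> {w. n \<bullet> w = c}" by blast
    then have "aff_dim P \<le> aff_dim {w. n \<bullet> w = c}" by (rule aff_dim_subset)
    then show False using P(2) n(3) by simp
  qed
  moreover note ge[of a] ge[of b] ge[of d] two[of a b d] two[of a d b] two[of b d a] lattice_basis3_perm[OF B(2)] B(2)
  ultimately consider "n \<bullet> a = 0" "n \<bullet> b = 0" "n \<bullet> d > 0" | "n \<bullet> a = 0" "n \<bullet> d = 0" "n \<bullet> b > 0" | "n \<bullet> b = 0" "n \<bullet> d = 0" "n \<bullet> a > 0"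
    by (auto simp: insert_commute order.order_iff_strict)
  then show ?thesis
  proof cases
    case 1 then show ?thesis using B by blast
  next
    case 2
    have "primitive_edge_directions P v = {a,d,b}" using B(1) by (simp add: insert_commute)
    then show ?thesis using 2 lattice_basis3_perm(2)[OF B(2)] by blast
  next
    case 3
    have "primitive_edge_directions P v = {b,d,a}" using B(1) by (simp add: insert_commute)
    then show ?thesis using 3 lattice_basis3_perm(4)[OF B(2)] by blast
  qed
qed

text \<open>Parallel affine hulls are translates, so the normal of \<open>F\<close> is constant on
  \<open>G\<close>. The two values differ, as otherwise \<open>G\<close> would be a proper face of
  \<open>F\<close> of the same dimension. All of \<open>P\<close> lies in between because its
  vertices do.\<close>

lemma prismatoid_supporting_planes:
  assumes "prismatoid P"
  shows "\<exists>n c c'. c < c' \<and> (\<forall>x\<in>P. c \<le> n \<bullet> x \<and> n \<bullet> x \<le> c') \<and>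
    (\<forall>v. v extreme_point_of P \<longrightarrow> n \<bullet> v = c \<or> n \<bullet> v = c') \<and>
    aff_dim (P \<inter> {x. n \<bullet> x = c}) \<ge> aff_dim P - 1 \<and> aff_dim (P \<inter> {x. n \<bullet> x = c'}) \<ge> aff_dim P - 1"
proof -
  obtain F G where FG: "F facet_of P" "G facet_of P" "F \<noteq> G" "affine_parallel (affine hull F) (affine hull G)"
    "{v. v extreme_point_of P} \<subseteq> F \<union> G" and P: "polytope P" using assms unfolding prismatoid_def by blast
  have F: "F face_of P" "F \<noteq> {}" "aff_dim F = aff_dim P - 1" and G: "G face_of P" "G \<noteq> {}" "aff_dim G = aff_dim P - 1"
    using FG by (auto simp: facet_of_def)
  have cvx: "convex P" "compact P" using P by (auto simp: polytope_imp_convex polytope_imp_compact)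
  have "F exposed_face_of P" using exposed_face_of_polyhedron[OF polytope_imp_polyhedron[OF P]] F by blast
  then obtain m e where me: "P \<subseteq> {x. m \<bullet> x \<le> e}" "F = P \<inter> {x. m \<bullet> x = e}" unfolding exposed_face_of_def by blast
  define n c where "n = - m" and "c = - e"
  have nP: "c \<le> n \<bullet> x" if "x \<in> P" for x using me(1) that by (auto simp: n_def c_def)
  have nF: "F = P \<inter> {x. n \<bullet> x = c}" using me(2) by (auto simp: n_def c_def)
  have "F \<subseteq> {x. n \<bullet> x = c}" using nF by blast
  then have hF: "affine hull F \<subseteq> {x. n \<bullet> x = c}" by (intro hull_minimal affine_hyperplane)
  obtain a where a: "affine hull G = (\<lambda>x. a + x) ` (affine hull F)" using FG(4) unfolding affine_parallel_def by blast
  define c' where "c' = c + n \<bullet> a"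
  have nG: "n \<bullet> x = c'" if "x \<in> G" for x
  proof -
    have "x \<in> affine hull G" using that by (rule hull_inc)
    then obtain y where "x = a + y" "y \<in> affine hull F" unfolding a by blast
    then show ?thesis using hF by (auto simp: inner_add_right c'_def)
  qed
  have GP: "G \<subseteq> P" using G face_of_imp_subset by blast
  obtain g where "g \<in> G" using G by blast
  then have "c \<le> c'" using nP[of g] nG[of g] GP by auto
  moreover have "c \<noteq> c'"
  proof
    assume "c = c'"
    then have "G \<subseteq> F" using nF nG GP by auto
    then have "G face_of F" using face_of_face[OF F(1)] G by blast
    then have "aff_dim G < aff_dim F" using face_of_aff_dim_lt face_of_imp_convex F FG by metis
    then show False using F G by simp
  qed
  ultimately have lt: "c < c'" by simp
  have ext: "n \<bullet> v = c \<or> n \<bullet> v = c'" if "v extreme_point_of P" for v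
    using that FG(5) nF nG by blast
  have le: "n \<bullet> x \<le> c'" if "x \<in> P" for x
  proof -
    have "{v. v extreme_point_of P} \<subseteq> {x. n \<bullet> x \<le> c'}" using ext lt by fastforce
    then have "convex hull {v. v extreme_point_of P} \<subseteq> {x. n \<bullet> x \<le> c'}"
      by (intro hull_minimal convex_halfspace_le)
    then show ?thesis using Krein_Milman_Minkowski[OF cvx(2,1)] that by blast
  qed
  have "G \<subseteq> P \<inter> {x. n \<bullet> x = c'}" using GP nG by blast
  then have "aff_dim (P \<inter> {x. n \<bullet> x = c'}) \<ge> aff_dim P - 1" using G aff_dim_subset by metis
  then show ?thesis using lt nP le ext F(3) unfolding nF
    by (intro exI[of _ n] exI[of _ c] exI[of _ c']) simp
qed

lemma unimodular_tetrahedron_hull: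
  assumes p: "p0 \<in> int_lattice" "p1 \<in> int_lattice" "p2 \<in> int_lattice" "p3 \<in> int_lattice"
    and B: "lattice_basis3 (p1 - p0) (p2 - p0) (p3 - p0)"
  shows "unimodular_tetrahedron (convex hull {p0,p1,p2,p3})"
proof -
  note ind = lattice_basis3_independent[OF B]
  have im: "(\<lambda>x. - p0 + x) ` {p1,p2,p3} = {p1 - p0, p2 - p0, p3 - p0}"
    by (simp only: image_insert image_empty uminus_add_conv_diff)
  have "inj_on (\<lambda>x. - p0 + x) {p1,p2,p3}" by (rule inj_onI) simp
  from card_image[OF this] have "card {p1,p2,p3} = 3" unfolding im ind(2) by simp
  have "0 \<notin> {p1 - p0, p2 - p0, p3 - p0}"
  proof
    assume "0 \<in> {p1 - p0, p2 - p0, p3 - p0}"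
    then have "dependent {p1 - p0, p2 - p0, p3 - p0}" by (rule dependent_zero)
    then show False using ind(1) by simp
  qed
  then have p0: "p0 \<notin> {p1,p2,p3}" by auto
  then have card: "card {p0,p1,p2,p3} = 4" using \<open>card {p1,p2,p3} = 3\<close> by simp
  have aff: "\<not> affine_dependent {p0,p1,p2,p3}"
    using affine_dependent_iff_dependent[OF p0] ind(1) unfolding im by simp
  let ?T = "convex hull {p0,p1,p2,p3}"
  have ext: "w extreme_point_of ?T \<longleftrightarrow> w \<in> {p0,p1,p2,p3}" for w
    by (rule extreme_point_of_convex_hull_affine_independent[OF aff])
  have "3 simplex ?T" unfolding simplex_def using aff card by (intro exI[of _ "{p0,p1,p2,p3}"]) simp
  moreover have "lattice_polytope ?T" unfolding lattice_polytope_def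
    using p by (intro exI[of _ "{p0,p1,p2,p3}"]) simp
  moreover have "{w - p0 | w. w extreme_point_of ?T \<and> w \<noteq> p0} = {p1 - p0, p2 - p0, p3 - p0}"
    unfolding ext using p0 by auto
  then have "lattice_basis {w - p0 | w. w extreme_point_of ?T \<and> w \<noteq> p0}" using lattice_basis3_imp_basis[OF B] by simp
  moreover have "p0 extreme_point_of ?T" unfolding ext by simp
  ultimately show ?thesis unfolding unimodular_tetrahedron_def by blast
qed

text \<open>As \<open>D * D = 1\<close>, the inverse matrix is \<open>D\<close> times the adjugate,
  which yields the explicit integral coefficients below.\<close>

lemma lattice_basis3_change:
  fixes x1 y1 z1 x2 y2 z2 x3 y3 z3 :: int
  assumes B: "lattice_basis3 a b d"
    and det: "\<bar>x1 * (y2 * z3 - y3 * z2) - y1 * (x2 * z3 - x3 * z2) + z1 * (x2 * y3 - x3 * y2)\<bar> = 1"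
  shows "lattice_basis3 (of_int x1 *\<^sub>R a + of_int y1 *\<^sub>R b + of_int z1 *\<^sub>R d)
    (of_int x2 *\<^sub>R a + of_int y2 *\<^sub>R b + of_int z2 *\<^sub>R d) (of_int x3 *\<^sub>R a + of_int y3 *\<^sub>R b + of_int z3 *\<^sub>R d)"
proof -
  define D where "D = x1 * (y2 * z3 - y3 * z2) - y1 * (x2 * z3 - x3 * z2) + z1 * (x2 * y3 - x3 * y2)"
  have DD: "real_of_int D * real_of_int D = 1" using det by (auto simp: D_def[symmetric] abs_if split: if_splits)
  let ?e1 = "of_int x1 *\<^sub>R a + of_int y1 *\<^sub>R b + of_int z1 *\<^sub>R d"
  let ?e2 = "of_int x2 *\<^sub>R a + of_int y2 *\<^sub>R b + of_int z2 *\<^sub>R d"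
  let ?e3 = "of_int x3 *\<^sub>R a + of_int y3 *\<^sub>R b + of_int z3 *\<^sub>R d"
  have comb: "of_int r *\<^sub>R ?e1 + of_int s *\<^sub>R ?e2 + of_int t *\<^sub>R ?e3 =
    of_int (r * x1 + s * x2 + t * x3) *\<^sub>R a + of_int (r * y1 + s * y2 + t * y3) *\<^sub>R b + of_int (r * z1 + s * z2 + t * z3) *\<^sub>R d" for r s t
    by (simp add: algebra_simps)
  have DDi: "D * D = 1" using DD by (metis of_int_1 of_int_eq_iff of_int_mult)
  have a: "a = of_int (D * (y2 * z3 - y3 * z2)) *\<^sub>R ?e1 + of_int (D * (y3 * z1 - y1 * z3)) *\<^sub>R ?e2 + of_int (D * (y1 * z2 - y2 * z1)) *\<^sub>R ?e3"
  proof -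
    have "D * (y2 * z3 - y3 * z2) * x1 + D * (y3 * z1 - y1 * z3) * x2 + D * (y1 * z2 - y2 * z1) * x3 = D * D"
      "D * (y2 * z3 - y3 * z2) * y1 + D * (y3 * z1 - y1 * z3) * y2 + D * (y1 * z2 - y2 * z1) * y3 = 0"
      "D * (y2 * z3 - y3 * z2) * z1 + D * (y3 * z1 - y1 * z3) * z2 + D * (y1 * z2 - y2 * z1) * z3 = 0"
      unfolding D_def by algebra+
    then show ?thesis unfolding comb by (simp only: DDi) simp
  qed
  have b: "b = of_int (D * (x3 * z2 - x2 * z3)) *\<^sub>R ?e1 + of_int (D * (x1 * z3 - x3 * z1)) *\<^sub>R ?e2 + of_int (D * (x2 * z1 - x1 * z2)) *\<^sub>R ?e3"
  proof -
    have "D * (x3 * z2 - x2 * z3) * x1 + D * (x1 * z3 - x3 * z1) * x2 + D * (x2 * z1 - x1 * z2) * x3 = 0"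
      "D * (x3 * z2 - x2 * z3) * y1 + D * (x1 * z3 - x3 * z1) * y2 + D * (x2 * z1 - x1 * z2) * y3 = D * D"
      "D * (x3 * z2 - x2 * z3) * z1 + D * (x1 * z3 - x3 * z1) * z2 + D * (x2 * z1 - x1 * z2) * z3 = 0"
      unfolding D_def by algebra+
    then show ?thesis unfolding comb by (simp only: DDi) simp
  qed
  have d: "d = of_int (D * (x2 * y3 - x3 * y2)) *\<^sub>R ?e1 + of_int (D * (x3 * y1 - x1 * y3)) *\<^sub>R ?e2 + of_int (D * (x1 * y2 - x2 * y1)) *\<^sub>R ?e3"
  proof -
    have "D * (x2 * y3 - x3 * y2) * x1 + D * (x3 * y1 - x1 * y3) * x2 + D * (x1 * y2 - x2 * y1) * x3 = 0"
      "D * (x2 * y3 - x3 * y2) * y1 + D * (x3 * y1 - x1 * y3) * y2 + D * (x1 * y2 - x2 * y1) * y3 = 0"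
      "D * (x2 * y3 - x3 * y2) * z1 + D * (x3 * y1 - x1 * y3) * z2 + D * (x1 * y2 - x2 * y1) * z3 = D * D"
      unfolding D_def by algebra+
    then show ?thesis unfolding comb by (simp only: DDi) simp
  qed
  show ?thesis unfolding lattice_basis3_def
  proof (intro conjI ballI)
    show "?e1 \<in> int_lattice" "?e2 \<in> int_lattice" "?e3 \<in> int_lattice"
      using B unfolding lattice_basis3_def by (simp_all add: int_lattice_add int_lattice_scale)
    fix x assume "x \<in> int_lattice"
    then obtain i j k :: int where x: "x = of_int i *\<^sub>R a + of_int j *\<^sub>R b + of_int k *\<^sub>R d"
      using B unfolding lattice_basis3_def by blast
    obtain a1 a2 a3 :: int where a: "a = of_int a1 *\<^sub>R ?e1 + of_int a2 *\<^sub>R ?e2 + of_int a3 *\<^sub>R ?e3" using a by blast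
    obtain b1 b2 b3 :: int where b: "b = of_int b1 *\<^sub>R ?e1 + of_int b2 *\<^sub>R ?e2 + of_int b3 *\<^sub>R ?e3" using b by blast
    obtain d1 d2 d3 :: int where d: "d = of_int d1 *\<^sub>R ?e1 + of_int d2 *\<^sub>R ?e2 + of_int d3 *\<^sub>R ?e3" using d by blast
    have gen: "x = of_int (i * a1 + j * b1 + k * d1) *\<^sub>R e1 + of_int (i * a2 + j * b2 + k * d2) *\<^sub>R e2 + of_int (i * a3 + j * b3 + k * d3) *\<^sub>R e3"
      if "a = of_int a1 *\<^sub>R e1 + of_int a2 *\<^sub>R e2 + of_int a3 *\<^sub>R e3" "b = of_int b1 *\<^sub>R e1 + of_int b2 *\<^sub>R e2 + of_int b3 *\<^sub>R e3"
        "d = of_int d1 *\<^sub>R e1 + of_int d2 *\<^sub>R e2 + of_int d3 *\<^sub>R e3" for e1 e2 e3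
      unfolding x that by (simp add: algebra_simps)
    show "\<exists>i j k :: int. x = of_int i *\<^sub>R ?e1 + of_int j *\<^sub>R ?e2 + of_int k *\<^sub>R ?e3"
      using gen[OF a b d] by blast
  qed
qed

section \<open>Smooth prismatoids\<close>

text \<open>\<open>n\<close> is an arbitrary real normal, not a primitive integral one; the lattice
  scale of heights is recovered below as \<open>unit_height\<close>.\<close>

locale smooth_prism =
  fixes P :: "(real ^ 3) set" and n :: "real ^ 3" and c c' :: real
  assumes smooth: "smooth_polytope P" and dim: "aff_dim P = 3" and lt: "c < c'"
    and bounds: "\<And>x. x \<in> P \<Longrightarrow> c \<le> n \<bullet> x" "\<And>x. x \<in> P \<Longrightarrow> n \<bullet> x \<le> c'"
    and ext: "\<And>v. v extreme_point_of P \<Longrightarrow> n \<bullet> v = c \<or> n \<bullet> v = c'"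
    and faces: "aff_dim (P \<inter> {x. n \<bullet> x = c}) \<ge> 2" "aff_dim (P \<inter> {x. n \<bullet> x = c'}) \<ge> 2"
begin

lemma lattice: "lattice_polytope P"
  using smooth by (simp add: smooth_polytope_def)

lemma polytope: "polytope P"
  using smooth by (simp add: smooth_polytope_def simple_polytope_def)

lemma convex: "convex P"
  using polytope polytope_imp_convex by blast

lemma extreme_mem: "v extreme_point_of P \<Longrightarrow> v \<in> P"
  by (simp add: extreme_point_of_def)

lemma n_nonzero: "n \<noteq> 0"
proof
  assume "n = 0"
  have "P \<inter> {x. n \<bullet> x = c} \<noteq> {}" "P \<inter> {x. n \<bullet> x = c'} \<noteq> {}" using faces by (force, force)
  then show False using \<open>n = 0\<close> lt by (auto split: if_splits)
qed

text \<open>Only bottom vertices receive charts, \<open>d\<close> being the direction that leaves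
  the bottom plane; the top is described through them.\<close>

definition vchart :: "real ^ 3 \<Rightarrow> real ^ 3 \<Rightarrow> real ^ 3 \<Rightarrow> real ^ 3 \<Rightarrow> bool" where
  "vchart v a b d \<longleftrightarrow> v extreme_point_of P \<and> n \<bullet> v = c \<and> primitive_edge_directions P v = {a,b,d} \<and>
     lattice_basis3 a b d \<and> n \<bullet> a = 0 \<and> n \<bullet> b = 0 \<and> n \<bullet> d > 0"

lemma vchart_exists: "v extreme_point_of P \<Longrightarrow> n \<bullet> v = c \<Longrightarrow> \<exists>a b d. vchart v a b d"
  using smooth_vertex_at_facet[OF smooth dim _ bounds(1) _ n_nonzero faces(1)] unfolding vchart_def by metis

lemma vchart_sym: "vchart v a b d \<Longrightarrow> vchart v b a d"
  unfolding vchart_def using lattice_basis3_perm(1) by (auto simp: insert_commute)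

lemma vchart_tangent:
  assumes "vchart v a b d" "x \<in> P"
  obtains i j k where "i \<ge> 0" "j \<ge> 0" "k \<ge> 0" "x = v + i *\<^sub>R a + j *\<^sub>R b + k *\<^sub>R d"
  using smooth_tangent_cone[OF smooth, of v a b d x] assms unfolding vchart_def by metis

lemma vchart_edge:
  assumes "vchart v a b d" "u \<in> {a,b,d}"
  obtains l :: int where "l \<ge> 1" "v + of_int l *\<^sub>R u extreme_point_of P" "v + u \<in> P"
    "- u \<in> primitive_edge_directions P (v + of_int l *\<^sub>R u)"
  using primitive_edge_direction_edge[OF lattice, of v u] assms unfolding vchart_def by metis

lemma vchart_lattice:
  assumes "vchart v a b d"
  shows "v \<in> int_lattice" "a \<in> int_lattice" "b \<in> int_lattice" "d \<in> int_lattice" "lattice_basis3 a b d"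
    "n \<bullet> v = c" "n \<bullet> a = 0" "n \<bullet> b = 0" "n \<bullet> d > 0" "v extreme_point_of P" "v \<in> P"
  using assms lattice_polytope_extreme_in_lattice[OF lattice] extreme_mem unfolding vchart_def lattice_basis3_def by auto

text \<open>Each of \<open>d\<close>, \<open>d'\<close> is an integral combination of the other
  basis, and \<open>n\<close> sees only the last coefficient. So each of two positive numbers is a
  positive integral multiple of the other.\<close>

lemma vchart_height_eq:
  assumes "vchart v a b d" "vchart v' a' b' d'"
  shows "n \<bullet> d = n \<bullet> d'"
proof -
  note A = vchart_lattice[OF assms(1)] and B = vchart_lattice[OF assms(2)]
  obtain i j k :: int where k: "d' = of_int i *\<^sub>R a + of_int j *\<^sub>R b + of_int k *\<^sub>R d" using A(5) B(4) unfolding lattice_basis3_def by blast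
  obtain i' j' k' :: int where k': "d = of_int i' *\<^sub>R a' + of_int j' *\<^sub>R b' + of_int k' *\<^sub>R d'" using B(5) A(4) unfolding lattice_basis3_def by blast
  have 1: "n \<bullet> d' = of_int k * (n \<bullet> d)" "n \<bullet> d = of_int k' * (n \<bullet> d')"
    by (subst k, simp add: inner_add_right A) (subst k', simp add: inner_add_right B)
  have "of_int k > (0::real)" "of_int k' > (0::real)" using 1 A(9) B(9) by (metis zero_less_mult_pos2)+
  then have "k \<ge> 1" "k' \<ge> 1" by simp_all
  then have "1 * (n \<bullet> d) \<le> of_int k * (n \<bullet> d)" "1 * (n \<bullet> d') \<le> of_int k' * (n \<bullet> d')"
    using A(9) B(9) by (intro mult_right_mono; simp)+
  then show ?thesis using 1 by linarith
qed

lemma vchart_some: "\<exists>v a b d. vchart v a b d"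
proof -
  let ?F = "P \<inter> {x. n \<bullet> x = c}"
  have F: "?F face_of P" using face_of_Int_supporting_hyperplane_ge[OF convex bounds(1)] by blast
  have "?F \<noteq> {}" using faces(1) by force
  moreover have "compact ?F" "convex ?F"
    using face_of_polytope_polytope[OF polytope F] polytope_imp_compact polytope_imp_convex by auto
  ultimately obtain v where "v extreme_point_of ?F" using extreme_point_exists_convex by blast
  then have "v extreme_point_of P" "n \<bullet> v = c" using extreme_point_of_face[OF F] by auto
  then show ?thesis using vchart_exists by blast
qed

text \<open>The distance, measured by \<open>n\<close>, of consecutive lattice planes parallel to
  the bottom; \<open>vchart_height_eq\<close> makes the description meaningful.\<close>

definition unit_height :: real where
  "unit_height = (THE h. \<forall>v a b d. vchart v a b d \<longrightarrow> n \<bullet> d = h)"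

lemma vchart_unit_height: "vchart v a b d \<Longrightarrow> n \<bullet> d = unit_height"
proof -
  assume v: "vchart v a b d"
  have "\<forall>v' a' b' d'. vchart v' a' b' d' \<longrightarrow> n \<bullet> d' = n \<bullet> d" using vchart_height_eq v by blast
  moreover have "h = n \<bullet> d" if "\<forall>v a b d. vchart v a b d \<longrightarrow> n \<bullet> d = h" for h using that v by auto
  ultimately have "unit_height = n \<bullet> d" unfolding unit_height_def by (intro the_equality) blast+
  then show ?thesis by simp
qed

lemma unit_height_pos: "unit_height > 0"
  using vchart_some vchart_unit_height vchart_lattice(9) by metis

definition height :: int where
  "height = \<lfloor>(c' - c) / unit_height\<rfloor>"

text \<open>The edge along \<open>d\<close> ends at a vertex above the bottom plane, hence in the
  top plane. Its lattice length is therefore the same at every bottom vertex.\<close>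

lemma height:
  shows "height \<ge> 1" "c' = c + of_int height * unit_height"
    and "vchart v a b d \<Longrightarrow> v + of_int height *\<^sub>R d extreme_point_of P"
    and "vchart v a b d \<Longrightarrow> - d \<in> primitive_edge_directions P (v + of_int height *\<^sub>R d)"
proof -
  have *: "height \<ge> 1 \<and> c' = c + of_int height * unit_height \<and> v + of_int height *\<^sub>R d extreme_point_of P \<and>
    - d \<in> primitive_edge_directions P (v + of_int height *\<^sub>R d)" if v: "vchart v a b d" for v a b d
  proof -
    obtain l :: int where l: "l \<ge> 1" "v + of_int l *\<^sub>R d extreme_point_of P" "- d \<in> primitive_edge_directions P (v + of_int l *\<^sub>R d)"
      using vchart_edge[OF v, of d] by auto
    have "n \<bullet> (v + of_int l *\<^sub>R d) = c + of_int l * unit_height"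
      using vchart_unit_height[OF v] vchart_lattice[OF v] by (simp add: inner_add_right)
    moreover have "of_int l * unit_height > 0" using l unit_height_pos by simp
    ultimately have e: "c' = c + of_int l * unit_height" using ext[OF l(2)] by auto
    then have "height = l" unfolding height_def using unit_height_pos by simp
    then show ?thesis using l e by simp
  qed
  then show "height \<ge> 1" "c' = c + of_int height * unit_height" using vchart_some by blast+
  show "vchart v a b d \<Longrightarrow> v + of_int height *\<^sub>R d extreme_point_of P"
    and "vchart v a b d \<Longrightarrow> - d \<in> primitive_edge_directions P (v + of_int height *\<^sub>R d)" using * by blast+
qed

lemma top_vertex:
  assumes v: "vchart v a b d"
  obtains a' b' where "primitive_edge_directions P (v + of_int height *\<^sub>R d) = {a',b',-d}" "lattice_basis3 a' b' (-d)" "n \<bullet> a' = 0" "n \<bullet> b' = 0"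
proof -
  let ?w = "v + of_int height *\<^sub>R d"
  note w = height(3)[OF v]
  have nw: "n \<bullet> ?w = c'"
    using vchart_lattice[OF v] vchart_unit_height[OF v] height(2) by (simp add: inner_add_right)
  have K: "aff_dim (P \<inter> {x. (- n) \<bullet> x = - c'}) \<ge> 2" using faces(2) by simp
  obtain a' b' d' where ab: "primitive_edge_directions P ?w = {a',b',d'}" "lattice_basis3 a' b' d'"
    "(- n) \<bullet> a' = 0" "(- n) \<bullet> b' = 0" "(- n) \<bullet> d' > 0"
    using smooth_vertex_at_facet[OF smooth dim w, of "- c'" "- n"] bounds(2) nw n_nonzero K by auto
  have "- d \<in> {a',b',d'}" using height(4)[OF v] ab(1) by simp
  then have "d' = - d" using ab vchart_lattice(9)[OF v] by auto
  then show ?thesis using that[of a' b'] ab by simp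
qed

lemma lattice_in_plane:
  assumes B: "lattice_basis3 a b d" "n \<bullet> a = 0" "n \<bullet> b = 0" "n \<bullet> d \<noteq> 0" and x: "x \<in> int_lattice" "n \<bullet> x = 0"
  obtains i j :: int where "x = of_int i *\<^sub>R a + of_int j *\<^sub>R b"
proof -
  obtain i j k :: int where k: "x = of_int i *\<^sub>R a + of_int j *\<^sub>R b + of_int k *\<^sub>R d" using B(1) x(1) unfolding lattice_basis3_def by blast
  have "n \<bullet> x = of_int k * (n \<bullet> d)" unfolding k using B by (simp add: inner_add_right)
  then have "k = 0" using B x by simp
  then show ?thesis using that k by simp
qed

lemma plane_nonneg_coords:
  assumes B: "lattice_basis3 a b d" "n \<bullet> a = 0" "n \<bullet> b = 0" "n \<bullet> d \<noteq> 0" and x: "x \<in> int_lattice" "n \<bullet> x = 0"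
    and nn: "of_int h *\<^sub>R d + x = i *\<^sub>R a + j *\<^sub>R b + k *\<^sub>R d" "i \<ge> 0" "j \<ge> 0"
  obtains p q :: int where "p \<ge> 0" "q \<ge> 0" "x = of_int p *\<^sub>R a + of_int q *\<^sub>R b"
proof -
  obtain p q :: int where pq: "x = of_int p *\<^sub>R a + of_int q *\<^sub>R b" using lattice_in_plane[OF B x] by blast
  have "of_int p *\<^sub>R a + of_int q *\<^sub>R b + of_int h *\<^sub>R d = i *\<^sub>R a + j *\<^sub>R b + k *\<^sub>R d"
    using nn(1) unfolding pq by (simp add: algebra_simps)
  then have "of_int p = i" "of_int q = j" using lattice_basis3_unique[OF B(1)] by blast+
  then have "p \<ge> 0" "q \<ge> 0" using nn by (metis of_int_0_le_iff)+
  then show ?thesis using that pq by blast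
qed

text \<open>The tangent cones at the two ends of the edge along \<open>d\<close> show that the
  directions \<open>a'\<close>, \<open>b'\<close> in the top plane have nonnegative integral
  coordinates in \<open>a\<close>, \<open>b\<close>, and that \<open>a\<close> has such coordinates
  in \<open>a'\<close>, \<open>b'\<close>. Hence \<open>a\<close> is one of them.\<close>

lemma top_edge:
  assumes v: "vchart v a b d"
  shows "v + of_int height *\<^sub>R d + a \<in> P"
proof -
  let ?w = "v + of_int height *\<^sub>R d"
  note V = vchart_lattice[OF v]
  obtain a' b' where w: "primitive_edge_directions P ?w = {a',b',-d}" "lattice_basis3 a' b' (-d)" "n \<bullet> a' = 0" "n \<bullet> b' = 0"
    using top_vertex[OF v] .
  have wP: "?w + u \<in> P" if "u \<in> {a',b'}" for u
    using primitive_edge_direction_edge[OF lattice height(3)[OF v], of u] w(1) that by blast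
  have ab: "a' \<in> int_lattice" "b' \<in> int_lattice" using w(2) by (auto simp: lattice_basis3_def)
  have co: "\<exists>p q :: int. p \<ge> 0 \<and> q \<ge> 0 \<and> u = of_int p *\<^sub>R a + of_int q *\<^sub>R b" if u: "u \<in> {a',b'}" for u
  proof -
    obtain i j k where ijk: "i \<ge> 0" "j \<ge> 0" "?w + u = v + i *\<^sub>R a + j *\<^sub>R b + k *\<^sub>R d"
      using vchart_tangent[OF v wP[OF u]] by metis
    have 1: "of_int height *\<^sub>R d + u = i *\<^sub>R a + j *\<^sub>R b + k *\<^sub>R d" using ijk(3) by (simp add: algebra_simps)
    have "n \<bullet> d \<noteq> 0" "u \<in> int_lattice" "n \<bullet> u = 0" using V u ab w by auto
    then show ?thesis using plane_nonneg_coords[OF V(5,7,8) _ _ _ 1 ijk(1,2)] by metis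
  qed
  obtain p1 q1 :: int where 1: "p1 \<ge> 0" "q1 \<ge> 0" "a' = of_int p1 *\<^sub>R a + of_int q1 *\<^sub>R b" using co[of a'] by auto
  obtain p2 q2 :: int where 2: "p2 \<ge> 0" "q2 \<ge> 0" "b' = of_int p2 *\<^sub>R a + of_int q2 *\<^sub>R b" using co[of b'] by auto
  have "v + a \<in> P" using vchart_edge[OF v, of a] by blast
  then obtain i j k where ijk: "i \<ge> 0" "j \<ge> 0" "v + a = ?w + i *\<^sub>R a' + j *\<^sub>R b' + k *\<^sub>R (- d)"
    using smooth_tangent_cone[OF smooth height(3)[OF v] w(1,2)] by metis
  have 3: "of_int height *\<^sub>R (- d) + a = i *\<^sub>R a' + j *\<^sub>R b' + k *\<^sub>R (- d)" using ijk(3) by (simp add: algebra_simps)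
  have "n \<bullet> (- d) \<noteq> 0" using V by auto
  then obtain x y :: int where xy: "x \<ge> 0" "y \<ge> 0" "a = of_int x *\<^sub>R a' + of_int y *\<^sub>R b'"
    using plane_nonneg_coords[OF w(2,3,4) _ V(2,7) 3 ijk(1,2)] by blast
  have "1 *\<^sub>R a + 0 *\<^sub>R b + 0 *\<^sub>R d = of_int (x * p1 + y * p2) *\<^sub>R a + of_int (x * q1 + y * q2) *\<^sub>R b + 0 *\<^sub>R d"
    using xy(3) unfolding 1(3) 2(3) by (simp add: algebra_simps)
  then have e: "1 = real_of_int (x * p1 + y * p2) \<and> 0 = real_of_int (x * q1 + y * q2) \<and> (0::real) = 0"
    by (rule lattice_basis3_unique[OF V(5)])
  have e': "x * p1 + y * p2 = 1" "x * q1 + y * q2 = 0"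
    using e by (metis of_int_eq_1_iff, metis of_int_eq_0_iff)
  have nn: "x * p1 \<ge> 0" "y * p2 \<ge> 0" "x * q1 \<ge> 0" "y * q2 \<ge> 0" using xy 1 2 by simp_all
  then have z: "x * q1 = 0" "y * q2 = 0" using e' by linarith+
  have "a = a' \<or> a = b'"
  proof (cases "x * p1 = 0")
    case False
    then have "x * p1 = 1" using e' nn by linarith
    then have "p1 = 1" "x = 1" using xy 1 by (auto simp: zmult_eq_1_iff)
    then show ?thesis using z 1(3) by simp
  next
    case True
    then have "y * p2 = 1" using e' by linarith
    then have "p2 = 1" "y = 1" using xy 2 by (auto simp: zmult_eq_1_iff)
    then show ?thesis using z 2(3) by simp
  qed
  then show ?thesis using wP by auto
qed

text \<open>The neighbour of \<open>v\<close> along the bottom edge: \<open>l\<close> is the length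
  of this edge, and the top vertices above its ends differ by \<open>l + height * m\<close> times
  \<open>a\<close>. A component \<open>r\<close> of \<open>d2 - d\<close> along \<open>b\<close> is
  excluded because the tangent cones at the two ends give opposite signs for
  \<open>height * r\<close>.\<close>

lemma adjacent_vchart:
  assumes v: "vchart v a b d"
  obtains l m y :: int and b2 d2 where "l \<ge> 1" "l + height * m \<ge> 1" "vchart (v + of_int l *\<^sub>R a) (- a) b2 d2"
    "d2 = d + of_int m *\<^sub>R a" "b2 = b + of_int y *\<^sub>R a"
proof -
  note V = vchart_lattice[OF v]
  obtain l :: int where l: "l \<ge> 1" "v + of_int l *\<^sub>R a extreme_point_of P" "- a \<in> primitive_edge_directions P (v + of_int l *\<^sub>R a)"
    using vchart_edge[OF v, of a] by blast
  let ?v = "v + of_int l *\<^sub>R a"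
  have "n \<bullet> ?v = c" using V by (simp add: inner_add_right)
  then obtain a1 b1 d2 where c1: "vchart ?v a1 b1 d2" using vchart_exists[OF l(2)] by blast
  then have "- a \<in> {a1,b1,d2}" using l(3) unfolding vchart_def by simp
  then have "- a = a1 \<or> - a = b1" using vchart_lattice(9)[OF c1] V(7) by auto
  then obtain b2 where c2: "vchart ?v (- a) b2 d2" using c1 vchart_sym by blast
  note W = vchart_lattice[OF c2]
  have d0: "n \<bullet> d \<noteq> 0" "n \<bullet> d2 \<noteq> 0" using V W by auto
  have "n \<bullet> (d2 - d) = 0" using vchart_unit_height[OF v] vchart_unit_height[OF c2] by (simp add: inner_diff_right)
  then obtain m r :: int where "d2 - d = of_int m *\<^sub>R a + of_int r *\<^sub>R b"
    using lattice_in_plane[OF V(5,7,8) d0(1), of "d2 - d"] int_lattice_diff[OF W(4) V(4)] by blast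
  then have d2: "d2 = of_int m *\<^sub>R a + of_int r *\<^sub>R b + d" by (metis diff_add_cancel)
  obtain y \<mu> :: int where b2: "b2 = of_int y *\<^sub>R a + of_int \<mu> *\<^sub>R b"
    using lattice_in_plane[OF V(5,7,8) d0(1) W(3,8)] .
  obtain x z :: int where bx: "b = of_int x *\<^sub>R (- a) + of_int z *\<^sub>R b2"
    using lattice_in_plane[OF W(5,7,8) d0(2) V(3,8)] .
  have "0 *\<^sub>R a + 1 *\<^sub>R b + 0 *\<^sub>R d = of_int (z * y - x) *\<^sub>R a + of_int (z * \<mu>) *\<^sub>R b + 0 *\<^sub>R d"
    using bx unfolding b2 by (simp add: algebra_simps)
  then have "0 = real_of_int (z * y - x) \<and> 1 = real_of_int (z * \<mu>) \<and> (0::real) = 0" by (rule lattice_basis3_unique[OF V(5)])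
  then have "z * \<mu> = 1" by (simp only: of_int_eq_1_iff eq_commute[of "1::real"])
  have "?v + b2 \<in> P" using vchart_edge[OF c2, of b2] by blast
  then obtain i j k where ijk: "i \<ge> 0" "j \<ge> 0" "k \<ge> 0" "?v + b2 = v + i *\<^sub>R a + j *\<^sub>R b + k *\<^sub>R d"
    using vchart_tangent[OF v] by metis
  have "of_int (l + y) *\<^sub>R a + of_int \<mu> *\<^sub>R b + 0 *\<^sub>R d = i *\<^sub>R a + j *\<^sub>R b + k *\<^sub>R d"
    using ijk(4) unfolding b2 by (simp add: algebra_simps)
  then have "real_of_int \<mu> = j" using lattice_basis3_unique[OF V(5)] by blast
  then have "\<mu> \<ge> 0" using ijk by simp
  then have mu: "\<mu> = 1" using \<open>z * \<mu> = 1\<close> by (auto simp: zmult_eq_1_iff)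
  have "?v + of_int height *\<^sub>R d2 \<in> P" using extreme_mem[OF height(3)[OF c2]] .
  then obtain i j k where ijk: "i \<ge> 0" "j \<ge> 0" "k \<ge> 0" "?v + of_int height *\<^sub>R d2 = v + i *\<^sub>R a + j *\<^sub>R b + k *\<^sub>R d"
    using vchart_tangent[OF v] by metis
  have "of_int (l + height * m) *\<^sub>R a + of_int (height * r) *\<^sub>R b + of_int height *\<^sub>R d = i *\<^sub>R a + j *\<^sub>R b + k *\<^sub>R d"
    using ijk(4) unfolding d2 by (simp add: algebra_simps)
  then have "real_of_int (l + height * m) = i" "real_of_int (height * r) = j" using lattice_basis3_unique[OF V(5)] by blast+
  then have "real_of_int (l + height * m) \<ge> 0" "real_of_int (height * r) \<ge> 0" using ijk by simp_all
  then have pos: "l + height * m \<ge> 0" "height * r \<ge> 0" by (simp_all only: of_int_0_le_iff)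
  have "v + of_int height *\<^sub>R d \<in> P" using extreme_mem[OF height(3)[OF v]] .
  then obtain i j k where ijk: "i \<ge> 0" "j \<ge> 0" "k \<ge> 0" "v + of_int height *\<^sub>R d = ?v + i *\<^sub>R (- a) + j *\<^sub>R b2 + k *\<^sub>R d2"
    using vchart_tangent[OF c2] by metis
  have "0 *\<^sub>R a + 0 *\<^sub>R b + of_int height *\<^sub>R d = (of_int l - i + j * of_int y + k * of_int m) *\<^sub>R a + (j + k * of_int r) *\<^sub>R b + k *\<^sub>R d"
    using ijk(4) unfolding d2 b2 mu by (simp add: algebra_simps)
  then have "0 = j + k * of_int r" "of_int height = k" using lattice_basis3_unique[OF V(5)] by blast+
  then have "of_int (height * r) = - j" by simp
  then have "real_of_int (height * r) \<le> 0" using ijk by simp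
  then have "height * r \<le> 0" by (simp only: of_int_le_0_iff)
  then have r0: "r = 0" using pos height(1) by auto
  have d2': "d2 = d + of_int m *\<^sub>R a" using d2 r0 by simp
  \<comment> \<open>Otherwise both upward edges end at the same top vertex, where only one direction
    leaves the top plane; then \<open>d2 = d\<close>, so \<open>m = 0\<close> and
    \<open>l = 0\<close>.\<close>
  have "l + height * m \<noteq> 0"
  proof
    assume 0: "l + height * m = 0"
    have "?v + of_int height *\<^sub>R d2 = v + of_int height *\<^sub>R d + of_int (l + height * m) *\<^sub>R a"
      unfolding d2' by (simp add: algebra_simps)
    then have same: "?v + of_int height *\<^sub>R d2 = v + of_int height *\<^sub>R d" using 0 by simp
    obtain a' b' where w: "primitive_edge_directions P (v + of_int height *\<^sub>R d) = {a',b',-d}" "n \<bullet> a' = 0" "n \<bullet> b' = 0"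
      using top_vertex[OF v] by metis
    have "- d2 \<in> {a',b',-d}" using height(4)[OF c2] unfolding same w(1) .
    then have "d2 = d" using w W(9) by auto
    then have "of_int m *\<^sub>R a = 0" using d2' by simp
    moreover have "a \<noteq> 0" using lattice_basis3_independent(1)[OF V(5)] dependent_zero by blast
    ultimately have "m = 0" by simp
    then show False using 0 l(1) by simp
  qed
  then have "l + height * m \<ge> 1" using pos by simp
  moreover have "b2 = b + of_int y *\<^sub>R a" using b2 mu by simp
  ultimately show ?thesis using that l(1) c2 d2' by blast
qed

lemma finite_vcharts: "finite {(v,d). \<exists>a b. vchart v a b d}"
proof (rule finite_subset)
  obtain V where V: "finite V" "P = convex hull V" using polytope polytope_def by blast
  have "{v. v extreme_point_of P} \<subseteq> V" unfolding V(2) using extreme_point_of_convex_hull by blast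
  then have fv: "finite {v. v extreme_point_of P}" using V(1) finite_subset by blast
  show "{(v,d). \<exists>a b. vchart v a b d} \<subseteq> (SIGMA v:{v. v extreme_point_of P}. primitive_edge_directions P v)"
    by (auto simp: vchart_def)
  have "finite (primitive_edge_directions P v)" if "v extreme_point_of P" for v
    using smooth that by (auto simp: smooth_polytope_def lattice_basis_def)
  then show "finite (SIGMA v:{v. v extreme_point_of P}. primitive_edge_directions P v)" using fv by auto
qed

text \<open>This is why all slices share their edge directions. Passing to the neighbour along
  \<open>a\<close> changes the objective by \<open>(l + z * m) * (e \<bullet> a)\<close>, and
  \<open>l + z * m\<close> is positive since it interpolates between positive values at bottom and
  top.\<close>

lemma vchart_minimizing:
  assumes z: "0 \<le> z" "z \<le> of_int height"
  shows "\<exists>v a b d. vchart v a b d \<and> e \<bullet> a \<ge> 0 \<and> e \<bullet> b \<ge> 0 \<and>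
    (\<forall>v' a' b' d'. vchart v' a' b' d' \<longrightarrow> e \<bullet> (v + z *\<^sub>R d) \<le> e \<bullet> (v' + z *\<^sub>R d'))"
proof -
  let ?C = "{(v,d). \<exists>a b. vchart v a b d}"
  note fin = finite_vcharts
  let ?f = "\<lambda>(v,d). e \<bullet> (v + z *\<^sub>R d)"
  have "?C \<noteq> {}" using vchart_some by auto
  then have "Min (?f ` ?C) \<in> ?f ` ?C" using fin by (intro Min_in) auto
  then obtain p where "p \<in> ?C" "Min (?f ` ?C) = ?f p" by (rule imageE)
  moreover obtain v d where p: "p = (v,d)" by (cases p)
  ultimately obtain a b where v: "vchart v a b d" and min': "Min (?f ` ?C) = e \<bullet> (v + z *\<^sub>R d)" by auto
  have min: "e \<bullet> (v + z *\<^sub>R d) \<le> e \<bullet> (v' + z *\<^sub>R d')" if "vchart v' a' b' d'" for v' a' b' d'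
    unfolding min'[symmetric] using fin that by (intro Min_le) (auto intro!: image_eqI[of _ _ "(v',d')"])
  have dir: "e \<bullet> a \<ge> 0" if v: "vchart v a b d" for a b
  proof -
    obtain l m y :: int and b2 d2 where A: "l \<ge> 1" "l + height * m \<ge> 1" "vchart (v + of_int l *\<^sub>R a) (- a) b2 d2" "d2 = d + of_int m *\<^sub>R a"
      using adjacent_vchart[OF v] by metis
    have "e \<bullet> (v + z *\<^sub>R d) \<le> e \<bullet> (v + of_int l *\<^sub>R a + z *\<^sub>R d2)" by (rule min[OF A(3)])
    then have 1: "0 \<le> (of_int l + z * of_int m) * (e \<bullet> a)" unfolding A(4) by (simp add: inner_add_right algebra_simps)
    have h: "real_of_int height > 0" using height(1) by simp
    have "real_of_int l \<ge> 1" "real_of_int (l + height * m) \<ge> 1" using A by (simp_all only: of_int_1_le_iff)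
    then have lm: "real_of_int l \<ge> 1" "of_int l + of_int height * real_of_int m \<ge> 1" by simp_all
    have "(of_int height - z) * 1 + z * 1 \<le> (of_int height - z) * of_int l + z * (of_int l + of_int height * real_of_int m)"
      using lm z by (intro add_mono mult_left_mono) auto
    then have "real_of_int height \<le> of_int height * (of_int l + z * of_int m)" by (simp add: algebra_simps)
    then have "of_int l + z * of_int m > 0" using h by (smt (verit) mult_nonneg_nonpos2 mult.commute)
    then show ?thesis using 1 by (simp add: zero_le_mult_iff)
  qed
  show ?thesis using v dir[OF v] dir[OF vchart_sym[OF v]] min by blast
qed

text \<open>A point outside the hull would be separated by some \<open>e\<close>, but the slice lies
  in the tangent cone of a chart minimising \<open>e\<close>. Taking the hull of the pairs
  \<open>(v,d)\<close> lets one choice of weights serve all heights, which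
  \<open>prism_point_split\<close> exploits.\<close>

lemma slice_hull:
  assumes x: "x \<in> P" "n \<bullet> x = c + z * unit_height"
  shows "x \<in> (\<lambda>(v,d). v + z *\<^sub>R d) ` (convex hull {(v,d). \<exists>a b. vchart v a b d})"
proof -
  let ?C = "{(v,d). \<exists>a b. vchart v a b d}"
  let ?L = "\<lambda>(v,d). v + z *\<^sub>R d :: real ^ 3"
  have z: "0 \<le> z" "z \<le> of_int height"
  proof -
    have "0 * unit_height \<le> z * unit_height" "z * unit_height \<le> of_int height * unit_height"
      using bounds(1)[OF x(1)] bounds(2)[OF x(1)] x(2) height(2) by linarith+
    then show "0 \<le> z" "z \<le> of_int height" using unit_height_pos by (simp_all only: mult_le_cancel_right_pos)
  qed
  have lin: "linear ?L" by (intro linearI) (auto simp: algebra_simps)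
  have hull: "?L ` (convex hull ?C) = convex hull (?L ` ?C)" using convex_hull_linear_image[OF lin] by simp
  define H where "H = convex hull (?L ` ?C)"
  have "compact H" unfolding H_def using finite_vcharts by (intro finite_imp_compact_convex_hull finite_imageI)
  then have H: "convex H" "closed H" by (simp_all add: H_def compact_imp_closed)
  show ?thesis unfolding hull H_def[symmetric]
  proof (rule ccontr)
    assume "x \<notin> H"
    then obtain e r where er: "e \<bullet> x < r" "\<forall>y\<in>H. e \<bullet> y > r"
      using separating_hyperplane_closed_point[OF H] by blast
    obtain v a b d where v: "vchart v a b d" "e \<bullet> a \<ge> 0" "e \<bullet> b \<ge> 0" using vchart_minimizing[OF z, of e] by blast
    have "v + z *\<^sub>R d \<in> ?L ` ?C" using v(1) by (auto intro!: image_eqI[of _ _ "(v,d)"])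
    then have "v + z *\<^sub>R d \<in> H" unfolding H_def by (rule hull_inc)
    then have r: "e \<bullet> (v + z *\<^sub>R d) > r" using er(2) by blast
    obtain i j k where ijk: "i \<ge> 0" "j \<ge> 0" "x = v + i *\<^sub>R a + j *\<^sub>R b + k *\<^sub>R d" using vchart_tangent[OF v(1) x(1)] by metis
    have "n \<bullet> x = c + k * unit_height" unfolding ijk using vchart_lattice[OF v(1)] vchart_unit_height[OF v(1)] by (simp add: inner_add_right)
    then have "k = z" using x(2) unit_height_pos by simp
    then have "e \<bullet> x = e \<bullet> (v + z *\<^sub>R d) + i * (e \<bullet> a) + j * (e \<bullet> b)" unfolding ijk by (simp add: inner_add_right)
    then have "e \<bullet> x \<ge> e \<bullet> (v + z *\<^sub>R d)" using ijk v by simp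
    then show False using r er by simp
  qed
qed

end

section \<open>Planar coordinates on the slices\<close>

locale smooth_prism_base = smooth_prism +
  fixes v0 a0 b0 d0 :: "real ^ 3"
  assumes base: "vchart v0 a0 b0 d0"
begin

lemmas base_facts = vchart_lattice[OF base]

definition point :: "real \<Rightarrow> real \<times> real \<Rightarrow> real ^ 3" where
  "point z p = v0 + fst p *\<^sub>R a0 + snd p *\<^sub>R b0 + z *\<^sub>R d0"

definition slice :: "real \<Rightarrow> (real \<times> real) set" where
  "slice z = {p. point z p \<in> P}"

text \<open>The vertex and its upward direction are forgotten, so that the relation does not depend
  on the height; by \<open>dirs_chart\<close> each pair is realised in every integral slice.\<close>

definition dirs :: "int \<times> int \<Rightarrow> int \<times> int \<Rightarrow> bool" where
  "dirs A B \<longleftrightarrow> (\<exists>v d. vchart v (of_int (fst A) *\<^sub>R a0 + of_int (snd A) *\<^sub>R b0) (of_int (fst B) *\<^sub>R a0 + of_int (snd B) *\<^sub>R b0) d)"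

lemma base_unique: "i *\<^sub>R a0 + j *\<^sub>R b0 + k *\<^sub>R d0 = i' *\<^sub>R a0 + j' *\<^sub>R b0 + k' *\<^sub>R d0 \<Longrightarrow> i = i' \<and> j = j' \<and> k = k'"
  using lattice_basis3_unique[OF base_facts(5)] by blast

lemma point_eq_iff [simp]: "point z p = point z' q \<longleftrightarrow> z = z' \<and> p = q"
proof
  assume "point z p = point z' q"
  then have "fst p *\<^sub>R a0 + snd p *\<^sub>R b0 + z *\<^sub>R d0 = fst q *\<^sub>R a0 + snd q *\<^sub>R b0 + z' *\<^sub>R d0"
    unfolding point_def by (simp add: add.assoc)
  from base_unique[OF this] show "z = z' \<and> p = q" by (simp add: prod_eq_iff)
qed simp

lemma point_height: "n \<bullet> point z p = c + z * unit_height"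
  unfolding point_def using base_facts vchart_unit_height[OF base] by (simp add: inner_add_right)

lemma point_exists: "n \<bullet> x = c + z * unit_height \<Longrightarrow> \<exists>p. x = point z p"
proof -
  assume x: "n \<bullet> x = c + z * unit_height"
  obtain i j k where "x - v0 = i *\<^sub>R a0 + j *\<^sub>R b0 + k *\<^sub>R d0" using lattice_basis3_coords[OF base_facts(5)] by metis
  then have e: "x = point k (i,j)" unfolding point_def by (simp add: algebra_simps)
  then have "k = z" using x point_height unit_height_pos by auto
  then show ?thesis using e by blast
qed

lemma point_comb: "(1-t) *\<^sub>R point z p + t *\<^sub>R point z' q = point ((1-t) * z + t * z') ((1-t) *\<^sub>R p + t *\<^sub>R q)"
  unfolding point_def by (simp add: algebra_simps)

text \<open>Each pair has integral coordinates in the other, so two integral determinants multiply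
  to one.\<close>

lemma dirs_det:
  assumes "vchart v (of_int ax *\<^sub>R a0 + of_int ay *\<^sub>R b0) (of_int bx *\<^sub>R a0 + of_int by' *\<^sub>R b0) d"
  shows "\<bar>ax * by' - ay * bx\<bar> = 1"
proof -
  let ?a = "of_int ax *\<^sub>R a0 + of_int ay *\<^sub>R b0" and ?b = "of_int bx *\<^sub>R a0 + of_int by' *\<^sub>R b0"
  note V = vchart_lattice[OF assms]
  have d: "n \<bullet> d \<noteq> 0" using V by simp
  obtain i j :: int where 1: "a0 = of_int i *\<^sub>R ?a + of_int j *\<^sub>R ?b"
    using lattice_in_plane[OF V(5,7,8) d base_facts(2,7)] .
  obtain k l :: int where 2: "b0 = of_int k *\<^sub>R ?a + of_int l *\<^sub>R ?b"
    using lattice_in_plane[OF V(5,7,8) d base_facts(3,8)] .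
  have "1 *\<^sub>R a0 + 0 *\<^sub>R b0 + 0 *\<^sub>R d0 = of_int (i * ax + j * bx) *\<^sub>R a0 + of_int (i * ay + j * by') *\<^sub>R b0 + 0 *\<^sub>R d0"
    by (subst 1) (simp add: algebra_simps)
  from base_unique[OF this] have e1: "i * ax + j * bx = 1" "i * ay + j * by' = 0"
    by (metis of_int_eq_1_iff, metis of_int_eq_0_iff)
  have "0 *\<^sub>R a0 + 1 *\<^sub>R b0 + 0 *\<^sub>R d0 = of_int (k * ax + l * bx) *\<^sub>R a0 + of_int (k * ay + l * by') *\<^sub>R b0 + 0 *\<^sub>R d0"
    by (subst 2) (simp add: algebra_simps)
  from base_unique[OF this] have e2: "k * ax + l * bx = 0" "k * ay + l * by' = 1"
    by (metis of_int_eq_0_iff, metis of_int_eq_1_iff)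
  have "(i * l - j * k) * (ax * by' - ay * bx) = (i * ax + j * bx) * (k * ay + l * by') - (i * ay + j * by') * (k * ax + l * bx)"
    by algebra
  also have "\<dots> = 1" using e1 e2 by simp
  finally have "(ax * by' - ay * bx) dvd 1" by (metis dvd_triv_right)
  then show ?thesis by simp
qed

lemma vchart_coords:
  assumes "vchart v a b d"
  obtains vx vy dx dy :: int where "v = v0 + of_int vx *\<^sub>R a0 + of_int vy *\<^sub>R b0" "d = d0 + of_int dx *\<^sub>R a0 + of_int dy *\<^sub>R b0"
proof -
  note V = vchart_lattice[OF assms]
  have d0: "n \<bullet> d0 \<noteq> 0" using base_facts by simp
  have "n \<bullet> (v - v0) = 0" "n \<bullet> (d - d0) = 0"
    using V base_facts vchart_unit_height[OF assms] vchart_unit_height[OF base] by (simp_all add: inner_diff_right)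
  moreover have "v - v0 \<in> int_lattice" "d - d0 \<in> int_lattice" using V base_facts int_lattice_diff by auto
  ultimately obtain vx vy dx dy :: int where "v - v0 = of_int vx *\<^sub>R a0 + of_int vy *\<^sub>R b0" "d - d0 = of_int dx *\<^sub>R a0 + of_int dy *\<^sub>R b0"
    using lattice_in_plane[OF base_facts(5,7,8) d0] by metis
  then show ?thesis using that[of vx vy dx dy] by (simp add: algebra_simps)
qed

lemma along_edge:
  assumes "p \<in> P" "p + of_int height *\<^sub>R d \<in> P" "0 \<le> z" "z \<le> of_int height"
  shows "p + z *\<^sub>R d \<in> P"
proof -
  have h: "real_of_int height > 0" using height(1) by simp
  have "(1 - z / of_int height) *\<^sub>R p + (z / of_int height) *\<^sub>R (p + of_int height *\<^sub>R d) \<in> P"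
    using assms h by (intro convexD[OF convex]) auto
  moreover have "(1 - z / of_int height) *\<^sub>R p + (z / of_int height) *\<^sub>R (p + of_int height *\<^sub>R d) = p + z *\<^sub>R d"
    using h by (simp add: algebra_simps)
  ultimately show ?thesis by simp
qed

text \<open>The segments in direction \<open>d\<close> above \<open>v\<close>, \<open>v + ?a\<close>
  and \<open>v + ?b\<close> lie in \<open>P\<close>, since their upper ends do by
  \<open>height\<close> and \<open>top_edge\<close>. The cone condition is the tangent cone at
  \<open>v\<close> cut at height \<open>i\<close>.\<close>

lemma slice_chart:
  assumes v: "vchart v (of_int (fst A) *\<^sub>R a0 + of_int (snd A) *\<^sub>R b0) (of_int (fst B) *\<^sub>R a0 + of_int (snd B) *\<^sub>R b0) d"
    and i: "0 \<le> i" "i \<le> height"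
    and vd: "v = v0 + of_int vx *\<^sub>R a0 + of_int vy *\<^sub>R b0" "d = d0 + of_int dx *\<^sub>R a0 + of_int dy *\<^sub>R b0"
  shows "chart (slice (of_int i)) (vx + i * dx, vy + i * dy) A B"
proof -
  let ?a = "of_int (fst A) *\<^sub>R a0 + of_int (snd A) *\<^sub>R b0" and ?b = "of_int (fst B) *\<^sub>R a0 + of_int (snd B) *\<^sub>R b0"
  have iz: "0 \<le> real_of_int i" "real_of_int i \<le> of_int height" using i by simp_all
  have 0: "v + of_int i *\<^sub>R d \<in> P"
    using along_edge[OF _ _ iz] vchart_lattice(11)[OF v] extreme_mem[OF height(3)[OF v]] by blast
  have e: "v + u + of_int i *\<^sub>R d \<in> P" if "v + u \<in> P" "v + of_int height *\<^sub>R d + u \<in> P" for u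
    using along_edge[OF that(1) _ iz] that(2) by (simp add: algebra_simps)
  have a: "v + ?a + of_int i *\<^sub>R d \<in> P"
    using e[of ?a] vchart_edge[OF v, of ?a] top_edge[OF v] by blast
  have b: "v + ?b + of_int i *\<^sub>R d \<in> P"
    using e[of ?b] vchart_edge[OF v, of ?b] top_edge[OF vchart_sym[OF v]] by blast
  have pt: "v + of_int x *\<^sub>R a0 + of_int y *\<^sub>R b0 + of_int i *\<^sub>R d = point (of_int i) (of_int (vx + i * dx + x), of_int (vy + i * dy + y))" for x y :: int
    unfolding vd point_def by (simp add: algebra_simps)
  show ?thesis unfolding chart_def
  proof (intro conjI allI impI)
    show "\<bar>fst A * snd B - snd A * fst B\<bar> = 1" by (rule dirs_det[OF v])
    show "(of_int (fst (vx + i * dx, vy + i * dy)), of_int (snd (vx + i * dx, vy + i * dy))) \<in> slice (of_int i)"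
      using 0 pt[of 0 0] unfolding slice_def by simp
    show "(of_int (fst (vx + i * dx, vy + i * dy) + fst A), of_int (snd (vx + i * dx, vy + i * dy) + snd A)) \<in> slice (of_int i)"
      using a pt[of "fst A" "snd A"] unfolding slice_def by (simp add: add.assoc)
    show "(of_int (fst (vx + i * dx, vy + i * dy) + fst B), of_int (snd (vx + i * dx, vy + i * dy) + snd B)) \<in> slice (of_int i)"
      using b pt[of "fst B" "snd B"] unfolding slice_def by (simp add: add.assoc)
    fix x y assume "(x,y) \<in> slice (of_int i)"
    then have P: "point (of_int i) (x,y) \<in> P" by (simp add: slice_def)
    obtain k l m where klm: "k \<ge> 0" "l \<ge> 0" "point (of_int i) (x,y) = v + k *\<^sub>R ?a + l *\<^sub>R ?b + m *\<^sub>R d"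
      using vchart_tangent[OF v P] by metis
    have "v + k *\<^sub>R ?a + l *\<^sub>R ?b + m *\<^sub>R d = point m
      (of_int vx + m * of_int dx + k * of_int (fst A) + l * of_int (fst B), of_int vy + m * of_int dy + k * of_int (snd A) + l * of_int (snd B))"
      unfolding vd point_def by (simp add: algebra_simps)
    then have "m = of_int i \<and> x = of_int vx + m * of_int dx + k * of_int (fst A) + l * of_int (fst B) \<and>
       y = of_int vy + m * of_int dy + k * of_int (snd A) + l * of_int (snd B)" using klm(3) by auto
    then show "\<exists>k\<ge>0. \<exists>l\<ge>0. x = of_int (fst (vx + i * dx, vy + i * dy)) + k * of_int (fst A) + l * of_int (fst B) \<and>
        y = of_int (snd (vx + i * dx, vy + i * dy)) + k * of_int (snd A) + l * of_int (snd B)"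
      using klm(1,2) by (intro exI[of _ k] exI[of _ l] conjI) simp_all
  qed
qed

lemma dirs_chart:
  assumes "dirs A B" "0 \<le> i" "i \<le> height"
  shows "\<exists>w. chart (slice (of_int i)) w A B"
proof -
  obtain v d where v: "vchart v (of_int (fst A) *\<^sub>R a0 + of_int (snd A) *\<^sub>R b0) (of_int (fst B) *\<^sub>R a0 + of_int (snd B) *\<^sub>R b0) d"
    using assms(1) unfolding dirs_def by blast
  obtain vx vy dx dy :: int where vd: "v = v0 + of_int vx *\<^sub>R a0 + of_int vy *\<^sub>R b0" "d = d0 + of_int dx *\<^sub>R a0 + of_int dy *\<^sub>R b0"
    using vchart_coords[OF v] .
  show ?thesis using slice_chart[OF v assms(2,3) vd] by blast
qed

lemma dirs_sym: "dirs A B \<Longrightarrow> dirs B A"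
  unfolding dirs_def using vchart_sym by blast

lemma dirs_base: "dirs (1,0) (0,1)"
  unfolding dirs_def using base by auto

lemma vchart_dirs:
  assumes "vchart v a b d"
  obtains A B where "a = of_int (fst A) *\<^sub>R a0 + of_int (snd A) *\<^sub>R b0" "b = of_int (fst B) *\<^sub>R a0 + of_int (snd B) *\<^sub>R b0" "dirs A B"
proof -
  note V = vchart_lattice[OF assms]
  have d0: "n \<bullet> d0 \<noteq> 0" using base_facts by simp
  obtain ax ay :: int where a: "a = of_int ax *\<^sub>R a0 + of_int ay *\<^sub>R b0" using lattice_in_plane[OF base_facts(5,7,8) d0 V(2,7)] .
  obtain bx by' :: int where b: "b = of_int bx *\<^sub>R a0 + of_int by' *\<^sub>R b0" using lattice_in_plane[OF base_facts(5,7,8) d0 V(3,8)] .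
  have "dirs (ax,ay) (bx,by')" unfolding dirs_def using assms a b by auto
  then show ?thesis using that[of "(ax,ay)" "(bx,by')"] a b by simp
qed

lemma dirs_minimizing:
  fixes p q :: int
  shows "\<exists>A B. dirs A B \<and> 0 \<le> p * fst A + q * snd A \<and> 0 \<le> p * fst B + q * snd B"
proof -
  obtain \<alpha> where al: "\<alpha> \<bullet> a0 = 1" "\<alpha> \<bullet> b0 = 0" using lattice_basis3_dual[OF base_facts(5)] by metis
  obtain \<beta> where be: "\<beta> \<bullet> b0 = 1" "\<beta> \<bullet> a0 = 0" using lattice_basis3_dual[OF lattice_basis3_perm(1)[OF base_facts(5)]] by metis
  define e where "e = of_int p *\<^sub>R \<alpha> + of_int q *\<^sub>R \<beta>"
  have e: "e \<bullet> (of_int x *\<^sub>R a0 + of_int y *\<^sub>R b0) = of_int (p * x + q * y)" for x y :: int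
    unfolding e_def by (simp add: inner_add_left inner_add_right al be)
  have "0 \<le> real_of_int height" using height(1) by simp
  then obtain v a b d where v: "vchart v a b d" "e \<bullet> a \<ge> 0" "e \<bullet> b \<ge> 0" using vchart_minimizing[of 0 e] by auto
  obtain A B where AB: "a = of_int (fst A) *\<^sub>R a0 + of_int (snd A) *\<^sub>R b0" "b = of_int (fst B) *\<^sub>R a0 + of_int (snd B) *\<^sub>R b0" "dirs A B"
    using vchart_dirs[OF v(1)] .
  have "0 \<le> real_of_int (p * fst A + q * snd A)" "0 \<le> real_of_int (p * fst B + q * snd B)"
    using v(2,3) unfolding AB e by blast+
  then have "0 \<le> p * fst A + q * snd A" "0 \<le> p * fst B + q * snd B" by (simp_all only: of_int_0_le_iff)
  then show ?thesis using AB(3) by blast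
qed

lemma dirs_adjacent:
  assumes "dirs A B"
  shows "\<exists>y. dirs (- fst A, - snd A) (fst B + y * fst A, snd B + y * snd A)"
proof -
  obtain v d where v: "vchart v (of_int (fst A) *\<^sub>R a0 + of_int (snd A) *\<^sub>R b0) (of_int (fst B) *\<^sub>R a0 + of_int (snd B) *\<^sub>R b0) d"
    using assms(1) unfolding dirs_def by blast
  let ?a = "of_int (fst A) *\<^sub>R a0 + of_int (snd A) *\<^sub>R b0" and ?b = "of_int (fst B) *\<^sub>R a0 + of_int (snd B) *\<^sub>R b0"
  obtain l y :: int and b2 d2 where w: "vchart (v + of_int l *\<^sub>R ?a) (- ?a) b2 d2" "b2 = ?b + of_int y *\<^sub>R ?a"
    using adjacent_vchart[OF v] by metis
  have "- ?a = of_int (fst (- fst A, - snd A)) *\<^sub>R a0 + of_int (snd (- fst A, - snd A)) *\<^sub>R b0"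
    "b2 = of_int (fst (fst B + y * fst A, snd B + y * snd A)) *\<^sub>R a0 + of_int (snd (fst B + y * fst A, snd B + y * snd A)) *\<^sub>R b0"
    unfolding w(2) by (simp_all add: algebra_simps)
  then have "dirs (- fst A, - snd A) (fst B + y * fst A, snd B + y * snd A)" unfolding dirs_def using w(1) by metis
  then show ?thesis by blast
qed

text \<open>A horizontal direction paired with a descending one is an end of a horizontal top edge.
  Neighbours along the top and the bottom edge supply the remaining corners; the base chart is the
  bottom left one, hence \<open>mB = 0\<close>.\<close>

lemma four_charts_if_antipodal:
  assumes "dirs A B" "snd A = 0" "snd B < 0"
  shows "\<exists>mB rB mT rT. four_charts dirs mB rB mT rT"
proof -
  obtain v d where v: "vchart v (of_int (fst A) *\<^sub>R a0 + of_int (snd A) *\<^sub>R b0) (of_int (fst B) *\<^sub>R a0 + of_int (snd B) *\<^sub>R b0) d"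
    using assms(1) unfolding dirs_def by blast
  have "\<bar>fst A * snd B\<bar> = 1" using dirs_det[OF v] assms(2) by simp
  then have "\<bar>fst A\<bar> * \<bar>snd B\<bar> = 1" by (simp add: abs_mult)
  then have "\<bar>snd B\<bar> = 1 \<and> \<bar>fst A\<bar> = 1" using zmult_eq_1_iff[of "\<bar>fst A\<bar>" "\<bar>snd B\<bar>"] by linarith
  then have sB: "snd B = -1" and fA: "fst A = 1 \<or> fst A = -1" using assms(3) by auto
  obtain y1 where y1: "dirs (-1,0) (y1,1)" using dirs_adjacent[OF dirs_base] by auto
  obtain y where y: "dirs (- fst A, 0) (fst B + y * fst A, -1)" using dirs_adjacent[OF assms(1)] assms(2) sB by auto
  have A: "dirs (fst A, 0) (fst B, -1)" using assms sB by (metis prod.collapse)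
  have "\<exists>m r. dirs (1,0) (m,-1) \<and> dirs (-1,0) (r,-1)" using fA y A by auto
  then obtain m r where "dirs (1,0) (m,-1)" "dirs (-1,0) (r,-1)" by blast
  then have "four_charts dirs 0 y1 (- m) (- r)" unfolding four_charts_def using dirs_base y1 by simp
  then show ?thesis by blast
qed

lemma linear_point: "linear (\<lambda>p :: real \<times> real. fst p *\<^sub>R a0 + snd p *\<^sub>R b0)"
  by (intro linearI) (auto simp: algebra_simps)

lemma hull_point: "convex hull (point z ` A) = point z ` (convex hull A)"
proof -
  have *: "point z ` B = (+) (v0 + z *\<^sub>R d0) ` ((\<lambda>p. fst p *\<^sub>R a0 + snd p *\<^sub>R b0) ` B)" for B
    unfolding image_image point_def by (intro image_cong) (simp_all add: algebra_simps)
  show ?thesis by (simp only: * convex_hull_translation convex_hull_linear_image[OF linear_point])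
qed

lemma convex_slice: "convex (slice z)"
proof -
  have "(1-t) *\<^sub>R p + t *\<^sub>R q \<in> slice z" if "p \<in> slice z" "q \<in> slice z" "0 \<le> t" "t \<le> 1" for p q t
  proof -
    have "(1-t) *\<^sub>R point z p + t *\<^sub>R point z q \<in> P"
      using that unfolding slice_def by (intro convexD[OF convex]) auto
    then show ?thesis unfolding point_comb slice_def by (simp add: algebra_simps)
  qed
  then show ?thesis unfolding convex_alt by blast
qed

lemma slice_lattice_polygon:
  assumes i: "0 \<le> i" "i \<le> height"
  shows "\<exists>V. finite V \<and> (\<forall>v\<in>V. int_pt v) \<and> slice (of_int i) = convex hull V"
proof -
  let ?C = "{(v,d). \<exists>a b. vchart v a b d}"
  let ?L = "\<lambda>(v,d). v + of_int i *\<^sub>R d :: real ^ 3"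
  define V where "V = {p. point (of_int i) p \<in> ?L ` ?C}"
  have iz: "0 \<le> real_of_int i" "real_of_int i \<le> of_int height" using i by simp_all
  have inj: "inj (point (of_int i))" by (rule injI) simp
  have "V = point (of_int i) -` (?L ` ?C)" by (simp only: V_def vimage_def)
  then have fin: "finite V" using finite_vimageI[OF finite_imageI[OF finite_vcharts] inj] by simp
  have *: "\<exists>p. int_pt p \<and> v + of_int i *\<^sub>R d = point (of_int i) p" if "vchart v a b d" for v a b d
  proof -
    obtain vx vy dx dy :: int where "v = v0 + of_int vx *\<^sub>R a0 + of_int vy *\<^sub>R b0" "d = d0 + of_int dx *\<^sub>R a0 + of_int dy *\<^sub>R b0"
      using vchart_coords[OF \<open>vchart v a b d\<close>] .
    then have "v + of_int i *\<^sub>R d = point (of_int i) (of_int (vx + i * dx), of_int (vy + i * dy))" by (simp add: point_def algebra_simps)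
    then show ?thesis by (intro exI[of _ "(of_int (vx + i * dx), of_int (vy + i * dy))"]) (simp add: int_pt_def)
  qed
  have ip: "int_pt p" if "p \<in> V" for p
  proof -
    obtain v a b d where "vchart v a b d" "point (of_int i) p = v + of_int i *\<^sub>R d" using \<open>p \<in> V\<close> unfolding V_def by auto
    then show ?thesis using *[of v a b d] by auto
  qed
  have LV: "?L ` ?C = point (of_int i) ` V"
  proof
    show "?L ` ?C \<subseteq> point (of_int i) ` V"
    proof
      fix x assume x: "x \<in> ?L ` ?C"
      then obtain v a b d where "vchart v a b d" "x = v + of_int i *\<^sub>R d" by auto
      then obtain p where p: "x = point (of_int i) p" using * by blast
      then have "p \<in> V" using x by (simp add: V_def)
      then show "x \<in> point (of_int i) ` V" using p by blast
    qed
  qed (auto simp: V_def)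
  have VS: "V \<subseteq> slice (of_int i)"
  proof
    fix p assume "p \<in> V"
    then obtain v a b d where v: "vchart v a b d" "point (of_int i) p = v + of_int i *\<^sub>R d" unfolding V_def by auto
    have "v + of_int i *\<^sub>R d \<in> P" using along_edge[OF _ _ iz] vchart_lattice(11)[OF v(1)] extreme_mem[OF height(3)[OF v(1)]] by blast
    then show "p \<in> slice (of_int i)" using v(2) by (simp add: slice_def)
  qed
  have "slice (of_int i) = convex hull V"
  proof
    show "convex hull V \<subseteq> slice (of_int i)" using VS convex_slice by (rule hull_minimal)
    show "slice (of_int i) \<subseteq> convex hull V"
    proof
      fix p assume "p \<in> slice (of_int i)"
      then have "point (of_int i) p \<in> P" by (simp add: slice_def)
      from slice_hull[OF this point_height] have "point (of_int i) p \<in> ?L ` (convex hull ?C)" .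
      also have "?L ` (convex hull ?C) = convex hull (?L ` ?C)"
        by (rule convex_hull_linear_image) (intro linearI, auto simp: algebra_simps)
      also have "\<dots> = point (of_int i) ` (convex hull V)" unfolding LV hull_point ..
      finally show "p \<in> convex hull V" by auto
    qed
  qed
  then show ?thesis using fin ip by blast
qed

text \<open>The weights that express \<open>x\<close> through the points \<open>v + z d\<close>
  define a point in every other slice as well; those at the two adjacent integral heights are
  \<open>p\<close> and \<open>q\<close>.\<close>

lemma prism_point_split:
  assumes x: "x \<in> P"
  obtains i :: int and t p q where "0 \<le> i" "i + 1 \<le> height" "0 \<le> t" "t \<le> 1" "p \<in> slice (of_int i)" "q \<in> slice (of_int (i+1))"
    "x = point (of_int i + t) ((1-t) *\<^sub>R p + t *\<^sub>R q)"
proof -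
  define z where "z = (n \<bullet> x - c) / unit_height"
  have nz: "n \<bullet> x = c + z * unit_height" using unit_height_pos by (simp add: z_def)
  have "0 * unit_height \<le> z * unit_height" "z * unit_height \<le> of_int height * unit_height"
    using bounds(1)[OF x] bounds(2)[OF x] nz height(2) by linarith+
  then have z: "0 \<le> z" "z \<le> of_int height" using unit_height_pos by (simp_all only: mult_le_cancel_right_pos)
  \<comment> \<open>The minimum assigns the top facet to the last slab, with
    \<open>t = 1\<close>.\<close>
  define i where "i = min \<lfloor>z\<rfloor> (height - 1)"
  define t where "t = z - of_int i"
  have i: "0 \<le> i" "i + 1 \<le> height" using z height(1) by (auto simp: i_def le_floor_iff)
  have "real_of_int i \<le> \<lfloor>z\<rfloor>" unfolding i_def by simp
  then have t0: "0 \<le> t" unfolding t_def by linarith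
  have t1: "t \<le> 1"
  proof (cases "\<lfloor>z\<rfloor> \<le> height - 1")
    case True then have "i = \<lfloor>z\<rfloor>" by (simp add: i_def)
    then show ?thesis unfolding t_def by linarith
  next
    case False then have "i = height - 1" by (simp add: i_def)
    then show ?thesis unfolding t_def using z by simp
  qed
  let ?C = "{(v,d). \<exists>a b. vchart v a b d}"
  let ?L = "\<lambda>z. \<lambda>(v,d). v + z *\<^sub>R d :: real ^ 3"
  obtain m where m: "m \<in> convex hull ?C" "x = ?L z m" using slice_hull[OF x nz] by blast
  have in_slice: "\<exists>p \<in> slice y. ?L y m = point y p" if y: "0 \<le> y" "y \<le> of_int height" for y
  proof -
    let ?H = "P \<inter> {x. n \<bullet> x = c + y * unit_height}"
    have "?L y ` ?C \<subseteq> ?H"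
    proof
      fix x assume "x \<in> ?L y ` ?C"
      then obtain v a b d where v: "vchart v a b d" "x = v + y *\<^sub>R d" by auto
      have "x \<in> P" unfolding v(2) using along_edge[OF _ _ y] vchart_lattice(11)[OF v(1)] extreme_mem[OF height(3)[OF v(1)]] by blast
      moreover have "n \<bullet> x = c + y * unit_height" unfolding v(2) using vchart_lattice[OF v(1)] vchart_unit_height[OF v(1)]
        by (simp add: inner_add_right)
      ultimately show "x \<in> ?H" by simp
    qed
    moreover have "convex ?H" using convex by (intro convex_Int convex_hyperplane)
    ultimately have "convex hull (?L y ` ?C) \<subseteq> ?H" by (rule hull_minimal)
    moreover have "?L y ` (convex hull ?C) = convex hull (?L y ` ?C)"
      by (rule convex_hull_linear_image) (intro linearI, auto simp: algebra_simps)
    ultimately have "?L y m \<in> ?H" using m(1) by blast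
    then obtain p where "?L y m = point y p" "?L y m \<in> P" using point_exists[of "?L y m" y] by blast
    then show ?thesis by (metis mem_Collect_eq slice_def)
  qed
  obtain p where p: "p \<in> slice (of_int i)" "?L (of_int i) m = point (of_int i) p" using in_slice[of "of_int i"] i by auto
  obtain q where q: "q \<in> slice (of_int (i+1))" "?L (of_int (i+1)) m = point (of_int (i+1)) q" using in_slice[of "of_int (i+1)"] i by auto
  have "x = (1-t) *\<^sub>R ?L (of_int i) m + t *\<^sub>R ?L (of_int (i+1)) m"
    unfolding m(2) t_def by (cases m) (simp add: algebra_simps)
  also have "\<dots> = point (of_int i + t) ((1-t) *\<^sub>R p + t *\<^sub>R q)" unfolding p(2) q(2) point_comb by (simp add: algebra_simps)
  finally show ?thesis using that i t0 t1 p(1) q(1) by blast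
qed

end

section \<open>Unimodular tetrahedra in a slab\<close>

context smooth_prism_base
begin

lemma point_int_lattice: "int_pt r \<Longrightarrow> point (of_int z) r \<in> int_lattice"
  unfolding int_pt_def point_def using base_facts(1-4) by (auto elim!: Ints_cases intro!: int_lattice_add int_lattice_scale)

lemma unimodular_tetrahedron_points:
  assumes r: "int_pt r0" "int_pt r1" "int_pt r2" "int_pt r3"
    and P: "point (of_int z0) r0 \<in> P" "point (of_int z1) r1 \<in> P" "point (of_int z2) r2 \<in> P" "point (of_int z3) r3 \<in> P"
    and det: "\<bar>fst (r1 - r0) * (snd (r2 - r0) * (z3 - z0) - snd (r3 - r0) * (z2 - z0))
      - snd (r1 - r0) * (fst (r2 - r0) * (z3 - z0) - fst (r3 - r0) * (z2 - z0))
      + (z1 - z0) * (fst (r2 - r0) * snd (r3 - r0) - fst (r3 - r0) * snd (r2 - r0))\<bar> = 1"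
  shows "unimodular_tetrahedron (convex hull {point z0 r0, point z1 r1, point z2 r2, point z3 r3})"
    and "convex hull {point z0 r0, point z1 r1, point z2 r2, point z3 r3} \<subseteq> P"
proof -
  have ex: "\<exists>x y :: int. r = (of_int x, of_int y)" if "int_pt r" for r
    using that unfolding int_pt_def by (metis Ints_cases prod.collapse)
  obtain x0 y0 :: int where 0: "r0 = (of_int x0, of_int y0)" using ex r by blast
  obtain x1 y1 :: int where 1: "r1 = (of_int x1, of_int y1)" using ex r by blast
  obtain x2 y2 :: int where 2: "r2 = (of_int x2, of_int y2)" using ex r by blast
  obtain x3 y3 :: int where 3: "r3 = (of_int x3, of_int y3)" using ex r by blast
  have diff: "point (of_int z) (of_int x, of_int y) - point (of_int z') (of_int x', of_int y') =
    of_int (x - x') *\<^sub>R a0 + of_int (y - y') *\<^sub>R b0 + of_int (z - z') *\<^sub>R d0" for x y z x' y' z' :: int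
    unfolding point_def by (simp add: algebra_simps)
  have "\<bar>real_of_int ((x1 - x0) * ((y2 - y0) * (z3 - z0) - (y3 - y0) * (z2 - z0)) - (y1 - y0) * ((x2 - x0) * (z3 - z0) - (x3 - x0) * (z2 - z0))
      + (z1 - z0) * ((x2 - x0) * (y3 - y0) - (x3 - x0) * (y2 - y0)))\<bar> = 1"
    using det unfolding 0 1 2 3 by simp
  then have "\<bar>(x1 - x0) * ((y2 - y0) * (z3 - z0) - (y3 - y0) * (z2 - z0)) - (y1 - y0) * ((x2 - x0) * (z3 - z0) - (x3 - x0) * (z2 - z0))
      + (z1 - z0) * ((x2 - x0) * (y3 - y0) - (x3 - x0) * (y2 - y0))\<bar> = 1" by (metis of_int_abs of_int_eq_1_iff)
  from lattice_basis3_change[OF base_facts(5) this]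
  have "lattice_basis3 (point z1 r1 - point z0 r0) (point z2 r2 - point z0 r0) (point z3 r3 - point z0 r0)"
    unfolding 0 1 2 3 diff .
  then show "unimodular_tetrahedron (convex hull {point z0 r0, point z1 r1, point z2 r2, point z3 r3})"
    using r by (intro unimodular_tetrahedron_hull point_int_lattice)
  show "convex hull {point z0 r0, point z1 r1, point z2 r2, point z3 r3} \<subseteq> P"
    using P convex by (intro hull_minimal) auto
qed

lemma slice_unimodular_triangle:
  assumes i: "0 \<le> i" "i \<le> height" and p: "p \<in> slice (of_int i)"
  obtains a b e where "int_pt a" "int_pt b" "int_pt e" "point (of_int i) a \<in> P" "point (of_int i) b \<in> P" "point (of_int i) e \<in> P"
    "\<bar>det2 (b - a) (e - a)\<bar> = 1" "point (of_int i) p \<in> convex hull {point (of_int i) a, point (of_int i) b, point (of_int i) e}"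
proof -
  obtain V where V: "\<forall>v\<in>V. int_pt v" "slice (of_int i) = convex hull V" using slice_lattice_polygon[OF i] by blast
  obtain w where w: "chart (slice (of_int i)) w (1,0) (0,1)" using dirs_chart[OF dirs_base i] by blast
  note m = chart_mem[OF w]
  have d: "det2 ((of_int (fst w + fst (1,0)), of_int (snd w + snd (1,0))) - (of_int (fst w), of_int (snd w)))
    ((of_int (fst w + fst (0,1)), of_int (snd w + snd (0,1))) - (of_int (fst w), of_int (snd w))) \<noteq> 0"
    by (simp add: det2_def)
  obtain a b c where abc: "int_pt a" "int_pt b" "int_pt c" "{a,b,c} \<subseteq> slice (of_int i)" "\<bar>det2 (b - a) (c - a)\<bar> = 1" "p \<in> convex hull {a,b,c}"
    using polygon_unimodular_triangle[OF _ V(2) m d p] V(1) by blast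
  have "point (of_int i) p \<in> point (of_int i) ` (convex hull {a,b,c})" using abc(6) by blast
  then have "point (of_int i) p \<in> convex hull {point (of_int i) a, point (of_int i) b, point (of_int i) c}"
    unfolding hull_point[symmetric] by simp
  then show ?thesis using that abc by (simp add: slice_def)
qed

lemma covered_by_tetrahedron:
  assumes f: "triangle_charts dirs \<or> (\<exists>mB rB mT rT. four_charts dirs mB rB mT rT)" and x: "x \<in> P"
  shows "\<exists>T. unimodular_tetrahedron T \<and> T \<subseteq> P \<and> x \<in> T"
proof -
  obtain i :: int and t p q where i: "0 \<le> i" "i + 1 \<le> height" and t: "0 \<le> t" "t \<le> 1"
    and pq: "p \<in> slice (of_int i)" "q \<in> slice (of_int (i+1))" and x': "x = point (of_int i + t) ((1-t) *\<^sub>R p + t *\<^sub>R q)"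
    using prism_point_split[OF x] .
  have i': "i \<le> height" "0 \<le> i + 1" using i by auto
  obtain V where V: "finite V" "\<forall>v\<in>V. int_pt v" "slice (of_int i) = convex hull V" using slice_lattice_polygon[OF i(1) i'(1)] by blast
  obtain V' where V': "finite V'" "\<forall>v\<in>V'. int_pt v" "slice (of_int (i+1)) = convex hull V'" using slice_lattice_polygon[OF i'(2) i(2)] by blast
  have "sum_cov t (slice (of_int i)) (slice (of_int (i+1))) ((1-t) *\<^sub>R p + t *\<^sub>R q)"
    by (rule slab_cover[OF V(1) V'(1) _ _ V(3) V'(3) _ _ f pq t])
      (use V(2) V'(2) dirs_chart[OF _ i(1) i'(1)] dirs_chart[OF _ i'(2) i(2)] in blast)+
  then obtain p' q' where pq': "p' \<in> slice (of_int i)" "q' \<in> slice (of_int (i+1))" "(1-t) *\<^sub>R p + t *\<^sub>R q = (1-t) *\<^sub>R p' + t *\<^sub>R q'"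
    and alt: "int_pt p' \<or> int_pt q' \<or>
      (\<exists>a\<in>slice (of_int i). \<exists>b\<in>slice (of_int i). \<exists>c\<in>slice (of_int (i+1)). \<exists>d\<in>slice (of_int (i+1)). int_pt a \<and> int_pt b \<and> int_pt c \<and> int_pt d \<and>
         p' \<in> closed_segment a b \<and> q' \<in> closed_segment c d \<and> \<bar>det2 (b - a) (d - c)\<bar> = 1)"
    unfolding sum_cov_def by blast
  have x: "x = (1-t) *\<^sub>R point (of_int i) p' + t *\<^sub>R point (of_int (i+1)) q'"
    unfolding x' pq'(3) point_comb by (simp add: algebra_simps)
  have inT: "x \<in> T" if "convex T" "point (of_int i) p' \<in> T" "point (of_int (i+1)) q' \<in> T" for T
    unfolding x using that t by (intro convexD) auto
  have P': "point (of_int i) p' \<in> P" "point (of_int (i+1)) q' \<in> P" using pq' by (simp_all add: slice_def)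
  from alt consider (1) "int_pt p'" | (2) "int_pt q'" | (3) a b c d where
    "a\<in>slice (of_int i)" "b\<in>slice (of_int i)" "c\<in>slice (of_int (i+1))" "d\<in>slice (of_int (i+1))" "int_pt a" "int_pt b" "int_pt c" "int_pt d"
    "p' \<in> closed_segment a b" "q' \<in> closed_segment c d" "\<bar>det2 (b - a) (d - c)\<bar> = 1" by blast
  then show ?thesis
  proof cases
    case 1
    obtain a b c where abc: "int_pt a" "int_pt b" "int_pt c" "point (of_int (i+1)) a \<in> P" "point (of_int (i+1)) b \<in> P" "point (of_int (i+1)) c \<in> P"
      "\<bar>det2 (b - a) (c - a)\<bar> = 1" "point (of_int (i+1)) q' \<in> convex hull {point (of_int (i+1)) a, point (of_int (i+1)) b, point (of_int (i+1)) c}"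
      using slice_unimodular_triangle[OF i'(2) i(2) pq'(2)] .
    \<comment> \<open>The apex comes last: the first three points have equal height, so the
      determinant reduces to the planar one.\<close>
    let ?T = "convex hull {point (of_int (i+1)) a, point (of_int (i+1)) b, point (of_int (i+1)) c, point (of_int i) p'}"
    have "(fst b - fst a) * (snd a - snd c) - (snd b - snd a) * (fst a - fst c) = - det2 (b - a) (c - a)"
      by (simp add: det2_def algebra_simps)
    then have det: "\<bar>(fst b - fst a) * (snd a - snd c) - (snd b - snd a) * (fst a - fst c)\<bar> = 1"
      using abc(7) by simp
    have "unimodular_tetrahedron ?T" "?T \<subseteq> P"
      using unimodular_tetrahedron_points[of a b c p' "i+1" "i+1" "i+1" i] 1 abc(1-6) P' det by simp_all
    moreover have "point (of_int (i+1)) q' \<in> ?T"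
      using abc(8) hull_mono[of "{point (of_int (i+1)) a, point (of_int (i+1)) b, point (of_int (i+1)) c}"
        "{point (of_int (i+1)) a, point (of_int (i+1)) b, point (of_int (i+1)) c, point (of_int i) p'}" convex] by blast
    moreover have "point (of_int i) p' \<in> ?T" by (rule hull_inc) simp
    ultimately show ?thesis using inT[of ?T] by blast
  next
    case 2
    obtain a b c where abc: "int_pt a" "int_pt b" "int_pt c" "point (of_int i) a \<in> P" "point (of_int i) b \<in> P" "point (of_int i) c \<in> P"
      "\<bar>det2 (b - a) (c - a)\<bar> = 1" "point (of_int i) p' \<in> convex hull {point (of_int i) a, point (of_int i) b, point (of_int i) c}"
      using slice_unimodular_triangle[OF i(1) i'(1) pq'(1)] .
    let ?T = "convex hull {point (of_int i) a, point (of_int i) b, point (of_int i) c, point (of_int (i+1)) q'}"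
    have "unimodular_tetrahedron ?T" "?T \<subseteq> P"
      using unimodular_tetrahedron_points[of a b c q' i i i "i+1"] 2 abc P' by (simp_all add: det2_def)
    moreover have "point (of_int i) p' \<in> ?T"
      using abc(8) hull_mono[of "{point (of_int i) a, point (of_int i) b, point (of_int i) c}"
        "{point (of_int i) a, point (of_int i) b, point (of_int i) c, point (of_int (i+1)) q'}" convex] by blast
    moreover have "point (of_int (i+1)) q' \<in> ?T" by (rule hull_inc) simp
    ultimately show ?thesis using inT[of ?T] by blast
  next
    case 3
    let ?T = "convex hull {point (of_int i) a, point (of_int i) b, point (of_int (i+1)) c, point (of_int (i+1)) d}"
    have inP: "point (of_int i) a \<in> P" "point (of_int i) b \<in> P" "point (of_int (i+1)) c \<in> P" "point (of_int (i+1)) d \<in> P"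
      using 3 by (simp_all add: slice_def)
    have "fst (b - a) * (snd (c - a) - snd (d - a)) - snd (b - a) * (fst (c - a) - fst (d - a)) = - det2 (b - a) (d - c)"
      by (simp add: det2_def algebra_simps)
    then have det: "\<bar>fst (b - a) * (snd (c - a) - snd (d - a)) - snd (b - a) * (fst (c - a) - fst (d - a))\<bar> = 1" using 3 by simp
    have "unimodular_tetrahedron ?T" "?T \<subseteq> P"
      using unimodular_tetrahedron_points[of a b c d i i "i+1" "i+1"] 3(5-8) inP det by simp_all
    moreover have "point (of_int i) p' \<in> ?T" "point (of_int (i+1)) q' \<in> ?T"
    proof -
      have s: "point z ` closed_segment u v = convex hull {point z u, point z v}" for z u v
        using hull_point[of z "{u,v}"] by (simp add: segment_convex_hull)
      have "point (of_int i) p' \<in> convex hull {point (of_int i) a, point (of_int i) b}"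
        unfolding s[symmetric] by (rule imageI[OF 3(9)])
      moreover have "convex hull {point (of_int i) a, point (of_int i) b} \<subseteq> ?T" by (intro hull_mono) auto
      ultimately show "point (of_int i) p' \<in> ?T" by blast
      have "point (of_int (i+1)) q' \<in> convex hull {point (of_int (i+1)) c, point (of_int (i+1)) d}"
        unfolding s[symmetric] by (rule imageI[OF 3(10)])
      moreover have "convex hull {point (of_int (i+1)) c, point (of_int (i+1)) d} \<subseteq> ?T" by (intro hull_mono) auto
      ultimately show "point (of_int (i+1)) q' \<in> ?T" by blast
    qed
    ultimately show ?thesis using inT[of ?T] by blast
  qed
qed

end

context smooth_prism
begin

text \<open>A chart with largest \<open>b0\<close>-coordinate has no rising direction. If one of its
  directions is horizontal, there is an edge parallel to the base edge. Otherwise its vertex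
  \<open>v1\<close> becomes the origin; the old base edge then maximises a functional with the
  positive coefficients \<open>- snd X\<close>, \<open>- snd Y\<close>, as
  \<open>charts_dichotomy\<close> requires.\<close>

lemma smooth_prism_covered:
  assumes x: "x \<in> P"
  shows "\<exists>T. unimodular_tetrahedron T \<and> T \<subseteq> P \<and> x \<in> T"
proof -
  obtain v0 a0 b0 d0 where v0: "vchart v0 a0 b0 d0" using vchart_some by blast
  interpret A: smooth_prism_base P n c c' v0 a0 b0 d0 by unfold_locales (rule v0)
  obtain X Y where XY: "A.dirs X Y" "snd X \<le> 0" "snd Y \<le> 0" using A.dirs_minimizing[of 0 "-1"] by auto
  obtain v1 d1 where v1: "vchart v1 (of_int (fst X) *\<^sub>R a0 + of_int (snd X) *\<^sub>R b0) (of_int (fst Y) *\<^sub>R a0 + of_int (snd Y) *\<^sub>R b0) d1"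
    using XY(1) unfolding A.dirs_def by blast
  have nz: "\<not> (snd X = 0 \<and> snd Y = 0)" using A.dirs_det[OF v1] by auto
  consider "snd X = 0" "snd Y < 0" | "snd Y = 0" "snd X < 0" | "snd X < 0" "snd Y < 0" using XY nz by linarith
  then show ?thesis
  proof cases
    case 1
    show ?thesis using A.covered_by_tetrahedron[OF _ x] A.four_charts_if_antipodal[OF XY(1) 1] by blast
  next
    case 2
    show ?thesis using A.covered_by_tetrahedron[OF _ x] A.four_charts_if_antipodal[OF A.dirs_sym[OF XY(1)] 2] by blast
  next
    case 3
    let ?a = "of_int (fst X) *\<^sub>R a0 + of_int (snd X) *\<^sub>R b0" and ?b = "of_int (fst Y) *\<^sub>R a0 + of_int (snd Y) *\<^sub>R b0"
    interpret B: smooth_prism_base P n c c' v1 ?a ?b d1 by unfold_locales (rule v1)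
    \<comment> \<open>The same corner with its directions exchanged, for the case that the parallel
      edges are vertical in \<open>B\<close>.\<close>
    interpret C: smooth_prism_base P n c c' v1 ?b ?a d1 by unfold_locales (rule vchart_sym[OF v1])
    have h: "0 \<le> (0::int)" "0 \<le> height" using height(1) by auto
    obtain \<beta> where be: "\<beta> \<bullet> b0 = 1" "\<beta> \<bullet> a0 = 0" "\<beta> \<bullet> d0 = 0"
      using lattice_basis3_dual[OF lattice_basis3_perm(1)[OF A.base_facts(5)]] by metis
    have bP: "\<beta> \<bullet> v0 \<le> \<beta> \<bullet> w" if "w \<in> P" for w
    proof -
      obtain i j k where "j \<ge> 0" "w = v0 + i *\<^sub>R a0 + j *\<^sub>R b0 + k *\<^sub>R d0" using vchart_tangent[OF v0 \<open>w \<in> P\<close>] by metis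
      then show ?thesis by (simp add: inner_add_right be)
    qed
    have bB: "\<beta> \<bullet> B.point 0 p = \<beta> \<bullet> v1 - (of_int (- snd X) * fst p + of_int (- snd Y) * snd p)" for p
      unfolding B.point_def by (simp add: inner_add_right be algebra_simps)
    have va: "v0 + a0 \<in> P" using vchart_edge[OF v0, of a0] by blast
    obtain s where s: "v0 = B.point 0 s" using B.point_exists[of v0 0] A.base_facts by auto
    \<comment> \<open>\<open>s\<close> and \<open>r\<close> are two points of the old base edge in
      the new coordinates; they are the two maximisers demanded by
      \<open>charts_dichotomy\<close>.\<close>
    obtain r where r: "v0 + a0 = B.point 0 r" using B.point_exists[of "v0 + a0" 0] A.base_facts by (auto simp: inner_add_right)
    have "a0 \<noteq> 0" using lattice_basis3_independent(1)[OF A.base_facts(5)] dependent_zero by auto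
    then have sr: "(fst s, snd s) \<noteq> (fst r, snd r)" using s r by auto
    have bs: "\<beta> \<bullet> v0 = \<beta> \<bullet> v1 - (of_int (- snd X) * fst s + of_int (- snd Y) * snd s)" using bB[of s] s by simp
    have br: "\<beta> \<bullet> v0 = \<beta> \<bullet> v1 - (of_int (- snd X) * fst r + of_int (- snd Y) * snd r)" using bB[of r] unfolding r[symmetric] inner_add_right be by simp
    have chart0: "chart (B.slice (of_int 0)) (0,0) (1,0) (0,1)"
      using B.slice_chart[where v = v1 and A = "(1,0)" and B = "(0,1)" and d = d1 and i = 0 and vx = 0 and vy = 0 and dx = 0 and dy = 0] v1 h
      by simp
    have dich: "(\<exists>a b. B.dirs a b \<and> fst a = 0 \<and> fst b = -1) \<or> (\<exists>a b. B.dirs a b \<and> snd a = 0 \<and> snd b = -1) \<or> triangle_charts B.dirs"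
    proof (rule charts_dichotomy[where S = "B.slice (of_int 0)" and p = "- snd X" and q = "- snd Y" and
          ?s1.0 = "fst s" and ?s2.0 = "snd s" and ?r1.0 = "fst r" and ?r2.0 = "snd r"])
      show "\<exists>v. chart (B.slice (of_int 0)) v a b" if "B.dirs a b" for a b using B.dirs_chart[OF that h] .
      show "B.dirs b a" if "B.dirs a b" for a b using B.dirs_sym[OF that] .
      show "\<exists>a b. B.dirs a b \<and> 0 \<le> p * fst a + q * snd a \<and> 0 \<le> p * fst b + q * snd b" for p q :: int
        by (rule B.dirs_minimizing)
      show "chart (B.slice (of_int 0)) (0,0) (1,0) (0,1)" by (rule chart0)
      show "B.dirs (1,0) (0,1)" by (rule B.dirs_base)
      show "0 < - snd X" "0 < - snd Y" using 3 by simp_all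
      show "(fst s, snd s) \<in> B.slice (of_int 0)" "(fst r, snd r) \<in> B.slice (of_int 0)"
        using vchart_lattice(11)[OF v0] va s r by (simp_all add: B.slice_def)
      show "(fst s, snd s) \<noteq> (fst r, snd r)" by (rule sr)
      show "of_int (- snd X) * fst s + of_int (- snd Y) * snd s = of_int (- snd X) * fst r + of_int (- snd Y) * snd r" using bs br by simp
      show "of_int (- snd X) * x + of_int (- snd Y) * y \<le> of_int (- snd X) * fst s + of_int (- snd Y) * snd s"
        if "(x,y) \<in> B.slice (of_int 0)" for x y
      proof -
        have "\<beta> \<bullet> v0 \<le> \<beta> \<bullet> B.point 0 (x,y)" using bP that by (simp add: B.slice_def)
        then show ?thesis unfolding bB bs by simp
      qed
    qed
    then consider (a) a b where "B.dirs a b" "fst a = 0" "fst b = -1" | (b) a b where "B.dirs a b" "snd a = 0" "snd b = -1" | (c) "triangle_charts B.dirs"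
      by blast
    then show ?thesis
    proof cases
      case a
      then have "C.dirs (prod.swap a) (prod.swap b)" unfolding B.dirs_def C.dirs_def by (simp add: add.commute)
      from C.four_charts_if_antipodal[OF this] show ?thesis using a C.covered_by_tetrahedron[OF _ x] by simp
    next
      case b
      then show ?thesis using B.four_charts_if_antipodal[OF b(1,2)] B.covered_by_tetrahedron[OF _ x] by simp
    next
      case c
      then show ?thesis using B.covered_by_tetrahedron[OF _ x] by blast
    qed
  qed
qed

end

theorem corollary1p7:
  fixes P :: "(real ^ 3) set"
  assumes "lattice_prismatoid P"
    and "aff_dim P = 3"
    and "smooth_polytope P"
  shows "\<exists>\<T>. unimodular_cover \<T> P"
proof -
  have "prismatoid P" using assms(1) by (simp add: lattice_prismatoid_def)
  then obtain n c c' where *: "c < c'" "\<forall>x\<in>P. c \<le> n \<bullet> x \<and> n \<bullet> x \<le> c'"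
    "\<forall>v. v extreme_point_of P \<longrightarrow> n \<bullet> v = c \<or> n \<bullet> v = c'"
    "aff_dim (P \<inter> {x. n \<bullet> x = c}) \<ge> 2" "aff_dim (P \<inter> {x. n \<bullet> x = c'}) \<ge> 2"
    using prismatoid_supporting_planes[of P] assms(2) by auto
  interpret smooth_prism P n c c' by unfold_locales (use assms * in auto)
  have "unimodular_cover {T. unimodular_tetrahedron T \<and> T \<subseteq> P} P"
    unfolding unimodular_cover_def using smooth_prism_covered by blast
  then show ?thesis by blast
qed

end
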